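(* Consider either the asymmetric setting or the symmetric setting, and suppose assumptions (i)–(iv) (all stated in the context) hold, with $\|f\|_\mu>0$. Let $Y_n := n^{-1/2} f(\sqrt{n}\,X_n + Z_n)$ and $$A_n := \tau(f,\mu)\,\|f\|_\mu\, X_n + \frac{1}{\sqrt n} f(Z_n).$$ Then, as $n\to\infty$, $$\|Y_n - A_n\|_2 \xrightarrow{a.s.} 0 .$$
   Context: Notation. For $f:\mathbb{R}\to\mathbb{R}$ and a matrix $M$, $f(M)$ denotes elementwise application. For matrices, $\|\cdot\|_2$ is the operator norm; for vectors, $\|\cdot\|_\infty$ is the maximum absolute entry. $\sigma_i(M)$ is the $i$-th largest singular value of $M$, with corresponding unit left and right singular vectors $u_i(M),v_i(M)$. All random matrices ($n\ge1$) are defined on a common probability space. Asymmetric setting: $X_n,Z_n$ are real $n\times p$ matrices, $p=p_n$, $p/n\to\gamma\in(0,\infty)$ as $n\to\infty$. $X_n$ is deterministic, of fixed rank $r$, with fixed (not depending on $n$) singular values $\sigma_1(X_n)>\cdots>\sigma_r(X_n)>0$. The elements of $Z_n$ are i.i.d. with law $\mu$ (a probability measure on $\mathbb{R}$ not depending on $n$). Symmetric setting: $X_n,Z_n$ are real symmetric $n\times n$ matrices ($p=n$, $\gamma=1$). $X_n$ is deterministic, of fixed rank $r$, and its nonzero eigenvalues are fixed (not depending on $n$) and distinct. The upper triangular elements (including the diagonal) of $Z_n$ are i.i.d. with law $\mu$. Inner product: $\langle g,h\rangle_\mu=\int gh\,d\mu$, $\|g\|_\mu^2=\langle g,g\rangle_\mu$.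 When $\mu$ has infinite support and finite moments, $\{q_k\}_{k\ge0}$ denotes the orthonormal polynomials of $\mu$: $\deg q_k=k$, positive leading coefficient, $\langle q_k,q_\ell\rangle_\mu=\delta_{k\ell}$. Put $a_k:=\langle f,q_k\rangle_\mu$, $b_k:=\langle q_k',1\rangle_\mu$, $f_K(z):=\sum_{k=1}^K a_kq_k(z)$. Assumptions: (i) $\sqrt n\,\|u_i(X_n)\|_\infty\|v_i(X_n)\|_\infty\to0$ for $1\le i\le r$. (ii) $\mu$ has infinite support and finite moments of all orders. (iii) $f:\mathbb{R}\to\mathbb{R}$ is polynomially bounded and continuous $\mu$-almost everywhere. (iv) $a_0=0$, $\lim_{K\to\infty}\int(f(z)-f_K(z))^2d\mu(z)=0$, and $\lim_{K\to\infty}\lim_{x\to0}\frac1x\int\big(f(x+z)-f_K(x+z)\big)d\mu(z)=0$. Under (ii)–(iv) the series $\sum_{k\ge1}a_kb_k$ converges, and one defines $\tau(f,\mu):=\|f\|_\mu^{-1}\sum_{k=1}^\infty a_kb_k$. *)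

theory Defs
  imports
    "HOL-Probability.Probability"
    "HOL-Computational_Algebra.Polynomial"
    "Jordan_Normal_Form.Char_Poly"
    "Jordan_Normal_Form.DL_Rank"
begin

text \<open>
  Matrices have sizes that vary with \<open>n\<close>, so we use the carrier-based matrices of
  the AFP throughout. Their entries are indexed from 0, whereas singular
  values and singular vectors are indexed from 1.
\<close>

subsection \<open>Norms, singular values and singular vectors\<close>

definition l2_norm :: "real Matrix.vec \<Rightarrow> real" where
  "l2_norm v = sqrt (v \<bullet> v)"

text \<open>The inserted 0 only matters for the empty vector.\<close>

definition linf_norm :: "real Matrix.vec \<Rightarrow> real" where
  "linf_norm v = Max (insert 0 {\<bar>vec_index v i\<bar> | i. i < dim_vec v})"

definition op_norm :: "real mat \<Rightarrow> real" where
  "op_norm A = Sup {l2_norm (A *\<^sub>v v) | v. v \<in> carrier_vec (dim_col A) \<and> l2_norm v \<le> 1}"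

text \<open>Roots of the characteristic polynomial, with algebraic multiplicity.\<close>

definition eigenvalue_mset :: "real mat \<Rightarrow> real multiset" where
  "eigenvalue_mset A = proots (char_poly A)"

text \<open>
  The \<open>i\<close>-th largest singular value for \<open>1 \<le> i \<le> min (dim_row A) (dim_col A)\<close>: all roots of the
  characteristic polynomial of the Gram matrix are real and nonnegative, so the list below
  consists of the singular values with multiplicity (padded with zeros up to \<open>dim_col A\<close>).
\<close>

definition singular_value :: "nat \<Rightarrow> real mat \<Rightarrow> real" where
  "singular_value i A =
     rev (sorted_list_of_multiset (image_mset sqrt (eigenvalue_mset (transpose_mat A * A)))) ! (i - 1)"

text \<open>
  The vectors \<open>u i\<close>, \<open>v i\<close> are the unit left and right singular vectors for the \<open>r\<close> largest
  singular values. Orthogonality is automatic when these singular values are positive and distinct.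
  It is needed in the symmetric setting, where eigenvalues of opposite sign
  give a repeated singular value.
\<close>

definition singular_vectors ::
    "real mat \<Rightarrow> nat \<Rightarrow> (nat \<Rightarrow> real Matrix.vec) \<Rightarrow> (nat \<Rightarrow> real Matrix.vec) \<Rightarrow> bool" where
  "singular_vectors A r u v \<longleftrightarrow>
     (\<forall>i\<in>{1..r}. u i \<in> carrier_vec (dim_row A) \<and> v i \<in> carrier_vec (dim_col A) \<and>
        A *\<^sub>v v i = singular_value i A \<cdot>\<^sub>v u i \<and>
        transpose_mat A *\<^sub>v u i = singular_value i A \<cdot>\<^sub>v v i) \<and>
     (\<forall>i\<in>{1..r}. \<forall>j\<in>{1..r}.
        u i \<bullet> u j = of_bool (i = j) \<and> v i \<bullet> v j = of_bool (i = j))"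

subsection \<open>The two settings\<close>

definition iid_entries ::
    "'w measure \<Rightarrow> real measure \<Rightarrow> (nat \<times> nat) set \<Rightarrow> ('w \<Rightarrow> real mat) \<Rightarrow> bool" where
  "iid_entries M \<mu> I Z \<longleftrightarrow>
     prob_space.indep_vars M (\<lambda>_. borel) (\<lambda>ij \<omega>. Z \<omega> $$ ij) I \<and>
     (\<forall>ij\<in>I. distr M borel (\<lambda>\<omega>. Z \<omega> $$ ij) = \<mu>)"

text \<open>
  A matrix of rank \<open>r\<close> only exists once both dimensions are at least \<open>r\<close>, so rank and spectrum
  of \<open>X n\<close> are prescribed for all sufficiently large \<open>n\<close>. Nothing is assumed about the
  joint law of the \<open>Z n\<close> for different \<open>n\<close>.
\<close>

definition asymmetric_setting ::
    "'w measure \<Rightarrow> real measure \<Rightarrow> nat \<Rightarrow> (nat \<Rightarrow> real mat) \<Rightarrow> (nat \<Rightarrow> 'w \<Rightarrow> real mat) \<Rightarrow> bool" where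
  "asymmetric_setting M \<mu> r X Z \<longleftrightarrow>
     (\<exists>p :: nat \<Rightarrow> nat. \<exists>\<gamma> :: real. \<exists>s :: nat \<Rightarrow> real.
        \<gamma> > 0 \<and> (\<lambda>n. real (p n) / real n) \<longlonglongrightarrow> \<gamma> \<and>
        (\<forall>n\<ge>1. X n \<in> carrier_mat n (p n)) \<and>
        (\<forall>n\<ge>1. \<forall>\<omega>\<in>space M. Z n \<omega> \<in> carrier_mat n (p n)) \<and>
        (\<forall>i\<in>{1..r}. s i > 0) \<and> (\<forall>i\<in>{1..<r}. s i > s (i + 1)) \<and>
        (\<forall>\<^sub>F n in sequentially.
           vec_space.rank n (X n) = r \<and> (\<forall>i\<in>{1..r}. singular_value i (X n) = s i)) \<and>
        (\<forall>n\<ge>1. iid_entries M \<mu> ({..<n} \<times> {..<p n}) (Z n)))"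

definition symmetric_setting ::
    "'w measure \<Rightarrow> real measure \<Rightarrow> nat \<Rightarrow> (nat \<Rightarrow> real mat) \<Rightarrow> (nat \<Rightarrow> 'w \<Rightarrow> real mat) \<Rightarrow> bool" where
  "symmetric_setting M \<mu> r X Z \<longleftrightarrow>
     (\<exists>l :: nat \<Rightarrow> real.
        (\<forall>n\<ge>1. X n \<in> carrier_mat n n \<and> transpose_mat (X n) = X n) \<and>
        (\<forall>n\<ge>1. \<forall>\<omega>\<in>space M. Z n \<omega> \<in> carrier_mat n n \<and> transpose_mat (Z n \<omega>) = Z n \<omega>) \<and>
        (\<forall>i\<in>{1..r}. l i \<noteq> 0) \<and> inj_on l {1..r} \<and>
        (\<forall>\<^sub>F n in sequentially.
           vec_space.rank n (X n) = r \<and>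
           filter_mset (\<lambda>x. x \<noteq> 0) (eigenvalue_mset (X n)) = image_mset l (mset_set {1..r})) \<and>
        (\<forall>n\<ge>1. iid_entries M \<mu> {(i, j). i \<le> j \<and> j < n} (Z n)))"

subsection \<open>Orthogonal polynomials and the coefficient \<open>\<tau>\<close>\<close>

definition measure_support :: "real measure \<Rightarrow> real set" where
  "measure_support \<mu> = {x. \<forall>U. open U \<and> x \<in> U \<longrightarrow> emeasure \<mu> U > 0}"

text \<open>
  A function that is continuous \<open>\<mu>\<close>-almost everywhere need not be Borel, but it is
  measurable for the completion of \<open>\<mu>\<close>. Integrating it against \<open>\<mu>\<close> itself would give the junk
  value 0 if it is not Borel; for Borel functions the two integrals agree.
\<close>

definition inner_mu :: "real measure \<Rightarrow> (real \<Rightarrow> real) \<Rightarrow> (real \<Rightarrow> real) \<Rightarrow> real" where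
  "inner_mu \<mu> g h = (\<integral>z. g z * h z \<partial>completion \<mu>)"

definition norm_mu :: "real measure \<Rightarrow> (real \<Rightarrow> real) \<Rightarrow> real" where
  "norm_mu \<mu> g = sqrt (inner_mu \<mu> g g)"

definition orthonormal_polys :: "real measure \<Rightarrow> (nat \<Rightarrow> real poly) \<Rightarrow> bool" where
  "orthonormal_polys \<mu> q \<longleftrightarrow>
     (\<forall>k. degree (q k) = k \<and> lead_coeff (q k) > 0) \<and>
     (\<forall>k l. inner_mu \<mu> (poly (q k)) (poly (q l)) = of_bool (k = l))"

definition coeff_a :: "real measure \<Rightarrow> (nat \<Rightarrow> real poly) \<Rightarrow> (real \<Rightarrow> real) \<Rightarrow> nat \<Rightarrow> real" where
  "coeff_a \<mu> q f k = inner_mu \<mu> f (poly (q k))"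

definition coeff_b :: "real measure \<Rightarrow> (nat \<Rightarrow> real poly) \<Rightarrow> nat \<Rightarrow> real" where
  "coeff_b \<mu> q k = inner_mu \<mu> (poly (pderiv (q k))) (\<lambda>_. 1)"

definition trunc :: "real measure \<Rightarrow> (nat \<Rightarrow> real poly) \<Rightarrow> (real \<Rightarrow> real) \<Rightarrow> nat \<Rightarrow> real \<Rightarrow> real" where
  "trunc \<mu> q f K z = (\<Sum>k=1..K. coeff_a \<mu> q f k * poly (q k) z)"

text \<open>The series runs over \<open>k \<ge> 1\<close>, hence the shift by \<open>Suc\<close>.\<close>

definition tau :: "real measure \<Rightarrow> (nat \<Rightarrow> real poly) \<Rightarrow> (real \<Rightarrow> real) \<Rightarrow> real" where
  "tau \<mu> q f = (\<Sum>k. coeff_a \<mu> q f (Suc k) * coeff_b \<mu> q (Suc k)) / norm_mu \<mu> f"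

definition polynomially_bounded :: "(real \<Rightarrow> real) \<Rightarrow> bool" where
  "polynomially_bounded f \<longleftrightarrow> (\<exists>(C::real) (m::nat). \<forall>x. \<bar>f x\<bar> \<le> C * (1 + \<bar>x\<bar> ^ m))"

text \<open>
  In the last condition the integrals of the shifted functions have to make sense for \<open>x\<close> near 0
  (a measurability condition, automatic if \<open>f\<close> is Borel and polynomially bounded and \<open>\<mu>\<close> has
  moments of all orders), and the inner limit \<open>L K\<close> has to exist for every \<open>K\<close>.
\<close>

definition polynomial_approximation ::
    "real measure \<Rightarrow> (nat \<Rightarrow> real poly) \<Rightarrow> (real \<Rightarrow> real) \<Rightarrow> bool" where
  "polynomial_approximation \<mu> q f \<longleftrightarrow>
     coeff_a \<mu> q f 0 = 0 \<and>
     (\<lambda>K. \<integral>z. (f z - trunc \<mu> q f K z)\<^sup>2 \<partial>completion \<mu>) \<longlonglongrightarrow> 0 \<and>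
     (\<forall>\<^sub>F x in at 0. integrable (completion \<mu>) (\<lambda>z. f (x + z))) \<and>
     (\<exists>L :: nat \<Rightarrow> real.
        (\<forall>K. ((\<lambda>x. 1 / x * (\<integral>z. f (x + z) - trunc \<mu> q f K (x + z) \<partial>completion \<mu>))
                \<longlongrightarrow> L K) (at 0)) \<and>
        L \<longlonglongrightarrow> 0)"

subsection \<open>The transformed matrix and its linearization\<close>

definition Y_mat :: "(real \<Rightarrow> real) \<Rightarrow> (nat \<Rightarrow> real mat) \<Rightarrow> (nat \<Rightarrow> 'w \<Rightarrow> real mat) \<Rightarrow>
    nat \<Rightarrow> 'w \<Rightarrow> real mat" where
  "Y_mat f X Z n \<omega> = (1 / sqrt (real n)) \<cdot>\<^sub>m map_mat f (sqrt (real n) \<cdot>\<^sub>m X n + Z n \<omega>)"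

definition A_mat :: "real measure \<Rightarrow> (nat \<Rightarrow> real poly) \<Rightarrow> (real \<Rightarrow> real) \<Rightarrow>
    (nat \<Rightarrow> real mat) \<Rightarrow> (nat \<Rightarrow> 'w \<Rightarrow> real mat) \<Rightarrow> nat \<Rightarrow> 'w \<Rightarrow> real mat" where
  "A_mat \<mu> q f X Z n \<omega> =
     (tau \<mu> q f * norm_mu \<mu> f) \<cdot>\<^sub>m X n + (1 / sqrt (real n)) \<cdot>\<^sub>m map_mat f (Z n \<omega>)"

end

theory Submission
  imports Defs "HOL-Real_Asymp.Real_Asymp"
begin

text \<open>
  By (i), the entries \<open>x\<close> of \<open>sqrt n X\<^sub>n\<close> tend to 0 uniformly. By (iv), the mean of \<open>f (x + z) - f z\<close>
  is \<open>\<tau> \<parallel>f\<parallel> x + o(x)\<close>, so replacing the increments by their means costs only \<open>o(1)\<close> in Frobenius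
  norm. The centred increments form a random matrix with independent entries, vanishing variance and
  bounded high moments. After truncation at \<open>n ^ (1/4)\<close>, its operator norm is controlled by the
  trace moment of order \<open>2 q\<close> with \<open>q\<close> between \<open>log n\<close> and \<open>2 log n\<close>, and the tail bounds are
  summable.

  For matrices with entries bounded by 1 and variances at most \<open>d\<close>, the expected trace is at most
  \<open>1 / d\<close> times the sum of \<open>d\<close> to the number of vertices, over the closed walks that use no edge
  exactly once. This sum counts such walks in a random vertex set \<open>S\<close> that contains each vertex with
  probability \<open>d\<close>. On a fixed \<open>S\<close> the number of such walks is at most the expected trace for a
  matrix with independent entries uniform on \<open>2, -1, -1\<close>, for which a net argument gives the bound
  \<open>(C (q + card S)) ^ q\<close> up to a factor linear in \<open>card S\<close>.
\<close>

subsection \<open>Operator bounds and traces of powers\<close>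

text \<open>The centred increments are about n^2 entries of variance at most a small \<eta>, so
  their Frobenius norm is only known to be a small multiple of n, while a small multiple of sqrt n
  is required. Cancellation has to be used, and the trace method does this. Its usual core, the
  enumeration of walk shapes, is replaced by a comparison. An admissible walk has weight at most d
  to the number of its edges; a connected graph has at most one vertex more than edges, hence the
  factor 1 / d. The law 2, -1, -1 is centred and its other moments are at least 1, so the expected
  trace of the reference matrix dominates the number of admissible walks. Random signs would lose
  the walks that use an edge three times. The random set S has mean size N d, so the base of the
  final bound is of order q + N d. For entries bounded by b, rescaling turns this into q b^2 + N d,
  which must be a small multiple of n: with b = n^(1/4) and q of order log n the first term is o(n).
  The order q is a power of two because the operator norm is extracted from the trace by repeated
  squaring instead of the spectral theorem.\<close>

text \<open>An operator norm bound as a family of inequalities: no supremum has to be formed, and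
  index sets can be enlarged, restricted or reindexed directly in the sums.\<close>

definition mat_bound :: "'a set \<Rightarrow> 'b set \<Rightarrow> ('a \<Rightarrow> 'b \<Rightarrow> real) \<Rightarrow> real \<Rightarrow> bool" where
  "mat_bound I J A c \<longleftrightarrow> (\<forall>x. L2_set (\<lambda>i. \<Sum>j\<in>J. A i j * x j) I \<le> c * L2_set x J)"

lemma mat_boundI:
  "(\<And>x. L2_set (\<lambda>i. \<Sum>j\<in>J. A i j * x j) I \<le> c * L2_set x J) \<Longrightarrow> mat_bound I J A c"
  by (simp add: mat_bound_def)

lemma mat_boundD:
  "mat_bound I J A c \<Longrightarrow> L2_set (\<lambda>i. \<Sum>j\<in>J. A i j * x j) I \<le> c * L2_set x J"
  by (simp add: mat_bound_def)

lemma L2_set_sq: "(L2_set f A)\<^sup>2 = (\<Sum>i\<in>A. (f i)\<^sup>2)"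
  by (simp add: L2_set_def sum_nonneg)

lemma sum_mult_le_L2_set: "\<bar>\<Sum>i\<in>A. f i * g i\<bar> \<le> L2_set f A * L2_set g A"
proof -
  have "\<bar>\<Sum>i\<in>A. f i * g i\<bar> \<le> (\<Sum>i\<in>A. \<bar>f i\<bar> * \<bar>g i\<bar>)"
    by (simp add: sum_abs[THEN order_trans] abs_mult flip: abs_mult)
  also have "\<dots> \<le> L2_set f A * L2_set g A"
    by (rule L2_set_mult_ineq)
  finally show ?thesis .
qed

text \<open>Cauchy-Schwarz in each row.\<close>

lemma mat_bound_Frobenius:
  "mat_bound I J A (sqrt (\<Sum>i\<in>I. \<Sum>j\<in>J. (A i j)\<^sup>2))"
proof (rule mat_boundI)
  fix x
  have "(L2_set (\<lambda>i. \<Sum>j\<in>J. A i j * x j) I)\<^sup>2 = (\<Sum>i\<in>I. (\<Sum>j\<in>J. A i j * x j)\<^sup>2)"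
    by (rule L2_set_sq)
  also have "\<dots> \<le> (\<Sum>i\<in>I. (L2_set (A i) J * L2_set x J)\<^sup>2)"
    by (intro sum_mono) (metis abs_ge_zero power2_abs power_mono sum_mult_le_L2_set)
  also have "\<dots> = (\<Sum>i\<in>I. \<Sum>j\<in>J. (A i j)\<^sup>2) * (L2_set x J)\<^sup>2"
    by (simp add: power_mult_distrib L2_set_sq sum_distrib_right)
  also have "\<dots> = (sqrt (\<Sum>i\<in>I. \<Sum>j\<in>J. (A i j)\<^sup>2) * L2_set x J)\<^sup>2"
    by (simp add: power_mult_distrib sum_nonneg)
  finally show "L2_set (\<lambda>i. \<Sum>j\<in>J. A i j * x j) I \<le> sqrt (\<Sum>i\<in>I. \<Sum>j\<in>J. (A i j)\<^sup>2) * L2_set x J"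
    by (rule power2_le_imp_le) (simp add: sum_nonneg)
qed

lemma mat_bound_scale:
  assumes "mat_bound I J A c" "s \<ge> 0"
  shows "mat_bound I J (\<lambda>i j. s * A i j) (s * c)"
proof (rule mat_boundI)
  fix x
  have "L2_set (\<lambda>i. \<Sum>j\<in>J. s * A i j * x j) I = s * L2_set (\<lambda>i. \<Sum>j\<in>J. A i j * x j) I"
    using assms(2) by (simp add: L2_set_right_distrib sum_distrib_left mult.assoc)
  also have "\<dots> \<le> s * (c * L2_set x J)"
    using assms by (intro mult_left_mono mat_boundD)
  finally show "L2_set (\<lambda>i. \<Sum>j\<in>J. s * A i j * x j) I \<le> s * c * L2_set x J" by simp
qed

lemma mat_bound_cong:
  assumes "mat_bound I J A c" "\<And>i j. i \<in> I \<Longrightarrow> j \<in> J \<Longrightarrow> A i j = B i j"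
  shows "mat_bound I J B c"
proof (rule mat_boundI)
  fix x
  have "L2_set (\<lambda>i. \<Sum>j\<in>J. B i j * x j) I = L2_set (\<lambda>i. \<Sum>j\<in>J. A i j * x j) I"
    using assms(2) by (intro L2_set_cong sum.cong refl) auto
  then show "L2_set (\<lambda>i. \<Sum>j\<in>J. B i j * x j) I \<le> c * L2_set x J"
    using mat_boundD[OF assms(1), of x] by simp
qed

section \<open>Powers, traces and operator bounds of symmetric matrices\<close>

text \<open>Only the intermediate indices range over \<open>S\<close>; this is why facts about the
  endpoints assume \<open>i \<in> S\<close> or \<open>j \<in> S\<close>.\<close>

fun mat_power :: "'a set \<Rightarrow> ('a \<Rightarrow> 'a \<Rightarrow> real) \<Rightarrow> nat \<Rightarrow> 'a \<Rightarrow> 'a \<Rightarrow> real" where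
  "mat_power S A 0 i j = of_bool (i = j)"
| "mat_power S A (Suc k) i j = (\<Sum>l\<in>S. A i l * mat_power S A k l j)"

definition trace_power :: "'a set \<Rightarrow> ('a \<Rightarrow> 'a \<Rightarrow> real) \<Rightarrow> nat \<Rightarrow> real" where
  "trace_power S A k = (\<Sum>i\<in>S. mat_power S A k i i)"

lemma mat_power_add:
  assumes "finite S" "i \<in> S"
  shows "mat_power S A (k + m) i j = (\<Sum>l\<in>S. mat_power S A k i l * mat_power S A m l j)"
  using assms(2)
proof (induction k arbitrary: i)
  case 0
  have "(\<Sum>l\<in>S. mat_power S A 0 i l * mat_power S A m l j) = (\<Sum>l\<in>S. if l = i then mat_power S A m l j else 0)"
    by (intro sum.cong) auto
  with 0 assms(1) show ?case by simp
next
  case (Suc k)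
  have "mat_power S A (Suc k + m) i j = (\<Sum>l\<in>S. A i l * (\<Sum>l'\<in>S. mat_power S A k l l' * mat_power S A m l' j))"
    using Suc by simp
  also have "\<dots> = (\<Sum>l'\<in>S. \<Sum>l\<in>S. A i l * (mat_power S A k l l' * mat_power S A m l' j))"
    by (simp add: sum_distrib_left) (rule sum.swap)
  also have "\<dots> = (\<Sum>l'\<in>S. mat_power S A (Suc k) i l' * mat_power S A m l' j)"
    by (simp add: sum_distrib_right mult.assoc)
  finally show ?case .
qed

lemma mat_power_1:
  assumes "finite S" "j \<in> S"
  shows "mat_power S A 1 i j = A i j"
proof -
  have "(\<Sum>l\<in>S. A i l * of_bool (l = j)) = (\<Sum>l\<in>S. if l = j then A i l else 0)"
    by (intro sum.cong) auto
  then show ?thesis using assms by simp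
qed

lemma mat_power_symmetric:
  assumes "finite S" "\<And>i j. A i j = A j i" "i \<in> S" "j \<in> S"
  shows "mat_power S A k i j = mat_power S A k j i"
  using assms(3,4)
proof (induction k arbitrary: i j)
  case 0
  then show ?case by auto
next
  case (Suc k)
  have "mat_power S A (Suc k) i j = (\<Sum>l\<in>S. mat_power S A k j l * mat_power S A 1 l i)"
    unfolding mat_power.simps using Suc assms(1)
    by (intro sum.cong refl) (subst mat_power_1, auto simp: assms(2)[of i] mult.commute)
  also have "\<dots> = mat_power S A (k + 1) j i"
    by (rule mat_power_add[symmetric]) (use Suc assms in auto)
  finally show ?case by simp
qed

lemma mat_power_apply:
  assumes "finite S" "i \<in> S"
  shows "(\<Sum>j\<in>S. mat_power S A (k + m) i j * x j) =
     (\<Sum>l\<in>S. mat_power S A k i l * (\<Sum>j\<in>S. mat_power S A m l j * x j))"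
proof -
  have "(\<Sum>j\<in>S. mat_power S A (k + m) i j * x j) =
     (\<Sum>j\<in>S. \<Sum>l\<in>S. mat_power S A k i l * mat_power S A m l j * x j)"
    using assms by (simp add: mat_power_add sum_distrib_right)
  also have "\<dots> = (\<Sum>l\<in>S. \<Sum>j\<in>S. mat_power S A k i l * mat_power S A m l j * x j)"
    by (rule sum.swap)
  finally show ?thesis by (simp add: sum_distrib_left mult.assoc)
qed

lemma trace_power_even:
  assumes "finite S" "\<And>i j. A i j = A j i"
  shows "trace_power S A (2 * k) = (\<Sum>i\<in>S. \<Sum>j\<in>S. (mat_power S A k i j)\<^sup>2)"
  unfolding trace_power_def mult_2
  using assms by (auto intro!: sum.cong simp: mat_power_add power2_eq_square mat_power_symmetric)

text \<open>By symmetry the left side is the quadratic form of the power \<open>2 * k\<close> at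
  \<open>x\<close>, to which Cauchy-Schwarz applies.\<close>

lemma L2_set_mat_power_sq_le:
  assumes "finite S" "\<And>i j. A i j = A j i"
  shows "(L2_set (\<lambda>i. \<Sum>j\<in>S. mat_power S A k i j * x j) S)\<^sup>2
    \<le> L2_set x S * L2_set (\<lambda>i. \<Sum>j\<in>S. mat_power S A (2 * k) i j * x j) S"
proof -
  let ?y = "\<lambda>i. \<Sum>j\<in>S. mat_power S A k i j * x j"
  have "(L2_set ?y S)\<^sup>2 = (\<Sum>i\<in>S. ?y i * (\<Sum>j\<in>S. mat_power S A k i j * x j))"
    unfolding L2_set_sq by (simp add: power2_eq_square)
  also have "\<dots> = (\<Sum>i\<in>S. \<Sum>j\<in>S. x j * (mat_power S A k j i * ?y i))"
    using assms by (auto intro!: sum.cong simp: sum_distrib_left mult_ac mat_power_symmetric[of S A])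
  also have "\<dots> = (\<Sum>j\<in>S. x j * (\<Sum>i\<in>S. mat_power S A k j i * ?y i))"
    by (subst sum.swap) (simp add: sum_distrib_left)
  also have "\<dots> = (\<Sum>j\<in>S. x j * (\<Sum>i\<in>S. mat_power S A (2 * k) j i * x i))"
    unfolding mult_2 using assms by (intro sum.cong refl) (simp add: mat_power_apply)
  also have "\<dots> \<le> L2_set x S * L2_set (\<lambda>i. \<Sum>j\<in>S. mat_power S A (2 * k) i j * x j) S"
    using sum_mult_le_L2_set[of x "\<lambda>j. \<Sum>i\<in>S. mat_power S A (2 * k) j i * x i" S] by linarith
  finally show ?thesis .
qed

text \<open>Squaring m times gives |A x|^(2^m) <= |x|^(2^m - 1) |A^(2^m) x|, and the squared
  Frobenius norm of A^(2^m) is the trace. No eigenvalues are involved; the price is that the order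
  of the trace is twice a power of two.\<close>

lemma mat_bound_of_trace_power:
  assumes S: "finite S" and sym: "\<And>i j. A i j = A j i"
    and t: "t \<ge> 0" "trace_power S A (2 * 2 ^ m) \<le> t ^ (2 * 2 ^ m)"
  shows "mat_bound S S A t"
proof (rule mat_boundI)
  fix x
  let ?n = "\<lambda>k. L2_set (\<lambda>i. \<Sum>j\<in>S. mat_power S A k i j * x j) S"
  let ?X = "L2_set x S"
  have pow: "?n 1 ^ (2 ^ m) \<le> ?X ^ (2 ^ m - 1) * ?n (2 ^ m)" for m
  proof (induction m)
    case 0
    then show ?case by simp
  next
    case (Suc m)
    have "?n 1 ^ (2 ^ Suc m) = (?n 1 ^ (2 ^ m))\<^sup>2"
      by (simp add: power_mult[symmetric] mult.commute)
    also have "\<dots> \<le> (?X ^ (2 ^ m - 1) * ?n (2 ^ m))\<^sup>2"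
      by (intro power_mono Suc) simp
    also have "\<dots> = ?X ^ (2 * (2 ^ m - 1)) * (?n (2 ^ m))\<^sup>2"
      by (simp add: power_mult_distrib power_mult[symmetric] mult.commute)
    also have "\<dots> \<le> ?X ^ (2 * (2 ^ m - 1)) * (?X * ?n (2 * 2 ^ m))"
      by (intro mult_left_mono L2_set_mat_power_sq_le S sym) simp
    also have "\<dots> = ?X ^ Suc (2 * (2 ^ m - 1)) * ?n (2 ^ Suc m)"
      by (simp add: mult_ac)
    also have "Suc (2 * (2 ^ m - 1)) = 2 ^ Suc m - (1::nat)"
    proof -
      have "(2::nat) ^ m \<ge> 1" by simp
      then show ?thesis unfolding power_Suc by linarith
    qed
    finally show ?case .
  qed
  have "?n (2 ^ m) \<le> sqrt (\<Sum>i\<in>S. \<Sum>j\<in>S. (mat_power S A (2 ^ m) i j)\<^sup>2) * ?X"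
    using mat_bound_Frobenius[of S S "mat_power S A (2 ^ m)"] by (rule mat_boundD)
  also have "(\<Sum>i\<in>S. \<Sum>j\<in>S. (mat_power S A (2 ^ m) i j)\<^sup>2) = trace_power S A (2 * 2 ^ m)"
    by (rule trace_power_even[OF S sym, symmetric])
  also have "sqrt \<dots> * ?X \<le> sqrt (t ^ (2 * 2 ^ m)) * ?X"
    using t by (intro mult_right_mono real_sqrt_le_mono) auto
  also have "sqrt (t ^ (2 * 2 ^ m)) = t ^ (2 ^ m)"
    using t(1) by (simp add: power_mult mult.commute[of 2] real_sqrt_abs)
  finally have "?n 1 ^ (2 ^ m) \<le> ?X ^ (2 ^ m - 1) * (t ^ (2 ^ m) * ?X)"
    by (intro order_trans[OF pow] mult_left_mono) auto
  also have "\<dots> = t ^ (2 ^ m) * ?X ^ Suc (2 ^ m - 1)"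
    by (simp only: power_Suc mult_ac)
  also have "\<dots> = (t * ?X) ^ (2 ^ m)"
    by (simp add: power_mult_distrib del: power_Suc)
  finally have "?n 1 \<le> t * ?X"
    using t by (subst (asm) power_mono_iff) auto
  moreover have "?n 1 = L2_set (\<lambda>i. \<Sum>j\<in>S. A i j * x j) S"
    using S by (intro L2_set_cong refl sum.cong) (simp del: mat_power.simps One_nat_def add: mat_power_1)
  ultimately show "L2_set (\<lambda>i. \<Sum>j\<in>S. A i j * x j) S \<le> t * ?X"
    by simp
qed

lemma mat_bound_mat_power:
  assumes S: "finite S" and b: "mat_bound S S A c" "c \<ge> 0"
  shows "mat_bound S S (mat_power S A k) (c ^ k)"
proof (induction k)
  case 0
  show ?case
  proof (rule mat_boundI)
    fix x
    have "L2_set (\<lambda>i. \<Sum>j\<in>S. mat_power S A 0 i j * x j) S = L2_set x S"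
    proof (intro L2_set_cong refl)
      fix i assume "i \<in> S"
      have "(\<Sum>j\<in>S. mat_power S A 0 i j * x j) = (\<Sum>j\<in>S. if j = i then x j else 0)"
        by (intro sum.cong) auto
      with \<open>i \<in> S\<close> S show "(\<Sum>j\<in>S. mat_power S A 0 i j * x j) = x i" by simp
    qed
    then show "L2_set (\<lambda>i. \<Sum>j\<in>S. mat_power S A 0 i j * x j) S \<le> c ^ 0 * L2_set x S" by simp
  qed
next
  case (Suc k)
  show ?case
  proof (rule mat_boundI)
    fix x
    have "L2_set (\<lambda>i. \<Sum>j\<in>S. mat_power S A (Suc k) i j * x j) S =
      L2_set (\<lambda>i. \<Sum>l\<in>S. A i l * (\<Sum>j\<in>S. mat_power S A k l j * x j)) S"
    proof (intro L2_set_cong refl)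
      fix i assume "i \<in> S"
      have "(\<Sum>j\<in>S. mat_power S A (1 + k) i j * x j) =
        (\<Sum>l\<in>S. mat_power S A 1 i l * (\<Sum>j\<in>S. mat_power S A k l j * x j))"
        by (rule mat_power_apply) fact+
      also have "\<dots> = (\<Sum>l\<in>S. A i l * (\<Sum>j\<in>S. mat_power S A k l j * x j))"
        using S by (intro sum.cong refl) (simp only: mat_power_1)
      finally show "(\<Sum>j\<in>S. mat_power S A (Suc k) i j * x j) =
        (\<Sum>l\<in>S. A i l * (\<Sum>j\<in>S. mat_power S A k l j * x j))" by simp
    qed
    also have "\<dots> \<le> c * L2_set (\<lambda>l. \<Sum>j\<in>S. mat_power S A k l j * x j) S"
      by (rule mat_boundD[OF b(1)])
    also have "\<dots> \<le> c * (c ^ k * L2_set x S)"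
      by (intro mult_left_mono mat_boundD[OF Suc] b)
    finally show "L2_set (\<lambda>i. \<Sum>j\<in>S. mat_power S A (Suc k) i j * x j) S \<le> c ^ Suc k * L2_set x S"
      by simp
  qed
qed

text \<open>The trace is the squared Frobenius norm of the power \<open>k\<close>, and each column
  of that power is the image of a unit vector.\<close>

lemma trace_power_le_of_mat_bound:
  assumes S: "finite S" and sym: "\<And>i j. A i j = A j i" and b: "mat_bound S S A c" "c \<ge> 0"
  shows "trace_power S A (2 * k) \<le> real (card S) * c ^ (2 * k)"
proof -
  have "(\<Sum>i\<in>S. (mat_power S A k i j)\<^sup>2) \<le> c ^ (2 * k)" if "j \<in> S" for j
  proof -
    let ?x = "\<lambda>l. of_bool (l = j) :: real"
    have "(\<Sum>l\<in>S. mat_power S A k i l * ?x l) = mat_power S A k i j" for i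
    proof -
      have "(\<Sum>l\<in>S. mat_power S A k i l * ?x l) = (\<Sum>l\<in>S. if l = j then mat_power S A k i l else 0)"
        by (intro sum.cong) auto
      with that S show ?thesis by simp
    qed
    moreover have "L2_set ?x S = 1"
    proof -
      have "(\<Sum>l\<in>S. (?x l)\<^sup>2) = (\<Sum>l\<in>S. if l = j then 1 else 0)"
        by (intro sum.cong) auto
      with that S show ?thesis by (simp add: L2_set_def)
    qed
    ultimately have "L2_set (\<lambda>i. mat_power S A k i j) S \<le> c ^ k"
      using mat_boundD[OF mat_bound_mat_power[OF S b, of k], of ?x] by simp
    then have "(L2_set (\<lambda>i. mat_power S A k i j) S)\<^sup>2 \<le> (c ^ k)\<^sup>2"
      by (intro power_mono) auto
    then show ?thesis by (simp add: L2_set_sq power_mult[symmetric] mult.commute)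
  qed
  then have "(\<Sum>j\<in>S. \<Sum>i\<in>S. (mat_power S A k i j)\<^sup>2) \<le> (\<Sum>j\<in>S. c ^ (2 * k))"
    by (intro sum_mono)
  also have "(\<Sum>j\<in>S. \<Sum>i\<in>S. (mat_power S A k i j)\<^sup>2) = trace_power S A (2 * k)"
    by (subst sum.swap) (rule trace_power_even[OF S sym, symmetric])
  finally show ?thesis by simp
qed

subsection \<open>A net in the unit ball\<close>

text \<open>\<open>z\<close> stands for the point \<open>z / (2 * sqrt (card S))\<close>, so the
  condition on the squares places that point in the unit ball. The box exhibits the set inside a
  finite product, over which the cardinality bound factorizes.\<close>

definition grid_net :: "'a set \<Rightarrow> ('a \<Rightarrow> int) set" where
  "grid_net S = {z \<in> S \<rightarrow>\<^sub>E {- int (4 * card S)..int (4 * card S)}. (\<Sum>i\<in>S. (z i)\<^sup>2) \<le> 4 * int (card S)}"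

lemma finite_grid_net: "finite S \<Longrightarrow> finite (grid_net S)"
  by (rule finite_subset[OF _ finite_PiE[of S "\<lambda>_. {- int (4 * card S)..int (4 * card S)}"]])
    (auto simp: grid_net_def)

lemma sum_geometric_int_le: "(\<Sum>k\<in>{- int n..int n}. (1/2) ^ nat \<bar>k\<bar>) \<le> (3::real)"
proof -
  have "(\<Sum>k\<in>{- int n..int n}. (1/2) ^ nat \<bar>k\<bar>) = (3::real) - 2 * (1/2) ^ n"
  proof (induction n)
    case 0
    then show ?case by simp
  next
    case (Suc n)
    have "{- int (Suc n)..int (Suc n)} = insert (- int (Suc n)) (insert (int (Suc n)) {- int n..int n})"
      by auto
    then have "(\<Sum>k\<in>{- int (Suc n)..int (Suc n)}. (1/2) ^ nat \<bar>k\<bar>) =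
      (1/2) ^ Suc n + ((1/2) ^ Suc n + (\<Sum>k\<in>{- int n..int n}. (1/2) ^ nat \<bar>k\<bar> :: real))"
      by (simp del: of_nat_Suc power_Suc add: nat_int)
    with Suc show ?case by simp
  qed
  also have "\<dots> \<le> 3" by simp
  finally show ?thesis .
qed

lemma abs_le_square_int: "\<bar>k\<bar> \<le> k\<^sup>2" for k :: int
proof (cases "k = 0")
  case False
  then have "\<bar>k\<bar> * 1 \<le> \<bar>k\<bar> * \<bar>k\<bar>" by (intro mult_left_mono) auto
  then show ?thesis by (simp add: power2_eq_square)
qed simp

text \<open>The weights \<open>2 ^ (4 * card S - \<Sum>\<bar>z i\<bar>)\<close> are at least 1 on the net and factorize over the
  coordinates.\<close>
lemma card_grid_net_le:
  assumes "finite S"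
  shows "real (card (grid_net S)) \<le> 48 ^ card S"
proof -
  let ?r = "card S" and ?w = "\<lambda>k::int. (1/2) ^ nat \<bar>k\<bar> :: real"
  let ?P = "S \<rightarrow>\<^sub>E {- int (4 * ?r)..int (4 * ?r)}"
  have ge: "1 \<le> 2 ^ (4 * ?r) * (\<Prod>i\<in>S. ?w (z i))" if "z \<in> grid_net S" for z
  proof -
    have "(\<Sum>i\<in>S. \<bar>z i\<bar>) \<le> (\<Sum>i\<in>S. (z i)\<^sup>2)"
      by (intro sum_mono abs_le_square_int)
    also have "\<dots> \<le> 4 * int ?r"
      using that by (simp add: grid_net_def)
    finally have "(\<Sum>i\<in>S. nat \<bar>z i\<bar>) \<le> 4 * ?r"
      by (simp flip: zle_int)
    then have "(1/2::real) ^ (4 * ?r) \<le> (1/2) ^ (\<Sum>i\<in>S. nat \<bar>z i\<bar>)"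
      by (intro power_decreasing) auto
    then have "2 ^ (4 * ?r) * (1/2::real) ^ (4 * ?r) \<le> 2 ^ (4 * ?r) * (1/2) ^ (\<Sum>i\<in>S. nat \<bar>z i\<bar>)"
      by (intro mult_left_mono) auto
    then show ?thesis
      by (simp add: power_sum flip: power_mult_distrib)
  qed
  have "real (card (grid_net S)) = (\<Sum>z\<in>grid_net S. 1)"
    by simp
  also have "\<dots> \<le> (\<Sum>z\<in>grid_net S. 2 ^ (4 * ?r) * (\<Prod>i\<in>S. ?w (z i)))"
    by (intro sum_mono ge)
  also have "\<dots> \<le> (\<Sum>z\<in>?P. 2 ^ (4 * ?r) * (\<Prod>i\<in>S. ?w (z i)))"
    using assms by (intro sum_mono2 finite_PiE) (auto simp: grid_net_def intro!: mult_nonneg_nonneg prod_nonneg)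
  also have "\<dots> = 2 ^ (4 * ?r) * (\<Prod>i\<in>S. \<Sum>k\<in>{- int (4 * ?r)..int (4 * ?r)}. ?w k)"
    using assms unfolding sum_distrib_left[symmetric] by (subst prod_sum_PiE) auto
  also have "\<dots> \<le> 2 ^ (4 * ?r) * (\<Prod>i\<in>S. 3)"
    by (intro mult_left_mono prod_mono conjI sum_nonneg sum_geometric_int_le) auto
  \<comment> \<open>48 = 2^4 * 3: per coordinate, the normalizing factor of the weights times the
    bound 3 for the geometric series.\<close>
  also have "\<dots> = 48 ^ ?r"
    by (simp add: power_mult flip: power_mult_distrib)
  finally show ?thesis .
qed

text \<open>Rounding towards zero does not increase the norm, so the rounded point stays in the net.\<close>
lemma grid_net_approx:
  assumes S: "finite S" "S \<noteq> {}" and x: "L2_set x S \<le> 1"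
  obtains z where "z \<in> grid_net S"
    "L2_set (\<lambda>i. x i - real_of_int (z i) / (2 * sqrt (card S))) S \<le> 1 / 2"
proof -
  let ?s = "sqrt (card S)"
  have s: "?s > 0" using S by (simp add: card_gt_0_iff)
  define rd :: "real \<Rightarrow> int" where "rd y = (if y \<ge> 0 then \<lfloor>y\<rfloor> else - \<lfloor>- y\<rfloor>)" for y
  have rd1: "\<bar>y - rd y\<bar> \<le> 1" for y
  proof (cases "y \<ge> 0")
    case True
    then show ?thesis unfolding rd_def by simp linarith
  next
    case False
    then show ?thesis unfolding rd_def by simp linarith
  qed
  have rd2: "\<bar>real_of_int (rd y)\<bar> \<le> \<bar>y\<bar>" for y
  proof (cases "y \<ge> 0")
    case True
    then show ?thesis unfolding rd_def by simp
  next
    case False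
    then have "0 \<le> \<lfloor>- y\<rfloor>" by simp
    with False show ?thesis unfolding rd_def by simp
  qed
  define z where "z i = (if i \<in> S then rd (2 * ?s * x i) else undefined)" for i
  have sq: "(\<Sum>i\<in>S. (x i)\<^sup>2) \<le> 1"
    using x power_mono[OF x, of 2] by (simp add: L2_set_sq)
  have "real_of_int (\<Sum>i\<in>S. (z i)\<^sup>2) \<le> (\<Sum>i\<in>S. (2 * ?s * x i)\<^sup>2)"
    unfolding of_int_sum using rd2
    by (intro sum_mono) (simp add: z_def abs_le_square_iff[symmetric] del: abs_mult)
  also have "\<dots> = 4 * real (card S) * (\<Sum>i\<in>S. (x i)\<^sup>2)"
    by (simp add: power_mult_distrib sum_distrib_left)
  also have "\<dots> \<le> 4 * real (card S) * 1"
    using sq by (intro mult_left_mono) auto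
  finally have zz: "(\<Sum>i\<in>S. (z i)\<^sup>2) \<le> 4 * int (card S)"
    by linarith
  have bound: "\<bar>z i\<bar> \<le> 4 * int (card S)" if "i \<in> S" for i
  proof -
    have "\<bar>z i\<bar> \<le> (z i)\<^sup>2"
      by (rule abs_le_square_int)
    also have "\<dots> \<le> (\<Sum>i\<in>S. (z i)\<^sup>2)"
      using S that by (intro member_le_sum) auto
    finally show ?thesis using zz by linarith
  qed
  have "z i \<in> {- int (4 * card S)..int (4 * card S)}" if "i \<in> S" for i
    using bound[OF that] by (simp add: abs_le_iff)
  then have "z \<in> grid_net S"
    using zz by (simp add: grid_net_def PiE_def extensional_def z_def del: of_nat_mult)
  moreover have "L2_set (\<lambda>i. x i - real_of_int (z i) / (2 * ?s)) S \<le> 1 / 2"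
  proof -
    have "(L2_set (\<lambda>i. x i - real_of_int (z i) / (2 * ?s)) S)\<^sup>2 = (\<Sum>i\<in>S. (x i - real_of_int (z i) / (2 * ?s))\<^sup>2)"
      by (rule L2_set_sq)
    also have "\<dots> \<le> (\<Sum>i\<in>S. (1 / (2 * ?s))\<^sup>2)"
    proof (rule sum_mono)
      fix i assume "i \<in> S"
      have "x i - real_of_int (z i) / (2 * ?s) = (2 * ?s * x i - rd (2 * ?s * x i)) / (2 * ?s)"
        using \<open>i \<in> S\<close> s by (simp add: z_def field_simps)
      then have "\<bar>x i - real_of_int (z i) / (2 * ?s)\<bar> \<le> 1 / (2 * ?s)"
        using rd1[of "2 * ?s * x i"] s by (simp add: abs_divide divide_right_mono)
      then show "(x i - real_of_int (z i) / (2 * ?s))\<^sup>2 \<le> (1 / (2 * ?s))\<^sup>2"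
        using abs_le_square_iff[of "x i - real_of_int (z i) / (2 * ?s)" "1 / (2 * ?s)"] s by simp
    qed
    also have "\<dots> = (1 / 2)\<^sup>2"
      using s by (simp add: power_divide power_mult_distrib)
    finally show ?thesis
      by (rule power2_le_imp_le) simp
  qed
  ultimately show ?thesis by (rule that)
qed

lemma sum_sq_grid_net: "z \<in> grid_net S \<Longrightarrow> (\<Sum>i\<in>S. (real_of_int (z i))\<^sup>2) \<le> 4 * real (card S)"
proof -
  assume "z \<in> grid_net S"
  then have "(\<Sum>i\<in>S. (z i)\<^sup>2) \<le> 4 * int (card S)" by (simp add: grid_net_def)
  then have "real_of_int (\<Sum>i\<in>S. (z i)\<^sup>2) \<le> real_of_int (4 * int (card S))"
    by (simp only: of_int_le_iff)
  then show ?thesis by simp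
qed

text \<open>Any bound \<open>c\<close> can be improved. On rescaled net points the bilinear form is
  at most \<open>t\<close>; rounding the left vector costs a factor 2, and rounding the right vector
  leaves an error of norm at most 1/2, which costs \<open>c / 2\<close>.\<close>

lemma mat_bound_halve:
  fixes A :: "'a \<Rightarrow> 'a \<Rightarrow> real" and t c :: real
  assumes S: "finite S" "S \<noteq> {}" and t: "t \<ge> 0" and c: "c \<ge> 0" "mat_bound S S A c"
    and net: "\<And>x y. x \<in> grid_net S \<Longrightarrow> y \<in> grid_net S \<Longrightarrow>
      \<bar>\<Sum>i\<in>S. \<Sum>j\<in>S. A i j * real_of_int (x i) * real_of_int (y j)\<bar> \<le> 4 * real (card S) * t"
  shows "mat_bound S S A (2 * t + c / 2)"
proof -
  let ?s = "2 * sqrt (card S)"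
  have s: "?s > 0" using S by (simp add: card_gt_0_iff)
  have ss: "?s * ?s = 4 * card S" by simp
  define ap where "ap x i = (\<Sum>j\<in>S. A i j * x j)" for x i
  have ap_diff: "ap x i = ap y i + ap (\<lambda>j. x j - y j) i" for x y i
    by (simp add: ap_def right_diff_distrib sum_subtractf)
  have step: "\<bar>\<Sum>i\<in>S. x i * w i\<bar> \<le> a + L2_set w S / 2"
    if x: "L2_set x S \<le> 1" and a: "\<And>z. z \<in> grid_net S \<Longrightarrow> \<bar>\<Sum>i\<in>S. real_of_int (z i) / ?s * w i\<bar> \<le> a" for x w a
  proof -
    obtain z where z: "z \<in> grid_net S" "L2_set (\<lambda>i. x i - real_of_int (z i) / ?s) S \<le> 1 / 2"
      using grid_net_approx[OF S x] by auto
    have "(\<Sum>i\<in>S. x i * w i) = (\<Sum>i\<in>S. real_of_int (z i) / ?s * w i) + (\<Sum>i\<in>S. (x i - real_of_int (z i) / ?s) * w i)"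
      by (simp add: left_diff_distrib sum_subtractf)
    also have "\<bar>\<dots>\<bar> \<le> a + L2_set (\<lambda>i. x i - real_of_int (z i) / ?s) S * L2_set w S"
      using a[OF z(1)] sum_mult_le_L2_set[of "\<lambda>i. x i - real_of_int (z i) / ?s" w S] by linarith
    also have "\<dots> \<le> a + 1 / 2 * L2_set w S"
      using z by (intro add_left_mono mult_right_mono) auto
    finally show ?thesis by simp
  qed
  \<comment> \<open>\<open>step\<close> is applied with \<open>x\<close> the normalized
    \<open>w\<close>, which turns the pairing into the norm of \<open>w\<close>.\<close>
  have self: "L2_set w S \<le> a + L2_set w S / 2"
    if a: "\<And>z. z \<in> grid_net S \<Longrightarrow> \<bar>\<Sum>i\<in>S. real_of_int (z i) / ?s * w i\<bar> \<le> a" and "a \<ge> 0" for w a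
  proof (cases "L2_set w S = 0")
    case False
    let ?n = "L2_set w S"
    have n: "?n > 0" using False by (simp add: order_less_le)
    have "L2_set (\<lambda>i. 1 / ?n * w i) S = 1 / ?n * ?n"
      using n by (subst L2_set_right_distrib[symmetric]) auto
    then have "L2_set (\<lambda>i. w i / ?n) S \<le> 1"
      using n by simp
    from step[OF this a] have "\<bar>\<Sum>i\<in>S. w i / ?n * w i\<bar> \<le> a + ?n / 2" by simp
    moreover have "(\<Sum>i\<in>S. w i / ?n * w i) = ?n"
    proof -
      have "(\<Sum>i\<in>S. w i / ?n * w i) = ?n\<^sup>2 / ?n"
        unfolding L2_set_sq by (simp add: power2_eq_square sum_divide_distrib)
      then show ?thesis using n by (simp add: power2_eq_square)
    qed
    ultimately show ?thesis by simp
  qed (use that in simp)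
  have one: "L2_set (ap y) S \<le> 2 * t + c / 2" if y: "L2_set y S \<le> 1" for y
  proof -
    obtain z where z: "z \<in> grid_net S" "L2_set (\<lambda>i. y i - real_of_int (z i) / ?s) S \<le> 1 / 2"
      using grid_net_approx[OF S y] by auto
    have "L2_set (ap (\<lambda>i. real_of_int (z i) / ?s)) S \<le> t + L2_set (ap (\<lambda>i. real_of_int (z i) / ?s)) S / 2"
    proof (rule self)
      fix w assume w: "w \<in> grid_net S"
      have "(\<Sum>i\<in>S. real_of_int (w i) / ?s * ap (\<lambda>i. real_of_int (z i) / ?s) i) = (\<Sum>i\<in>S. \<Sum>j\<in>S. A i j * real_of_int (w i) * real_of_int (z j)) / (?s * ?s)"
        unfolding ap_def by (simp add: sum_divide_distrib sum_distrib_left mult_ac)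
      also have "\<bar>\<dots>\<bar> \<le> 4 * real (card S) * t / (?s * ?s)"
        unfolding abs_divide abs_of_nonneg[OF order_less_imp_le[OF mult_pos_pos[OF s s]]]
        by (rule divide_right_mono[OF net[OF w z(1)]]) (use s in simp)
      also have "\<dots> = t"
        unfolding ss using S by (simp add: card_gt_0_iff)
      finally show "\<bar>\<Sum>i\<in>S. real_of_int (w i) / ?s * ap (\<lambda>i. real_of_int (z i) / ?s) i\<bar> \<le> t" .
    qed (rule t)
    then have 1: "L2_set (ap (\<lambda>i. real_of_int (z i) / ?s)) S \<le> 2 * t" by simp
    have "L2_set (ap y) S \<le> L2_set (ap (\<lambda>i. real_of_int (z i) / ?s)) S + L2_set (ap (\<lambda>i. y i - real_of_int (z i) / ?s)) S"
      using L2_set_triangle_ineq[of "ap (\<lambda>i. real_of_int (z i) / ?s)" "ap (\<lambda>i. y i - real_of_int (z i) / ?s)" S]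
      by (simp only: ap_diff[of y _ "\<lambda>i. real_of_int (z i) / ?s", symmetric])
    also have "L2_set (ap (\<lambda>i. y i - real_of_int (z i) / ?s)) S \<le> c * L2_set (\<lambda>i. y i - real_of_int (z i) / ?s) S"
      unfolding ap_def by (rule mat_boundD[OF c(2)])
    also have "\<dots> \<le> c * (1 / 2)"
      using z c by (intro mult_left_mono)
    finally show ?thesis using 1 by simp
  qed
  show ?thesis
  proof (rule mat_boundI, fold ap_def)
    fix y
    show "L2_set (ap y) S \<le> (2 * t + c / 2) * L2_set y S"
    proof (cases "L2_set y S = 0")
      case True
      have "L2_set (ap y) S \<le> c * L2_set y S"
        unfolding ap_def by (rule mat_boundD[OF c(2)])
      with True show ?thesis by simp
    next
      case False
      let ?n = "L2_set y S"
      have n: "?n > 0" using False by (simp add: order_less_le)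
      have "L2_set (\<lambda>i. 1 / ?n * y i) S = 1 / ?n * ?n"
        using n by (subst L2_set_right_distrib[symmetric]) auto
      then have "L2_set (ap (\<lambda>i. 1 / ?n * y i)) S \<le> 2 * t + c / 2"
        using n by (intro one) simp
      moreover have "ap (\<lambda>i. 1 / ?n * y i) = (\<lambda>i. 1 / ?n * ap y i)"
        unfolding ap_def sum_distrib_left by (simp add: mult_ac)
      moreover have "L2_set (\<lambda>i. 1 / ?n * ap y i) S = 1 / ?n * L2_set (ap y) S"
        using n by (subst L2_set_right_distrib[symmetric]) auto
      ultimately have "1 / ?n * L2_set (ap y) S \<le> 2 * t + c / 2" by simp
      with n show ?thesis by (simp add: field_simps)
    qed
  qed
qed

text \<open>The map c -> 2 t + c / 2 has the fixed point 4 t and halves the distance to it. The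
  iteration starts from the Frobenius norm, which is always a bound.\<close>

lemma mat_bound_of_grid_net:
  fixes A :: "'a \<Rightarrow> 'a \<Rightarrow> real" and t :: real
  assumes S: "finite S" "S \<noteq> {}" and t: "t \<ge> 0"
    and net: "\<And>x y. x \<in> grid_net S \<Longrightarrow> y \<in> grid_net S \<Longrightarrow>
      \<bar>\<Sum>i\<in>S. \<Sum>j\<in>S. A i j * real_of_int (x i) * real_of_int (y j)\<bar> \<le> 4 * real (card S) * t"
  shows "mat_bound S S A (4 * t)"
proof -
  let ?c = "sqrt (\<Sum>i\<in>S. \<Sum>j\<in>S. (A i j)\<^sup>2)"
  have c: "?c \<ge> 0" by (simp add: sum_nonneg)
  have it: "mat_bound S S A (4 * t + ?c / 2 ^ k)" for k
  proof (induction k)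
    case 0
    have "?c * L2_set x S \<le> (4 * t + ?c / 2 ^ 0) * L2_set x S" for x
      using t by (intro mult_right_mono) auto
    then show ?case
      using mat_bound_Frobenius[of S S A] unfolding mat_bound_def by (meson order_trans)
  next
    case (Suc k)
    have "mat_bound S S A (2 * t + (4 * t + ?c / 2 ^ k) / 2)"
      by (rule mat_bound_halve[OF S t _ Suc net]) (use t c in auto)
    then show ?case by (simp add: field_simps)
  qed
  show ?thesis
  proof (rule mat_boundI)
    fix x
    have "(\<lambda>k. (4 * t + ?c * (1/2) ^ k) * L2_set x S) \<longlonglongrightarrow> (4 * t + ?c * 0) * L2_set x S"
      by (intro tendsto_intros LIMSEQ_power_zero) auto
    then show "L2_set (\<lambda>i. \<Sum>j\<in>S. A i j * x j) S \<le> 4 * t * L2_set x S"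
      using mat_boundD[OF it, of x]
      by (intro LIMSEQ_le_const[of _ "4 * t * L2_set x S"]) (auto simp: power_one_over divide_simps)
  qed
qed

subsection \<open>The reference matrix\<close>

text \<open>A reference random matrix: its entries are uniform on the multiset \<open>{2, -1, -1}\<close>, which has
  mean 0 and all other moments at least 1. Expectations are averages over the finite set of
  functions into \<open>{0, 1, 2}\<close>.\<close>

definition ref_val :: "nat \<Rightarrow> real" where
  "ref_val c = (if c = 0 then 2 else - 1)"

definition average3 :: "'e set \<Rightarrow> (('e \<Rightarrow> nat) \<Rightarrow> real) \<Rightarrow> real" where
  "average3 E F = (\<Sum>\<omega>\<in>E \<rightarrow>\<^sub>E {..<3}. F \<omega>) / 3 ^ card E"

text \<open>Independence of the coordinates, in finite form.\<close>

lemma average3_prod: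
  assumes "finite E"
  shows "average3 E (\<lambda>\<omega>. \<Prod>e\<in>E. g e (\<omega> e)) = (\<Prod>e\<in>E. (\<Sum>c<3. g e c) / 3)"
  using assms by (simp add: average3_def prod_dividef prod_sum_PiE)

lemma average3_mono:
  "(\<And>\<omega>. F \<omega> \<le> G \<omega>) \<Longrightarrow> average3 E F \<le> average3 E G"
  unfolding average3_def by (intro divide_right_mono sum_mono) auto

lemma average3_add: "average3 E (\<lambda>\<omega>. F \<omega> + G \<omega>) = average3 E F + average3 E G"
  by (simp add: average3_def sum.distrib add_divide_distrib)

lemma average3_cmult: "average3 E (\<lambda>\<omega>. c * F \<omega>) = c * average3 E F"
  by (simp add: average3_def flip: sum_distrib_left)

lemma average3_sum: "average3 E (\<lambda>\<omega>. \<Sum>x\<in>A. F x \<omega>) = (\<Sum>x\<in>A. average3 E (F x))"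
  unfolding average3_def sum_divide_distrib[symmetric] by (subst sum.swap) simp

lemma average3_const: "finite E \<Longrightarrow> average3 E (\<lambda>_. c) = c"
  by (simp add: average3_def card_PiE)

text \<open>The linear term on the right vanishes when \<open>s\<close> is averaged against a
  centred law. What remains is a sub-Gaussian bound that holds for all \<open>s\<close>, not only
  for small ones.\<close>

lemma exp_le_self_plus_exp_square: "exp s \<le> s + exp (s\<^sup>2)" for s :: real
proof -
  have e: "1 + s\<^sup>2 \<le> exp (s\<^sup>2)" by (rule exp_ge_add_one_self)
  consider "s \<le> 0" | "0 \<le> s" "s \<le> 1" | "1 < s" by linarith
  then show ?thesis
  proof cases
    case 1
    have "exp s * (1 - s) \<le> exp s * exp (- s)"
      using exp_ge_add_one_self[of "- s"] by (intro mult_left_mono) auto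
    also have "\<dots> = 1" by (simp flip: exp_add)
    also have "1 \<le> (1 + s + s\<^sup>2) * (1 - s)"
    proof -
      have "(1 + s + s\<^sup>2) * (1 - s) = 1 - s * s\<^sup>2"
        by (simp add: algebra_simps power2_eq_square)
      moreover have "s * s\<^sup>2 \<le> 0" using 1 by (intro mult_nonpos_nonneg) auto
      ultimately show ?thesis by simp
    qed
    finally have "exp s \<le> 1 + s + s\<^sup>2"
      using 1 by (subst (asm) mult_le_cancel_right_pos) auto
    with e show ?thesis by linarith
  next
    case 2
    with e exp_bound[of s] show ?thesis by linarith
  next
    case 3
    then have "s * 1 \<le> s * s" by (intro mult_left_mono) auto
    then have "exp s \<le> exp (s\<^sup>2)" by (simp add: power2_eq_square)
    with 3 show ?thesis by linarith
  qed
qed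

text \<open>The linear terms, \<open>t * 2\<close> once and \<open>- t\<close> twice, cancel; the 4
  is the square of the largest value 2.\<close>

lemma ref_val_mgf_le: "(\<Sum>c<3. exp (t * ref_val c)) / 3 \<le> exp (4 * t\<^sup>2)"
proof -
  have "exp (t * 2) \<le> t * 2 + exp (4 * t\<^sup>2)"
    using exp_le_self_plus_exp_square[of "t * 2"] by (simp add: power_mult_distrib mult.commute)
  moreover have "exp (- t) \<le> - t + exp (4 * t\<^sup>2)"
  proof -
    have "exp (t\<^sup>2) \<le> exp (4 * t\<^sup>2)" by simp
    with exp_le_self_plus_exp_square[of "- t"] show ?thesis unfolding power2_minus by linarith
  qed
  ultimately show ?thesis
    by (simp add: ref_val_def numeral_3_eq_3)
qed

text \<open>The sum 2^k + 2 (-1)^k is 3 for k = 0 and at least 6 for k >= 2; only for k = 1 does it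
  vanish. The law is chosen for this property: the odd moments of a symmetric law are 0.\<close>

lemma ref_val_moment:
  assumes "k \<noteq> 1"
  shows "(\<Sum>c<3. ref_val c ^ k) / 3 \<ge> 1"
proof -
  have eq: "(\<Sum>c<3. ref_val c ^ k) = 2 ^ k + 2 * (- 1) ^ k"
    by (simp add: ref_val_def numeral_3_eq_3)
  show ?thesis
  proof (cases "even k")
    case True
    then show ?thesis unfolding eq by simp
  next
    case False
    with assms have "k \<ge> 3" by (cases k rule: parity_cases) (auto elim!: oddE)
    then have "(2::real) ^ 3 \<le> 2 ^ k" by (intro power_increasing) auto
    with False show ?thesis unfolding eq by simp
  qed
qed

lemma ref_val_mean: "(\<Sum>c<3. ref_val c ^ 1) / 3 = 0"
  by (simp add: ref_val_def numeral_3_eq_3)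

text \<open>An unordered pair, loops included, encoded as a sorted pair. A matrix that is a function
  of \<open>edge i j\<close> is automatically symmetric, and each edge names one independent
  entry.\<close>

definition edge :: "nat \<Rightarrow> nat \<Rightarrow> nat \<times> nat" where
  "edge i j = (min i j, max i j)"

definition edges_on :: "nat set \<Rightarrow> (nat \<times> nat) set" where
  "edges_on S = {(i, j). i \<in> S \<and> j \<in> S \<and> i \<le> j}"

lemma edge_commute: "edge i j = edge j i"
  by (simp add: edge_def min.commute max.commute)

lemma edge_in_edges_on: "i \<in> S \<Longrightarrow> j \<in> S \<Longrightarrow> edge i j \<in> edges_on S"
  by (auto simp: edge_def edges_on_def min_def max_def)

lemma finite_edges_on: "finite S \<Longrightarrow> finite (edges_on S)"
  by (rule finite_subset[of _ "S \<times> S"]) (auto simp: edges_on_def)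

definition ref_mat :: "(nat \<times> nat \<Rightarrow> nat) \<Rightarrow> nat \<Rightarrow> nat \<Rightarrow> real" where
  "ref_mat \<omega> i j = ref_val (\<omega> (edge i j))"

text \<open>Collecting the ordered pairs over each edge gives a sum of independent terms
  \<open>ref_val (\<omega> e) * c e\<close>. At most two ordered pairs share an edge, so the sum of
  the \<open>(c e)\<^sup>2\<close> is at most twice the product of the squared norms. With the 4 of
  \<open>ref_val_mgf_le\<close> this gives 8.\<close>

lemma ref_mat_bilinear_mgf:
  fixes x y :: "nat \<Rightarrow> real"
  assumes S: "finite S"
  shows "average3 (edges_on S) (\<lambda>\<omega>. exp (l * (\<Sum>i\<in>S. \<Sum>j\<in>S. ref_mat \<omega> i j * x i * y j)))
    \<le> exp (8 * l\<^sup>2 * ((\<Sum>i\<in>S. (x i)\<^sup>2) * (\<Sum>j\<in>S. (y j)\<^sup>2)))"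
proof -
  let ?E = "edges_on S"
  note fE = finite_edges_on[OF S]
  define fib where "fib e = {p \<in> S \<times> S. edge (fst p) (snd p) = e}" for e
  define c where "c e = (\<Sum>p\<in>fib e. x (fst p) * y (snd p))" for e
  have fin_fib: "finite (fib e)" for e
    unfolding fib_def using S by simp
  have group: "(\<Sum>e\<in>?E. \<Sum>p\<in>fib e. h p) = (\<Sum>p\<in>S \<times> S. h p)" for h :: "nat \<times> nat \<Rightarrow> real"
    unfolding fib_def using S fE by (intro sum.group) (auto intro: edge_in_edges_on)
  have card_fib: "card (fib e) \<le> 2" for e
  proof -
    have "fib e \<subseteq> {(fst e, snd e), (snd e, fst e)}"
      by (auto simp: fib_def edge_def min_def max_def split: if_splits)
    then have "card (fib e) \<le> card {(fst e, snd e), (snd e, fst e)}"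
      by (intro card_mono) auto
    also have "\<dots> \<le> 2" by (simp add: card_insert_if)
    finally show ?thesis .
  qed
  have bil: "(\<Sum>i\<in>S. \<Sum>j\<in>S. ref_mat \<omega> i j * x i * y j) = (\<Sum>e\<in>?E. ref_val (\<omega> e) * c e)" for \<omega>
  proof -
    have "(\<Sum>e\<in>?E. ref_val (\<omega> e) * c e) =
      (\<Sum>e\<in>?E. \<Sum>p\<in>fib e. ref_mat \<omega> (fst p) (snd p) * x (fst p) * y (snd p))"
      by (intro sum.cong refl) (simp add: c_def sum_distrib_left fib_def ref_mat_def mult.assoc)
    also have "\<dots> = (\<Sum>i\<in>S. \<Sum>j\<in>S. ref_mat \<omega> i j * x i * y j)"
      unfolding group by (simp add: sum.cartesian_product case_prod_unfold)
    finally show ?thesis by simp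
  qed
  have "(\<Sum>e\<in>?E. (c e)\<^sup>2) \<le> (\<Sum>e\<in>?E. 2 * (\<Sum>p\<in>fib e. (x (fst p) * y (snd p))\<^sup>2))"
  proof (rule sum_mono)
    fix e
    have "(c e)\<^sup>2 \<le> (\<Sum>p\<in>fib e. (x (fst p) * y (snd p))\<^sup>2) * card (fib e)"
      unfolding c_def by (rule sum_squared_le_sum_of_squares)
    also have "\<dots> \<le> (\<Sum>p\<in>fib e. (x (fst p) * y (snd p))\<^sup>2) * 2"
      using card_fib[of e] by (intro mult_left_mono sum_nonneg) auto
    finally show "(c e)\<^sup>2 \<le> 2 * (\<Sum>p\<in>fib e. (x (fst p) * y (snd p))\<^sup>2)" by simp
  qed
  also have "\<dots> = 2 * (\<Sum>p\<in>S \<times> S. (x (fst p) * y (snd p))\<^sup>2)"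
    unfolding group[symmetric] by (simp add: sum_distrib_left)
  also have "\<dots> = 2 * ((\<Sum>i\<in>S. (x i)\<^sup>2) * (\<Sum>j\<in>S. (y j)\<^sup>2))"
    by (simp add: sum_product sum.cartesian_product case_prod_unfold power_mult_distrib)
  finally have c2: "(\<Sum>e\<in>?E. (c e)\<^sup>2) \<le> 2 * ((\<Sum>i\<in>S. (x i)\<^sup>2) * (\<Sum>j\<in>S. (y j)\<^sup>2))" .
  have "average3 ?E (\<lambda>\<omega>. exp (l * (\<Sum>i\<in>S. \<Sum>j\<in>S. ref_mat \<omega> i j * x i * y j))) =
    average3 ?E (\<lambda>\<omega>. \<Prod>e\<in>?E. exp (l * c e * ref_val (\<omega> e)))"
    unfolding bil using fE by (simp add: exp_sum sum_distrib_left mult_ac)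
  also have "\<dots> = (\<Prod>e\<in>?E. (\<Sum>k<3. exp (l * c e * ref_val k)) / 3)"
    by (rule average3_prod[OF fE])
  also have "\<dots> \<le> (\<Prod>e\<in>?E. exp (4 * (l * c e)\<^sup>2))"
    by (intro prod_mono conjI ref_val_mgf_le divide_nonneg_pos sum_nonneg) auto
  also have "\<dots> = exp (4 * l\<^sup>2 * (\<Sum>e\<in>?E. (c e)\<^sup>2))"
    using fE by (simp add: exp_sum sum_distrib_left power_mult_distrib mult.assoc)
  also have "\<dots> \<le> exp (4 * l\<^sup>2 * (2 * ((\<Sum>i\<in>S. (x i)\<^sup>2) * (\<Sum>j\<in>S. (y j)\<^sup>2))))"
    using c2 by (intro exp_mono mult_left_mono) auto
  finally show ?thesis by (simp add: mult_ac)
qed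

text \<open>Comparison with a single term of the exponential series at the absolute value of
  \<open>x\<close>.\<close>

lemma power_even_le_fact_exp:
  "x ^ (2 * a) \<le> fact (2 * a) * (exp x + exp (- x))" for x :: real
proof -
  have le: "y ^ k / fact k \<le> exp y" if "y \<ge> 0" for y :: real and k
  proof -
    have "(\<Sum>i\<in>{k}. y ^ i / fact i) \<le> (\<Sum>i. y ^ i / fact i)"
      using summable_exp[of y] that by (intro sum_le_suminf) (auto simp: field_simps)
    then show ?thesis by (simp add: exp_def field_simps scaleR_conv_of_real)
  qed
  have "x ^ (2 * a) = \<bar>x\<bar> ^ (2 * a)" by (simp add: power_even_abs)
  also have "\<dots> \<le> fact (2 * a) * exp \<bar>x\<bar>"
    using le[of "\<bar>x\<bar>" "2 * a"] by (simp add: field_simps)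
  also have "\<dots> \<le> fact (2 * a) * (exp x + exp (- x))"
    by (intro mult_left_mono) (auto simp: abs_if)
  finally show ?thesis .
qed

text \<open>Moments from the moment generating function at \<open>l\<close> and \<open>- l\<close>.
  Growth like a^a, as for a Gaussian variable, is what keeps the base in
  \<open>ref_mat_trace_le\<close> linear in \<open>q + card S\<close>.\<close>

lemma ref_mat_bilinear_moment:
  fixes x y :: "nat \<Rightarrow> real"
  assumes S: "finite S" and a: "a \<ge> 1" and K: "K \<ge> 0"
    and xy: "(\<Sum>i\<in>S. (x i)\<^sup>2) \<le> K" "(\<Sum>j\<in>S. (y j)\<^sup>2) \<le> K"
  shows "average3 (edges_on S) (\<lambda>\<omega>. (\<Sum>i\<in>S. \<Sum>j\<in>S. ref_mat \<omega> i j * x i * y j) ^ (2 * a))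
    \<le> 2 * (4 * exp 8 * real a) ^ a * K ^ (2 * a)"
proof (cases "K = 0")
  case True
  have "x i = 0" if "i \<in> S" for i
    using xy(1) that S True by (metis member_le_sum power2_less_eq_zero_iff zero_le_power2 order_trans)
  then have "(\<Sum>i\<in>S. \<Sum>j\<in>S. ref_mat \<omega> i j * x i * y j) = 0" for \<omega> by simp
  with a True show ?thesis by (simp add: average3_def power_0_left)
next
  case False
  with K have K: "K > 0" by simp
  \<comment> \<open>Up to a constant factor this minimizes exp (8 l^2 K^2) / l^(2 a).\<close>
  define l where "l = sqrt a / K"
  have l: "l > 0" using a K by (simp add: l_def)
  let ?b = "\<lambda>\<omega>. \<Sum>i\<in>S. \<Sum>j\<in>S. ref_mat \<omega> i j * x i * y j"
  let ?avg = "average3 (edges_on S)"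
  have mgf: "?avg (\<lambda>\<omega>. exp (s * ?b \<omega>)) \<le> exp (8 * real a)" if s: "s\<^sup>2 = l\<^sup>2" for s
  proof -
    have "?avg (\<lambda>\<omega>. exp (s * ?b \<omega>)) \<le> exp (8 * s\<^sup>2 * ((\<Sum>i\<in>S. (x i)\<^sup>2) * (\<Sum>j\<in>S. (y j)\<^sup>2)))"
      by (rule ref_mat_bilinear_mgf[OF S])
    also have "\<dots> \<le> exp (8 * s\<^sup>2 * (K * K))"
      using xy K by (intro exp_mono mult_left_mono mult_mono sum_nonneg) auto
    also have "8 * s\<^sup>2 * (K * K) = 8 * real a"
      using K unfolding s by (simp add: l_def power_divide power2_eq_square)
    finally show ?thesis .
  qed
  have "l ^ (2 * a) * ?avg (\<lambda>\<omega>. ?b \<omega> ^ (2 * a)) = ?avg (\<lambda>\<omega>. (l * ?b \<omega>) ^ (2 * a))"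
    by (simp add: power_mult_distrib average3_cmult)
  also have "\<dots> \<le> ?avg (\<lambda>\<omega>. fact (2 * a) * (exp (l * ?b \<omega>) + exp (- (l * ?b \<omega>))))"
    by (intro average3_mono power_even_le_fact_exp)
  also have "\<dots> \<le> fact (2 * a) * (exp (8 * real a) + exp (8 * real a))"
    unfolding average3_cmult average3_add by (intro mult_left_mono add_mono mgf mgf[of "- l", unfolded mult_minus_left]) auto
  also have "\<dots> \<le> (2 * real a) ^ (2 * a) * (exp (8 * real a) + exp (8 * real a))"
    using fact_le_power[of "2 * a", where ?'a = real]
    by (intro mult_right_mono) auto
  also have "\<dots> = 2 * (4 * exp 8 * real a) ^ a * real a ^ a"
  proof -
    have "exp (8 * real a) = exp 8 ^ a" by (simp add: exp_of_nat2_mult)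
    then show ?thesis by (simp add: power_mult_distrib power_mult power2_eq_square)
  qed
  also have "\<dots> = l ^ (2 * a) * (2 * (4 * exp 8 * real a) ^ a * K ^ (2 * a))"
    using K a by (simp add: l_def power_divide power_mult)
  finally show ?thesis
    using l by simp
qed

text \<open>147456 = 16 * 48 * 48 * 4. The 16 is the square of the factor 4 in
  \<open>mat_bound_of_grid_net\<close>, each 48 counts one of the two nets, and
  \<open>4 * exp 8\<close> comes from \<open>ref_mat_bilinear_moment\<close>.\<close>

definition ref_const :: real where "ref_const = 147456 * exp 8"

text \<open>The largest bilinear value over the net is replaced by the sum \<open>T\<close> of all
  powers of order \<open>2 * a\<close>, so that only moments are needed. The order
  \<open>q + card S\<close> instead of \<open>q\<close> absorbs the number of pairs of net points,
  at most 48^(2 card S), into the constant.\<close>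

lemma ref_mat_trace_le:
  assumes S: "finite S"
  shows "average3 (edges_on S) (\<lambda>\<omega>. trace_power S (ref_mat \<omega>) (2 * q))
    \<le> 3 * real (card S) * (ref_const * real (q + card S)) ^ q"
proof (cases "S = {}")
  case True
  then show ?thesis by (simp add: trace_power_def average3_def)
next
  case False
  let ?n = "card S" and ?r = "real (card S)" and ?avg = "average3 (edges_on S)" and ?N = "grid_net S"
  define a where "a = q + ?n"
  have r: "?r > 0" using S False by (simp add: card_gt_0_iff)
  then have a: "a \<ge> 1" by (simp add: a_def)
  define D where "D = ref_const * real a"
  have D: "D > 0" using a by (simp add: D_def ref_const_def)
  define b where "b \<omega> x y = (\<Sum>i\<in>S. \<Sum>j\<in>S. ref_mat \<omega> i j * real_of_int (x i) * real_of_int (y j))" for \<omega> x y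
  define T where "T \<omega> = (\<Sum>x\<in>?N. \<Sum>y\<in>?N. b \<omega> x y ^ (2 * a))" for \<omega>
  have T: "T \<omega> \<ge> 0" for \<omega> unfolding T_def by (intro sum_nonneg) auto
  have fN: "finite ?N" by (rule finite_grid_net[OF S])
  have trace: "trace_power S (ref_mat \<omega>) (2 * q) \<le> ?r * (D ^ q * (1 + 16 ^ a * T \<omega> / (4 * ?r) ^ (2 * a) / D ^ a))" for \<omega>
  proof -
    \<comment> \<open>The power of order \<open>2 * a\<close> of each bilinear value is a summand of
      \<open>T\<close>, so the root of \<open>T\<close> dominates all these values at once.\<close>
    define t where "t = root (2 * a) (T \<omega>) / (4 * ?r)"
    have t: "t \<ge> 0" unfolding t_def using T[of \<omega>] a by simp
    have "mat_bound S S (ref_mat \<omega>) (4 * t)"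
    proof (rule mat_bound_of_grid_net[OF S False t], fold b_def)
      fix x y assume xy: "x \<in> ?N" "y \<in> ?N"
      have "b \<omega> x y ^ (2 * a) \<le> (\<Sum>y\<in>?N. b \<omega> x y ^ (2 * a))"
        using fN xy by (intro member_le_sum) auto
      also have "\<dots> \<le> T \<omega>"
        unfolding T_def using fN xy by (intro member_le_sum[of x _ "\<lambda>x. \<Sum>y\<in>?N. b \<omega> x y ^ (2 * a)"] sum_nonneg) auto
      finally have "\<bar>b \<omega> x y\<bar> ^ (2 * a) \<le> T \<omega>"
        by (simp add: power_even_abs)
      then have "root (2 * a) (\<bar>b \<omega> x y\<bar> ^ (2 * a)) \<le> root (2 * a) (T \<omega>)"
        using a by simp
      then have "\<bar>b \<omega> x y\<bar> \<le> root (2 * a) (T \<omega>)"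
        using a by (simp add: real_root_power_cancel)
      then show "\<bar>b \<omega> x y\<bar> \<le> 4 * ?r * t"
        using r by (simp add: t_def)
    qed
    then have "trace_power S (ref_mat \<omega>) (2 * q) \<le> ?r * (4 * t) ^ (2 * q)"
      using t by (intro trace_power_le_of_mat_bound S) (auto simp: ref_mat_def edge_commute)
    also have "(4 * t) ^ (2 * q) = D ^ q * ((16 * t\<^sup>2) / D) ^ q"
      using D by (simp add: power_mult power_mult_distrib power_divide)
    \<comment> \<open>y^q <= 1 + y^a because \<open>q \<le> a\<close>: only the moment of order
      \<open>a\<close> is under control.\<close>
    also have "((16 * t\<^sup>2) / D) ^ q \<le> 1 + ((16 * t\<^sup>2) / D) ^ a"
    proof (cases "(16 * t\<^sup>2) / D \<le> 1")
      case True
      then have "((16 * t\<^sup>2) / D) ^ q \<le> 1"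
        using D by (intro power_le_one) auto
      moreover have "((16 * t\<^sup>2) / D) ^ a \<ge> 0" using D by simp
      ultimately show ?thesis by linarith
    next
      case False
      then have "((16 * t\<^sup>2) / D) ^ q \<le> ((16 * t\<^sup>2) / D) ^ a"
        by (intro power_increasing) (auto simp: a_def)
      then show ?thesis by simp
    qed
    also have "((16 * t\<^sup>2) / D) ^ a = 16 ^ a * T \<omega> / (4 * ?r) ^ (2 * a) / D ^ a"
    proof -
      have "(t\<^sup>2) ^ a = (root (2 * a) (T \<omega>)) ^ (2 * a) / (4 * ?r) ^ (2 * a)"
        by (simp add: t_def power_divide power_mult)
      also have "(root (2 * a) (T \<omega>)) ^ (2 * a) = T \<omega>"
        using a T by (intro real_root_pow_pos2) auto
      finally show ?thesis by (simp add: power_divide power_mult_distrib)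
    qed
    finally show ?thesis
      using D by (simp add: mult_left_mono)
  qed
  have avgT: "?avg T \<le> 48 ^ ?n * (48 ^ ?n * (2 * (4 * exp 8 * real a) ^ a * (4 * ?r) ^ (2 * a)))"
  proof -
    have "?avg T = (\<Sum>x\<in>?N. \<Sum>y\<in>?N. ?avg (\<lambda>\<omega>. b \<omega> x y ^ (2 * a)))"
      unfolding T_def by (simp add: average3_sum)
    also have "\<dots> \<le> (\<Sum>x\<in>?N. \<Sum>y\<in>?N. 2 * (4 * exp 8 * real a) ^ a * (4 * ?r) ^ (2 * a))"
      unfolding b_def by (intro sum_mono ref_mat_bilinear_moment S a sum_sq_grid_net) auto
    also have "\<dots> = real (card ?N) * (real (card ?N) * (2 * (4 * exp 8 * real a) ^ a * (4 * ?r) ^ (2 * a)))"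
      by simp
    also have "\<dots> \<le> 48 ^ ?n * (48 ^ ?n * (2 * (4 * exp 8 * real a) ^ a * (4 * ?r) ^ (2 * a)))"
      using card_grid_net_le[OF S] by (intro mult_mono) auto
    finally show ?thesis .
  qed
  have "16 ^ a * ?avg T / (4 * ?r) ^ (2 * a) / D ^ a \<le> 2"
  proof -
    have "16 ^ a * ?avg T \<le> 16 ^ a * (48 ^ a * (48 ^ a * (2 * (4 * exp 8 * real a) ^ a * (4 * ?r) ^ (2 * a))))"
    proof (intro mult_left_mono order_trans[OF avgT])
      have "(48::real) ^ ?n \<le> 48 ^ a" by (intro power_increasing) (auto simp: a_def)
      then show "48 ^ ?n * (48 ^ ?n * (2 * (4 * exp 8 * real a) ^ a * (4 * ?r) ^ (2 * a)))
         \<le> 48 ^ a * (48 ^ a * (2 * (4 * exp 8 * real a) ^ a * (4 * ?r) ^ (2 * a)))"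
        by (intro mult_mono) auto
    qed auto
    also have "\<dots> = 2 * D ^ a * (4 * ?r) ^ (2 * a)"
    proof -
      have "D = 16 * (48 * (48 * (4 * exp 8 * real a)))" by (simp add: D_def ref_const_def)
      then have "D ^ a = 16 ^ a * (48 ^ a * (48 ^ a * (4 * exp 8 * real a) ^ a))"
        by (simp only: power_mult_distrib)
      then show ?thesis by simp
    qed
    finally show ?thesis
      using D r by (simp add: divide_simps mult_ac)
  qed
  then have avg2: "?avg (\<lambda>\<omega>. 16 ^ a * T \<omega> / (4 * ?r) ^ (2 * a) / D ^ a) \<le> 2"
    by (simp add: average3_def sum_divide_distrib sum_distrib_left mult_ac)
  have "?avg (\<lambda>\<omega>. trace_power S (ref_mat \<omega>) (2 * q))
    \<le> ?avg (\<lambda>\<omega>. ?r * (D ^ q * (1 + 16 ^ a * T \<omega> / (4 * ?r) ^ (2 * a) / D ^ a)))"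
    by (intro average3_mono trace)
  also have "\<dots> = ?r * (D ^ q * (1 + ?avg (\<lambda>\<omega>. 16 ^ a * T \<omega> / (4 * ?r) ^ (2 * a) / D ^ a)))"
    by (simp only: average3_cmult average3_add average3_const[OF finite_edges_on[OF S]])
  also have "\<dots> \<le> ?r * (D ^ q * (1 + 2))"
    using avg2 D by (intro mult_left_mono add_left_mono) auto
  finally show ?thesis by (simp add: D_def a_def mult_ac)
qed

subsection \<open>Closed walks\<close>

fun walk_edges :: "nat list \<Rightarrow> (nat \<times> nat) list" where
  "walk_edges (x # y # ys) = edge x y # walk_edges (y # ys)"
| "walk_edges xs = []"

definition walks :: "nat set \<Rightarrow> nat \<Rightarrow> nat \<Rightarrow> nat \<Rightarrow> nat list set" where
  "walks S m i j = {w. length w = Suc m \<and> set w \<subseteq> S \<and> hd w = i \<and> last w = j}"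

definition closed_walks :: "nat set \<Rightarrow> nat \<Rightarrow> nat list set" where
  "closed_walks S m = {w. length w = Suc m \<and> set w \<subseteq> S \<and> hd w = last w}"

text \<open>Only these walks can contribute to the expected trace of a matrix with independent
  centred entries, because an edge used exactly once contributes its mean as a factor.\<close>

definition admissible :: "nat list \<Rightarrow> bool" where
  "admissible w \<longleftrightarrow> (\<forall>e. count_list (walk_edges w) e \<noteq> 1)"

lemma finite_walks: "finite S \<Longrightarrow> finite (walks S m i j)"
  by (rule finite_subset[OF _ finite_lists_length_eq[of S "Suc m"]]) (auto simp: walks_def)

lemma finite_closed_walks: "finite S \<Longrightarrow> finite (closed_walks S m)"
  by (rule finite_subset[OF _ finite_lists_length_eq[of S "Suc m"]]) (auto simp: closed_walks_def)

lemma walks_0: "walks S 0 i j = (if i = j \<and> i \<in> S then {[i]} else {})"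
  by (auto simp: walks_def length_Suc_conv)

lemma walks_Suc:
  assumes "i \<in> S"
  shows "walks S (Suc m) i j = (\<Union>l\<in>S. (#) i ` walks S m l j)"
proof (intro equalityI subsetI)
  fix w assume w: "w \<in> walks S (Suc m) i j"
  then obtain x y ys where eq: "w = x # y # ys"
    by (auto simp: walks_def length_Suc_conv)
  with w have "y \<in> S" "x = i" "y # ys \<in> walks S m y j"
    by (auto simp: walks_def)
  with eq show "w \<in> (\<Union>l\<in>S. (#) i ` walks S m l j)" by auto
next
  fix w assume "w \<in> (\<Union>l\<in>S. (#) i ` walks S m l j)"
  with assms show "w \<in> walks S (Suc m) i j"
    by (auto simp: walks_def)
qed

text \<open>Entries of the form \<open>h (edge i j)\<close> make the weight of a walk depend only on
  how often it uses each unordered edge.\<close>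

lemma mat_power_walks:
  assumes S: "finite S" and A: "\<And>i j. A i j = h (edge i j)" and "i \<in> S"
  shows "mat_power S A m i j = (\<Sum>w\<in>walks S m i j. prod_list (map h (walk_edges w)))"
  using \<open>i \<in> S\<close>
proof (induction m arbitrary: i)
  case 0
  then show ?case by (simp add: walks_0)
next
  case (Suc m)
  have "(\<Sum>w\<in>walks S (Suc m) i j. prod_list (map h (walk_edges w))) =
    (\<Sum>l\<in>S. \<Sum>w\<in>(#) i ` walks S m l j. prod_list (map h (walk_edges w)))"
    unfolding walks_Suc[OF Suc.prems] using S
    by (intro sum.UNION_disjoint ballI finite_imageI finite_walks) (auto simp: walks_def)
  also have "\<dots> = (\<Sum>l\<in>S. \<Sum>w\<in>walks S m l j. prod_list (map h (walk_edges (i # w))))"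
    by (rule sum.cong[OF refl], subst sum.reindex) simp_all
  also have "\<dots> = (\<Sum>l\<in>S. \<Sum>w\<in>walks S m l j. A i l * prod_list (map h (walk_edges w)))"
  proof (intro sum.cong refl)
    fix l w assume "w \<in> walks S m l j"
    then obtain ys where "w = l # ys" by (auto simp: walks_def length_Suc_conv)
    then show "prod_list (map h (walk_edges (i # w))) = A i l * prod_list (map h (walk_edges w))"
      by (simp add: A)
  qed
  finally show ?case by (simp add: Suc.IH sum_distrib_left)
qed

lemma trace_power_walks:
  assumes S: "finite S" and A: "\<And>i j. A i j = h (edge i j)"
  shows "trace_power S A m = (\<Sum>w\<in>closed_walks S m. prod_list (map h (walk_edges w)))"
proof -
  have "hd w \<in> S" if "length w = Suc m" "set w \<subseteq> S" for w
    using that by (cases w) auto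
  then have "closed_walks S m = (\<Union>i\<in>S. walks S m i i)"
    by (auto simp: closed_walks_def walks_def) metis
  then have "(\<Sum>w\<in>closed_walks S m. prod_list (map h (walk_edges w))) =
    (\<Sum>i\<in>S. \<Sum>w\<in>walks S m i i. prod_list (map h (walk_edges w)))"
    using S by (simp only:) (intro sum.UNION_disjoint ballI finite_walks, auto simp: walks_def)
  also have "\<dots> = (\<Sum>i\<in>S. mat_power S A m i i)"
    using S A by (intro sum.cong refl) (simp add: mat_power_walks)
  finally show ?thesis by (simp add: trace_power_def)
qed

lemma prod_list_map_count:
  assumes "finite E" "set es \<subseteq> E"
  shows "prod_list (map h es) = (\<Prod>e\<in>E. h e ^ count_list es e :: real)"
  using assms(2)
proof (induction es)
  case Nil
  then show ?case by simp
next
  case (Cons x es)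
  have "(\<Prod>e\<in>E. h e ^ count_list (x # es) e) =
    (\<Prod>e\<in>E. (if e = x then h e else 1) * h e ^ count_list es e)"
    by (intro prod.cong refl) auto
  also have "\<dots> = h x * (\<Prod>e\<in>E. h e ^ count_list es e)"
    using assms(1) Cons.prems by (simp add: prod.distrib)
  finally show ?case using Cons by simp
qed

lemma edges_of_walk: "e \<in> set (walk_edges w) \<Longrightarrow> {fst e, snd e} \<subseteq> set w"
  by (induction w rule: walk_edges.induct) (auto simp: edge_def min_def max_def split: if_splits)

lemma set_walk_edges_subset: "set w \<subseteq> S \<Longrightarrow> set (walk_edges w) \<subseteq> edges_on S"
  by (induction w rule: walk_edges.induct) (auto intro: edge_in_edges_on)

lemma card_set_walk_le: "card (set w) \<le> Suc (card (set (walk_edges w)))"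
proof (induction w rule: walk_edges.induct)
  case (1 x y ys)
  show ?case
  proof (cases "x \<in> set (y # ys)")
    case True
    then have "card (set (x # y # ys)) = card (set (y # ys))"
      by (simp add: insert_absorb)
    also have "\<dots> \<le> Suc (card (set (walk_edges (y # ys))))" by (rule 1)
    also have "\<dots> \<le> Suc (card (set (walk_edges (x # y # ys))))"
      by (simp add: card_insert_if)
    finally show ?thesis .
  next
    case False
    have "edge x y \<notin> set (walk_edges (y # ys))"
      using edges_of_walk[of "edge x y" "y # ys"] False
      by (auto simp: edge_def min_def max_def split: if_splits)
    with False 1 show ?thesis by simp
  qed
qed auto

section \<open>Walks inside a random vertex set\<close>

text \<open>For d in [0, 1] both sides are the probability that a Bernoulli(d) subset of
  \<open>A\<close> contains \<open>V\<close>. In the expanded product the weight of exclusion is 0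
  on \<open>V\<close>, so the sets that miss a point of \<open>V\<close> drop out.\<close>

lemma sum_Pow_Bernoulli_superset:
  fixes d :: real
  assumes A: "finite A" and V: "V \<subseteq> A"
  shows "(\<Sum>S | V \<subseteq> S \<and> S \<subseteq> A. d ^ card S * (1 - d) ^ card (A - S)) = d ^ card V"
proof -
  have "(\<Prod>x\<in>A. d + (if x \<in> V then 0 else 1 - d)) = (\<Prod>x\<in>A. if x \<in> V then d else 1)"
    by (intro prod.cong) auto
  also have "\<dots> = d ^ card V"
    using A V by (simp add: prod.If_cases Int_absorb1)
  finally have "d ^ card V = (\<Sum>S\<in>Pow A. d ^ card S * (\<Prod>x\<in>A - S. if x \<in> V then 0 else 1 - d))"
    using A by (simp add: prod_add)
  also have "\<dots> = (\<Sum>S\<in>{S \<in> Pow A. V \<subseteq> S}. d ^ card S * (1 - d) ^ card (A - S))"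
  proof (rule sum.mono_neutral_cong_right)
    show "\<forall>S\<in>Pow A - {S \<in> Pow A. V \<subseteq> S}. d ^ card S * (\<Prod>x\<in>A - S. if x \<in> V then 0 else 1 - d) = 0"
    proof
      fix S assume "S \<in> Pow A - {S \<in> Pow A. V \<subseteq> S}"
      then obtain x where "x \<in> V" "x \<notin> S" by auto
      with A V show "d ^ card S * (\<Prod>x\<in>A - S. if x \<in> V then 0 else 1 - d) = 0"
        by (auto intro!: prod_zero)
    qed
    fix S assume "S \<in> {S \<in> Pow A. V \<subseteq> S}"
    then have "(\<Prod>x\<in>A - S. if x \<in> V then 0 else 1 - d) = (\<Prod>x\<in>A - S. 1 - d)"
      by (intro prod.cong) auto
    then show "d ^ card S * (\<Prod>x\<in>A - S. if x \<in> V then 0 else 1 - d) = d ^ card S * (1 - d) ^ card (A - S)"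
      by simp
  qed (use A in auto)
  also have "{S \<in> Pow A. V \<subseteq> S} = {S. V \<subseteq> S \<and> S \<subseteq> A}" by auto
  finally show ?thesis by simp
qed

text \<open>The moment generating function of the binomial size of the random set: each point
  contributes 1 + d (e^t - 1), and e^t <= 1 + 2 t on [0, 1].\<close>

lemma sum_Pow_Bernoulli_exp_le:
  fixes d t :: real
  assumes A: "finite A" and d: "0 \<le> d" and t: "0 \<le> t" "t \<le> 1"
  shows "(\<Sum>S\<in>Pow A. d ^ card S * (1 - d) ^ card (A - S) * exp (t * card S)) \<le> exp (2 * card A * d * t)"
proof (cases "A = {}")
  case True
  then show ?thesis by simp
next
  case False
  have "(\<Sum>S\<in>Pow A. d ^ card S * (1 - d) ^ card (A - S) * exp (t * card S)) =
    (\<Sum>S\<in>Pow A. (\<Prod>x\<in>S. d * exp t) * (\<Prod>x\<in>A - S. 1 - d))"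
    by (intro sum.cong refl) (simp add: power_mult_distrib exp_of_nat2_mult mult_ac)
  also have "\<dots> = (d * exp t + (1 - d)) ^ card A"
    using prod_add[OF A, of "\<lambda>_. d * exp t" "\<lambda>_. 1 - d"] by simp
  also have "\<dots> \<le> exp (2 * d * t) ^ card A"
  proof (intro power_mono)
    have "exp t \<le> 1 + t + t\<^sup>2" using t by (intro exp_bound)
    also have "t\<^sup>2 \<le> t" using t by (simp add: power2_eq_square mult_left_le)
    finally have "d * exp t \<le> d * (1 + 2 * t)" using d by (intro mult_left_mono) auto
    then have "d * exp t + (1 - d) \<le> 1 + 2 * d * t" by (simp add: algebra_simps)
    also have "\<dots> \<le> exp (2 * d * t)" by (rule exp_ge_add_one_self)
    finally show "d * exp t + (1 - d) \<le> exp (2 * d * t)" .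
    have "1 \<le> exp t" using t by simp
    then have "d * 1 \<le> d * exp t" using d by (intro mult_left_mono)
    then show "0 \<le> d * exp t + (1 - d)" by simp
  qed
  also have "\<dots> = exp (2 * card A * d * t)"
    by (simp add: exp_of_nat_mult[symmetric] mult_ac)
  finally show ?thesis .
qed

text \<open>Each closed walk contributes a product of moments of \<open>ref_val\<close>. The product
  is at least 1 if the walk is admissible, and 0 otherwise, because an edge used once contributes
  the mean.\<close>

lemma count_admissible_le_ref_trace:
  assumes S: "finite S"
  shows "real (card {w \<in> closed_walks S m. admissible w})
    \<le> average3 (edges_on S) (\<lambda>\<omega>. trace_power S (ref_mat \<omega>) m)"
proof -
  let ?E = "edges_on S" and ?W = "closed_walks S m"
  note E = finite_edges_on[OF S]
  have "average3 ?E (\<lambda>\<omega>. trace_power S (ref_mat \<omega>) m) =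
    average3 ?E (\<lambda>\<omega>. \<Sum>w\<in>?W. \<Prod>e\<in>?E. ref_val (\<omega> e) ^ count_list (walk_edges w) e)"
  proof -
    have "trace_power S (ref_mat \<omega>) m = (\<Sum>w\<in>?W. \<Prod>e\<in>?E. ref_val (\<omega> e) ^ count_list (walk_edges w) e)" for \<omega>
      using trace_power_walks[OF S, of "ref_mat \<omega>" "\<lambda>e. ref_val (\<omega> e)"]
        prod_list_map_count[OF E, of _ "\<lambda>e. ref_val (\<omega> e)"]
      by (simp add: ref_mat_def closed_walks_def set_walk_edges_subset)
    then show ?thesis by simp
  qed
  also have "\<dots> = (\<Sum>w\<in>?W. \<Prod>e\<in>?E. (\<Sum>c<3. ref_val c ^ count_list (walk_edges w) e) / 3)"
    unfolding average3_sum by (intro sum.cong refl average3_prod E)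
  also have "\<dots> \<ge> (\<Sum>w\<in>?W. if admissible w then 1 else 0)"
  proof (rule sum_mono)
    fix w assume w: "w \<in> ?W"
    show "(if admissible w then 1 else 0) \<le> (\<Prod>e\<in>?E. (\<Sum>c<3. ref_val c ^ count_list (walk_edges w) e) / 3)"
    proof (cases "admissible w")
      case True
      then have "(\<Prod>e\<in>?E. 1) \<le> (\<Prod>e\<in>?E. (\<Sum>c<3. ref_val c ^ count_list (walk_edges w) e) / 3)"
        unfolding admissible_def by (intro prod_mono conjI ref_val_moment) auto
      with True show ?thesis by simp
    next
      case False
      then obtain e where e: "count_list (walk_edges w) e = 1" by (auto simp: admissible_def)
      then have "e \<in> set (walk_edges w)"
        by (metis count_notin zero_neq_one)
      then have "e \<in> ?E"
        using w set_walk_edges_subset[of w S] by (auto simp: closed_walks_def)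
      with E have "(\<Prod>e\<in>?E. (\<Sum>c<3. ref_val c ^ count_list (walk_edges w) e) / 3) = 0"
        by (intro prod_zero bexI[of _ e]) (simp_all only: e ref_val_mean)
      with False show ?thesis by simp
    qed
  qed
  also have "(\<Sum>w\<in>?W. if admissible w then 1 else 0 :: real) = card {w \<in> ?W. admissible w}"
    using finite_closed_walks[OF S] by (simp add: sum.If_cases Int_def)
  finally show ?thesis .
qed

text \<open>\<open>d ^ card (set w)\<close> is the probability that a Bernoulli(\<open>d\<close>) random subset of the vertices
  contains the walk \<open>w\<close>.\<close>
lemma sum_admissible_walks_le:
  fixes d a :: real
  assumes d: "0 < d" "d \<le> 1" and a: "a > 0" "real N * d \<le> a" "real q \<le> a"
  shows "(\<Sum>w | w \<in> closed_walks {..<N} (2 * q) \<and> admissible w. d ^ card (set w))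
    \<le> 3 * real N * (ref_const * exp 3 * a) ^ q"
proof -
  let ?A = "{..<N}" and ?P = "\<lambda>S. d ^ card S * (1 - d) ^ card ({..<N} - S)"
  let ?W = "{w \<in> closed_walks ?A (2 * q). admissible w}"
  have P: "?P S \<ge> 0" for S using d by simp
  have fW: "finite ?W" using finite_closed_walks[of ?A "2 * q"] by simp
  \<comment> \<open>The exponent that arises when the factor \<open>exp (card S / a)\<close> of
    \<open>key\<close> is raised to the power \<open>q\<close>. It lies in [0, 1], as
    \<open>sum_Pow_Bernoulli_exp_le\<close> requires.\<close>
  define t where "t = q / a"
  have t: "0 \<le> t" "t \<le> 1" using a by (auto simp: t_def)
  have C: "ref_const > 0" by (simp add: ref_const_def)
  have "(\<Sum>w\<in>?W. d ^ card (set w)) = (\<Sum>w\<in>?W. \<Sum>S\<in>{S \<in> Pow ?A. set w \<subseteq> S}. ?P S)"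
  proof (intro sum.cong refl)
    fix w assume "w \<in> ?W"
    then have "set w \<subseteq> ?A" by (simp add: closed_walks_def)
    from sum_Pow_Bernoulli_superset[OF _ this, of d]
    have "d ^ card (set w) = (\<Sum>S | set w \<subseteq> S \<and> S \<subseteq> ?A. ?P S)" by simp
    also have "{S. set w \<subseteq> S \<and> S \<subseteq> ?A} = {S \<in> Pow ?A. set w \<subseteq> S}" by auto
    finally show "d ^ card (set w) = (\<Sum>S\<in>{S \<in> Pow ?A. set w \<subseteq> S}. ?P S)" .
  qed
  also have "\<dots> = (\<Sum>S\<in>Pow ?A. \<Sum>w\<in>{w \<in> ?W. set w \<subseteq> S}. ?P S)"
    by (rule sum.swap_restrict) (use fW in auto)
  also have "\<dots> = (\<Sum>S\<in>Pow ?A. ?P S * card {w \<in> closed_walks S (2 * q). admissible w})"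
  proof (intro sum.cong refl)
    fix S assume "S \<in> Pow ?A"
    then have "{w \<in> ?W. set w \<subseteq> S} = {w \<in> closed_walks S (2 * q). admissible w}"
      by (auto simp: closed_walks_def)
    then show "(\<Sum>w\<in>{w \<in> ?W. set w \<subseteq> S}. ?P S) = ?P S * card {w \<in> closed_walks S (2 * q). admissible w}"
      by (simp del: Collect_conj_eq)
  qed
  also have "\<dots> \<le> (\<Sum>S\<in>Pow ?A. ?P S * (3 * real N * (ref_const * a * exp 1) ^ q * exp (t * card S)))"
  proof (intro sum_mono mult_left_mono P)
    fix S assume S: "S \<in> Pow ?A"
    then have fS: "finite S" by (auto intro: finite_subset)
    have "card S \<le> N" using S card_mono[of ?A S] by simp
    \<comment> \<open>From y <= e^y with y = (q + card S) / a. The dependence on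
      \<open>card S\<close> becomes exponential and can then be averaged over
      \<open>S\<close>.\<close>
    have key: "ref_const * real (q + card S) \<le> ref_const * a * exp 1 * exp (card S / a)"
    proof -
      have "real (q + card S) / a \<le> exp (real (q + card S) / a)"
        using exp_ge_add_one_self[of "real (q + card S) / a"] by linarith
      also have "\<dots> = exp (q / a) * exp (card S / a)"
        by (simp add: add_divide_distrib flip: exp_add)
      also have "\<dots> \<le> exp 1 * exp (card S / a)"
        using t by (intro mult_right_mono) (auto simp: t_def)
      finally have "real (q + card S) \<le> a * (exp 1 * exp (card S / a))"
        using a(1) by (simp add: divide_le_eq mult.commute)
      then have "ref_const * real (q + card S) \<le> ref_const * (a * (exp 1 * exp (card S / a)))"
        using C by (intro mult_left_mono) auto
      then show ?thesis by (simp only: mult.assoc)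
    qed
    have "real (card {w \<in> closed_walks S (2 * q). admissible w})
      \<le> average3 (edges_on S) (\<lambda>\<omega>. trace_power S (ref_mat \<omega>) (2 * q))"
      by (rule count_admissible_le_ref_trace[OF fS])
    also have "\<dots> \<le> 3 * real (card S) * (ref_const * real (q + card S)) ^ q"
      by (rule ref_mat_trace_le[OF fS])
    also have "\<dots> \<le> 3 * real N * (ref_const * a * exp 1 * exp (card S / a)) ^ q"
      using \<open>card S \<le> N\<close> C by (intro mult_mono power_mono key) auto
    also have "\<dots> = 3 * real N * (ref_const * a * exp 1) ^ q * exp (t * card S)"
      by (simp add: power_mult_distrib t_def exp_of_nat_mult[symmetric])
    finally show "real (card {w \<in> closed_walks S (2 * q). admissible w})
      \<le> 3 * real N * (ref_const * a * exp 1) ^ q * exp (t * card S)" .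
  qed
  also have "\<dots> = 3 * real N * (ref_const * a * exp 1) ^ q * (\<Sum>S\<in>Pow ?A. ?P S * exp (t * card S))"
    by (simp add: sum_distrib_left mult_ac)
  also have "\<dots> \<le> 3 * real N * (ref_const * a * exp 1) ^ q * exp (2 * real N * d * t)"
    using sum_Pow_Bernoulli_exp_le[of ?A d t] d t C a by (intro mult_left_mono) auto
  also have "\<dots> \<le> 3 * real N * (ref_const * a * exp 1) ^ q * exp (2 * real q)"
  proof (intro mult_left_mono exp_mono)
    \<comment> \<open>The mean size \<open>real N * d\<close> of the random set is at most
      \<open>a\<close>.\<close>
    have "2 * real N * d * t \<le> 2 * a * t"
      using a t by (intro mult_right_mono) auto
    also have "\<dots> = 2 * real q" using a by (simp add: t_def)
    finally show "2 * real N * d * t \<le> 2 * real q" .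
  qed (use C a in auto)
  \<comment> \<open>Per power, one factor e comes from \<open>key\<close> and two come from the
    average over \<open>S\<close>.\<close>
  also have "\<dots> = 3 * real N * (ref_const * exp 3 * a) ^ q"
  proof -
    have "exp (2 * real q) = exp 2 ^ q" by (simp add: exp_of_nat2_mult)
    moreover have "exp 1 * exp 2 = exp (3::real)" by (simp flip: exp_add)
    ultimately have "(ref_const * a * exp 1) ^ q * exp (2 * real q) = (ref_const * exp 3 * a) ^ q"
      by (simp flip: power_mult_distrib) (simp add: mult_ac)
    then show ?thesis by (simp add: mult.assoc)
  qed
  finally show ?thesis by simp
qed

subsection \<open>Tail bounds for the operator norm\<close>

text \<open>After expansion into walks, independence makes each expectation a product of moments
  over edges. The entries are bounded by 1, so every moment of order at least 2 is at most
  \<open>d\<close>, and an admissible walk has weight at most \<open>d\<close> to the number of its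
  edges. Positions outside \<open>J\<close> carry 0, which makes room for the block embedding of a
  rectangular matrix.\<close>

lemma (in prob_space) expectation_trace_power_le:
  fixes h :: "nat \<times> nat \<Rightarrow> 'a \<Rightarrow> real" and d c :: real
  assumes J: "J \<subseteq> edges_on {..<N}"
    and indep: "indep_vars (\<lambda>_. borel) h J"
    and bnd: "\<And>e \<omega>. e \<in> J \<Longrightarrow> \<omega> \<in> space M \<Longrightarrow> \<bar>h e \<omega>\<bar> \<le> 1"
    and mean: "\<And>e. e \<in> J \<Longrightarrow> expectation (h e) = 0"
    and var: "\<And>e. e \<in> J \<Longrightarrow> expectation (\<lambda>\<omega>. (h e \<omega>)\<^sup>2) \<le> d"
    and d: "0 < d" "d \<le> 1" and c: "c > 0" "real N * d \<le> c" "real q \<le> c"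
  defines "H \<equiv> \<lambda>\<omega> i j. if edge i j \<in> J then h (edge i j) \<omega> else 0"
  shows "integrable M (\<lambda>\<omega>. trace_power {..<N} (H \<omega>) (2 * q))"
    and "expectation (\<lambda>\<omega>. trace_power {..<N} (H \<omega>) (2 * q)) \<le> 3 * real N / d * (ref_const * exp 3 * c) ^ q"
proof -
  let ?S = "{..<N}" and ?W = "closed_walks {..<N} (2 * q)"
  have fJ: "finite J" using J finite_edges_on[of ?S] by (auto intro: finite_subset)
  have rv: "random_variable borel (h e)" if "e \<in> J" for e
    using indep that by (auto simp: indep_vars_def2)
  define g where "g \<omega> e = (if e \<in> J then h e \<omega> else 0)" for \<omega> e
  have tr: "trace_power ?S (H \<omega>) (2 * q) = (\<Sum>w\<in>?W. prod_list (map (g \<omega>) (walk_edges w)))" for \<omega>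
    by (rule trace_power_walks) (auto simp: H_def g_def)
  have int_pow: "integrable M (\<lambda>\<omega>. h e \<omega> ^ k)" if "e \<in> J" for e k
  proof (rule integrable_const_bound)
    show "AE \<omega> in M. norm (h e \<omega> ^ k) \<le> 1"
      using bnd[OF that] by (intro AE_I2) (simp add: power_abs power_le_one)
    show "random_variable borel (\<lambda>\<omega>. h e \<omega> ^ k)" using rv[OF that] by simp
  qed
  have abs_moment: "\<bar>expectation (\<lambda>\<omega>. h e \<omega> ^ k)\<bar> \<le> d" if e: "e \<in> J" and k: "k \<ge> 2" for e k
  proof -
    have "\<bar>expectation (\<lambda>\<omega>. h e \<omega> ^ k)\<bar> \<le> expectation (\<lambda>\<omega>. \<bar>h e \<omega> ^ k\<bar>)"
      by (rule integral_abs_bound)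
    also have "\<dots> \<le> expectation (\<lambda>\<omega>. (h e \<omega>)\<^sup>2)"
    proof (rule integral_mono)
      fix \<omega> assume "\<omega> \<in> space M"
      with bnd[OF e this] k have "\<bar>h e \<omega>\<bar> ^ k \<le> \<bar>h e \<omega>\<bar> ^ 2"
        by (intro power_decreasing) auto
      then show "\<bar>h e \<omega> ^ k\<bar> \<le> (h e \<omega>)\<^sup>2" by (simp add: power_abs)
    qed (use int_pow[OF e] in auto)
    also have "\<dots> \<le> d" by (rule var[OF e])
    finally show ?thesis .
  qed
  \<comment> \<open>The additional factor \<open>d\<close> turns \<open>d\<close> to the number of
    edges into at most \<open>d\<close> to the number of vertices, by
    \<open>card_set_walk_le\<close>.\<close>
  have walk: "integrable M (\<lambda>\<omega>. prod_list (map (g \<omega>) (walk_edges w)))"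
    "d * expectation (\<lambda>\<omega>. prod_list (map (g \<omega>) (walk_edges w))) \<le> (if admissible w then d ^ card (set w) else 0)"
    if w: "w \<in> ?W" for w
  proof -
    let ?c = "count_list (walk_edges w)"
    have "integrable M (\<lambda>\<omega>. prod_list (map (g \<omega>) (walk_edges w))) \<and>
      d * expectation (\<lambda>\<omega>. prod_list (map (g \<omega>) (walk_edges w))) \<le> (if admissible w then d ^ card (set w) else 0)"
    proof (cases "set (walk_edges w) \<subseteq> J")
      case False
      then obtain e where "e \<in> set (walk_edges w)" "e \<notin> J" by auto
      then have "0 \<in> set (map (g \<omega>) (walk_edges w))" for \<omega> by (force simp: g_def)
      then have z: "prod_list (map (g \<omega>) (walk_edges w)) = 0" for \<omega>
        by (simp only: prod_list_zero_iff)
      show ?thesis unfolding z using d by simp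
    next
      case True
      have "prod_list (map (g \<omega>) (walk_edges w)) = (\<Prod>e\<in>J. h e \<omega> ^ ?c e)" for \<omega>
        using prod_list_map_count[OF fJ True, of "g \<omega>"] by (simp add: g_def)
      moreover have "indep_vars (\<lambda>_. borel) (\<lambda>e \<omega>. h e \<omega> ^ ?c e) J"
        by (rule indep_vars_compose2[OF indep]) simp
      from indep_vars_integrable[OF fJ this int_pow] indep_vars_lebesgue_integral[OF fJ this int_pow]
      have "integrable M (\<lambda>\<omega>. \<Prod>e\<in>J. h e \<omega> ^ ?c e)"
        "expectation (\<lambda>\<omega>. \<Prod>e\<in>J. h e \<omega> ^ ?c e) = (\<Prod>e\<in>J. expectation (\<lambda>\<omega>. h e \<omega> ^ ?c e))"
        by auto
      moreover have "d * (\<Prod>e\<in>J. expectation (\<lambda>\<omega>. h e \<omega> ^ ?c e)) \<le> (if admissible w then d ^ card (set w) else 0)"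
      proof (cases "admissible w")
        case adm: True
        have "(\<Prod>e\<in>J. expectation (\<lambda>\<omega>. h e \<omega> ^ ?c e)) \<le> (\<Prod>e\<in>J. \<bar>expectation (\<lambda>\<omega>. h e \<omega> ^ ?c e)\<bar>)"
          unfolding abs_prod[symmetric] by simp
        also have "\<dots> \<le> (\<Prod>e\<in>J. if e \<in> set (walk_edges w) then d else 1)"
        proof (intro prod_mono conjI)
          fix e assume e: "e \<in> J"
          show "\<bar>expectation (\<lambda>\<omega>. h e \<omega> ^ ?c e)\<bar> \<le> (if e \<in> set (walk_edges w) then d else 1)"
          proof (cases "e \<in> set (walk_edges w)")
            case in_w: True
            then have "?c e \<noteq> 0" by (simp add: count_list_0_iff)
            moreover have "?c e \<noteq> 1" using adm unfolding admissible_def by blast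
            ultimately have "?c e \<ge> 2" by linarith
            from abs_moment[OF e this] in_w show ?thesis by simp
          next
            case False
            then have "?c e = 0" by (simp add: count_list_0_iff)
            with False show ?thesis by (simp add: prob_space)
          qed
        qed auto
        also have "\<dots> = d ^ card (set (walk_edges w))"
          using fJ True by (simp add: prod.If_cases Int_absorb1)
        finally have "d * (\<Prod>e\<in>J. expectation (\<lambda>\<omega>. h e \<omega> ^ ?c e)) \<le> d * d ^ card (set (walk_edges w))"
          using d by (intro mult_left_mono) auto
        also have "\<dots> = d ^ Suc (card (set (walk_edges w)))" by simp
        also have "\<dots> \<le> d ^ card (set w)"
          using d card_set_walk_le[of w] by (intro power_decreasing) auto
        finally show ?thesis using adm by simp
      next
        case False
        then obtain e where e: "?c e = 1" by (auto simp: admissible_def)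
        then have "e \<in> J" using True by (metis count_notin subsetD zero_neq_one)
        with mean have "(\<Prod>e\<in>J. expectation (\<lambda>\<omega>. h e \<omega> ^ ?c e)) = 0"
          using fJ by (intro prod_zero bexI[of _ e]) (simp_all add: e)
        with False show ?thesis by simp
      qed
      ultimately show ?thesis by simp
    qed
    then show "integrable M (\<lambda>\<omega>. prod_list (map (g \<omega>) (walk_edges w)))"
      "d * expectation (\<lambda>\<omega>. prod_list (map (g \<omega>) (walk_edges w))) \<le> (if admissible w then d ^ card (set w) else 0)"
      by auto
  qed
  show int: "integrable M (\<lambda>\<omega>. trace_power ?S (H \<omega>) (2 * q))"
    unfolding tr by (intro Bochner_Integration.integrable_sum walk)
  have "d * expectation (\<lambda>\<omega>. trace_power ?S (H \<omega>) (2 * q)) =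
    (\<Sum>w\<in>?W. d * expectation (\<lambda>\<omega>. prod_list (map (g \<omega>) (walk_edges w))))"
    unfolding tr using walk by (simp add: Bochner_Integration.integral_sum sum_distrib_left)
  also have "\<dots> \<le> (\<Sum>w\<in>?W. if admissible w then d ^ card (set w) else 0)"
    by (intro sum_mono walk)
  also have "\<dots> = (\<Sum>w | w \<in> ?W \<and> admissible w. d ^ card (set w))"
    using finite_closed_walks[of ?S "2 * q"] by (simp add: sum.If_cases Int_def)
  also have "\<dots> \<le> 3 * real N * (ref_const * exp 3 * c) ^ q"
    by (rule sum_admissible_walks_le[OF d c])
  finally show "expectation (\<lambda>\<omega>. trace_power ?S (H \<omega>) (2 * q)) \<le> 3 * real N / d * (ref_const * exp 3 * c) ^ q"
    using d by (simp add: pos_le_divide_eq mult.commute)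
qed

text \<open>Markov's inequality for the trace of the matrix divided by \<open>b\<close>. The
  exceptional set is defined through the trace, whose measurability is immediate, and not through
  \<open>mat_bound\<close>. The constant \<open>c\<close> dominates both contributions N d and q b^2
  to the base.\<close>

lemma (in prob_space) mat_bound_tail:
  fixes h :: "nat \<times> nat \<Rightarrow> 'a \<Rightarrow> real" and d b c t :: real
  assumes J: "J \<subseteq> edges_on {..<N}"
    and indep: "indep_vars (\<lambda>_. borel) h J"
    and b: "b > 0" and bnd: "\<And>e \<omega>. e \<in> J \<Longrightarrow> \<omega> \<in> space M \<Longrightarrow> \<bar>h e \<omega>\<bar> \<le> b"
    and mean: "\<And>e. e \<in> J \<Longrightarrow> expectation (h e) = 0"
    and var: "\<And>e. e \<in> J \<Longrightarrow> expectation (\<lambda>\<omega>. (h e \<omega>)\<^sup>2) \<le> d"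
    and d: "0 < d" "d \<le> b\<^sup>2" and c: "real N * d \<le> c" "2 ^ m * b\<^sup>2 \<le> c" and t: "t > 0"
  obtains A where "A \<in> events"
    "prob A \<le> 3 * real N * b\<^sup>2 / d * (ref_const * exp 3 * c / t\<^sup>2) ^ (2 ^ m)"
    "\<And>\<omega>. \<omega> \<in> space M - A \<Longrightarrow>
      mat_bound {..<N} {..<N} (\<lambda>i j. if edge i j \<in> J then h (edge i j) \<omega> else 0) t"
proof -
  let ?S = "{..<N}"
  \<comment> \<open>A power of two, as \<open>mat_bound_of_trace_power\<close> demands.\<close>
  define q where "q = (2::nat) ^ m"
  define h' where "h' e \<omega> = h e \<omega> / b" for e \<omega>
  define H where "H \<omega> i j = (if edge i j \<in> J then h' (edge i j) \<omega> else 0)" for \<omega> i j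
  have sb: "b\<^sup>2 > 0" using b by simp
  have c0: "c > 0" using c(2) sb by (smt (verit) zero_less_power mult_pos_pos)
  have p1: "indep_vars (\<lambda>_. borel) h' J"
    unfolding h'_def by (rule indep_vars_compose2[OF indep]) simp
  have p2: "\<bar>h' e \<omega>\<bar> \<le> 1" if "e \<in> J" "\<omega> \<in> space M" for e \<omega>
    using bnd[OF that] b by (simp add: h'_def abs_divide)
  have p3: "expectation (h' e) = 0" if "e \<in> J" for e
    using mean[OF that] by (simp add: h'_def[abs_def])
  have p4: "expectation (\<lambda>\<omega>. (h' e \<omega>)\<^sup>2) \<le> d / b\<^sup>2" if "e \<in> J" for e
    using var[OF that] b by (simp add: h'_def[abs_def] power_divide divide_right_mono)
  have p5: "0 < d / b\<^sup>2" and p6: "d / b\<^sup>2 \<le> 1" using d sb by auto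
  have p7: "c / b\<^sup>2 > 0" using c0 sb by simp
  have p8: "real N * (d / b\<^sup>2) \<le> c / b\<^sup>2" and p9: "real q \<le> c / b\<^sup>2"
    using c sb by (simp_all add: divide_right_mono pos_le_divide_eq q_def)
  note bound = expectation_trace_power_le[OF J p1 p2 p3 p4 p5 p6 p7 p8 p9, folded H_def]
  have int: "integrable M (\<lambda>\<omega>. trace_power ?S (H \<omega>) (2 * q))"
    by (rule bound(1))
  have ex: "expectation (\<lambda>\<omega>. trace_power ?S (H \<omega>) (2 * q))
      \<le> 3 * real N / (d / b\<^sup>2) * (ref_const * exp 3 * (c / b\<^sup>2)) ^ q"
    by (rule bound(2))
  have sym: "H \<omega> i j = H \<omega> j i" for \<omega> i j by (simp add: H_def edge_commute)
  have nonneg: "0 \<le> trace_power ?S (H \<omega>) (2 * q)" for \<omega>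
    using trace_power_even[of ?S "H \<omega>" q] sym by (simp add: sum_nonneg)
  define A where "A = {\<omega> \<in> space M. trace_power ?S (H \<omega>) (2 * q) \<ge> (t / b) ^ (2 * q)}"
  have "A \<in> events"
    unfolding A_def using int by measurable
  moreover have "prob A \<le> expectation (\<lambda>\<omega>. trace_power ?S (H \<omega>) (2 * q)) / (t / b) ^ (2 * q)"
    unfolding A_def using int nonneg t b
    by (intro integral_Markov_inequality_measure[where A = "{}"]) auto
  then have "prob A \<le> 3 * real N * b\<^sup>2 / d * (ref_const * exp 3 * c / t\<^sup>2) ^ q"
  proof (rule order_trans)
    have "expectation (\<lambda>\<omega>. trace_power ?S (H \<omega>) (2 * q)) / (t / b) ^ (2 * q)
      \<le> 3 * real N / (d / b\<^sup>2) * (ref_const * exp 3 * (c / b\<^sup>2)) ^ q / (t / b) ^ (2 * q)"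
      using ex t b by (intro divide_right_mono) auto
    also have "\<dots> = 3 * real N * b\<^sup>2 / d * (ref_const * exp 3 * c / t\<^sup>2) ^ q"
      using t b by (simp add: power_mult power_divide power_mult_distrib)
    finally show "expectation (\<lambda>\<omega>. trace_power ?S (H \<omega>) (2 * q)) / (t / b) ^ (2 * q)
      \<le> 3 * real N * b\<^sup>2 / d * (ref_const * exp 3 * c / t\<^sup>2) ^ q" .
  qed
  moreover have "mat_bound ?S ?S (\<lambda>i j. if edge i j \<in> J then h (edge i j) \<omega> else 0) t"
    if "\<omega> \<in> space M - A" for \<omega>
  proof -
    have "trace_power ?S (H \<omega>) (2 * 2 ^ m) \<le> (t / b) ^ (2 * 2 ^ m)"
      using that unfolding A_def q_def by force
    then have mb: "mat_bound ?S ?S (H \<omega>) (t / b)"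
      using t b sym by (intro mat_bound_of_trace_power) auto
    have "mat_bound ?S ?S (\<lambda>i j. b * H \<omega> i j) (b * (t / b))"
      using b by (intro mat_bound_scale[OF mb]) simp
    then have "mat_bound ?S ?S (\<lambda>i j. b * H \<omega> i j) t"
      using b by simp
    then show ?thesis
      by (rule mat_bound_cong) (use b in \<open>auto simp: H_def h'_def\<close>)
  qed
  ultimately show ?thesis using that by (simp add: q_def)
qed

section \<open>Symmetric and rectangular matrices under one tail bound\<close>

text \<open>Serves to move the independent entries of a rectangular matrix to their places in the
  symmetric block matrix.\<close>

lemma (in prob_space) indep_vars_reindex:
  assumes indep: "indep_vars M' X I" and g: "inj_on g J" "g ` J \<subseteq> I"
  shows "indep_vars (\<lambda>j. M' (g j)) (\<lambda>j. X (g j)) J"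
proof -
  let ?F = "\<lambda>i. {X i -` A \<inter> space M |A. A \<in> sets (M' i)}"
  have ind: "indep_sets ?F I" and rv: "\<And>i. i \<in> I \<Longrightarrow> random_variable (M' i) (X i)"
    using indep unfolding indep_vars_def2 by auto
  have "indep_sets (\<lambda>j. ?F (g j)) J"
  proof (rule indep_setsI)
    show "?F (g j) \<subseteq> events" if "j \<in> J" for j
      using ind that g(2) unfolding indep_sets_def by blast
    fix A K assume K: "K \<noteq> {}" "K \<subseteq> J" "finite K" and A: "\<forall>j\<in>K. A j \<in> ?F (g j)"
    define B where "B i = A (inv_into J g i)" for i
    have B: "B (g j) = A j" if "j \<in> K" for j
      using that K g by (simp add: B_def inv_into_f_f subset_iff)
    have inj: "inj_on g K" using g(1) K(2) by (rule inj_on_subset)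
    have "prob (\<Inter>i\<in>g ` K. B i) = (\<Prod>i\<in>g ` K. prob (B i))"
    proof (rule indep_setsD[OF ind])
      show "g ` K \<subseteq> I" using K g by auto
      show "\<forall>i\<in>g ` K. B i \<in> ?F i" using A B by simp
    qed (use K in auto)
    then show "prob (\<Inter>j\<in>K. A j) = (\<Prod>j\<in>K. prob (A j))"
      using B inj by (simp add: prod.reindex)
  qed
  then show ?thesis
    using rv g(2) unfolding indep_vars_def2 by auto
qed

lemma sum_shift_lessThan: "(\<Sum>k<n + p. if n \<le> k then f (k - n) else 0) = (\<Sum>j<p. f j)"
  for f :: "nat \<Rightarrow> real"
proof -
  have "(\<Sum>k<n + p. if n \<le> k then f (k - n) else 0) = (\<Sum>k\<in>{n..<n + p}. f (k - n))"
    by (rule sum.mono_neutral_cong_right) auto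
  also have "\<dots> = (\<Sum>j<p. f j)"
    by (rule sum.reindex_bij_witness[of _ "\<lambda>j. j + n" "\<lambda>k. k - n"]) auto
  finally show ?thesis .
qed

text \<open>In the asymmetric case the entry \<open>(i, j)\<close> is placed at position \<open>(i, n + j)\<close> of a symmetric
  matrix of size \<open>n + p\<close>.\<close>
lemma mat_bound_block:
  fixes A :: "nat \<Rightarrow> nat \<Rightarrow> real"
  assumes b: "mat_bound {..<n + p} {..<n + p} H t"
    and H: "\<And>i j. i < n \<Longrightarrow> j < p \<Longrightarrow> H i (n + j) = A i j"
  shows "mat_bound {..<n} {..<p} A t"
proof (rule mat_boundI)
  fix x :: "nat \<Rightarrow> real"
  define y where "y k = (if n \<le> k then x (k - n) else 0)" for k
  have "L2_set (\<lambda>i. \<Sum>j\<in>{..<p}. A i j * x j) {..<n} = L2_set (\<lambda>i. \<Sum>k\<in>{..<n + p}. H i k * y k) {..<n}"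
  proof (intro L2_set_cong refl)
    fix i assume i: "i \<in> {..<n}"
    have "(\<Sum>k<n + p. H i k * y k) = (\<Sum>k<n + p. if n \<le> k then A i (k - n) * x (k - n) else 0)"
    proof (intro sum.cong refl)
      fix k assume k: "k \<in> {..<n + p}"
      show "H i k * y k = (if n \<le> k then A i (k - n) * x (k - n) else 0)"
      proof (cases "n \<le> k")
        case True
        with k i have "H i (n + (k - n)) = A i (k - n)" by (intro H) auto
        with True show ?thesis by (simp add: y_def)
      qed (simp add: y_def)
    qed
    then show "(\<Sum>j<p. A i j * x j) = (\<Sum>k<n + p. H i k * y k)"
      using sum_shift_lessThan[where n = n and p = p and f = "\<lambda>j. A i j * x j"] by simp
  qed
  also have "\<dots> \<le> L2_set (\<lambda>i. \<Sum>k\<in>{..<n + p}. H i k * y k) {..<n + p}"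
    unfolding L2_set_def by (intro real_sqrt_le_mono sum_mono2) auto
  also have "\<dots> \<le> t * L2_set y {..<n + p}"
    by (rule mat_boundD[OF b])
  also have "L2_set y {..<n + p} = L2_set x {..<p}"
  proof -
    have "(\<Sum>k<n + p. (y k)\<^sup>2) = (\<Sum>k<n + p. if n \<le> k then (x (k - n))\<^sup>2 else 0)"
      by (intro sum.cong refl) (simp add: y_def)
    then show ?thesis
      using sum_shift_lessThan[where n = n and p = p and f = "\<lambda>j. (x j)\<^sup>2"] by (simp add: L2_set_def)
  qed
  finally show "L2_set (\<lambda>i. \<Sum>j\<in>{..<p}. A i j * x j) {..<n} \<le> t * L2_set x {..<p}" .
qed

text \<open>\<open>I\<close> is the set of independent positions and \<open>\<kappa> i j\<close> the independent position that determines
  the entry \<open>(i, j)\<close>.\<close>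
definition entry_pattern :: "nat \<Rightarrow> nat \<Rightarrow> (nat \<times> nat) set \<Rightarrow> (nat \<Rightarrow> nat \<Rightarrow> nat \<times> nat) \<Rightarrow> bool" where
  "entry_pattern n p I \<kappa> \<longleftrightarrow>
     I = {..<n} \<times> {..<p} \<and> \<kappa> = Pair \<or> p = n \<and> I = {(i, j). i \<le> j \<and> j < n} \<and> \<kappa> = edge"

lemma entry_patternD:
  assumes "entry_pattern n p I \<kappa>"
  shows "finite I" "I \<subseteq> {..<n} \<times> {..<p}" "\<And>i j. i < n \<Longrightarrow> j < p \<Longrightarrow> \<kappa> i j \<in> I"
proof -
  show I: "I \<subseteq> {..<n} \<times> {..<p}" using assms by (auto simp: entry_pattern_def)
  show "finite I" by (rule finite_subset[OF I]) simp
  show "\<kappa> i j \<in> I" if "i < n" "j < p" for i j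
    using assms that by (auto simp: entry_pattern_def edge_def min_def max_def)
qed

text \<open>The rectangular case is the block embedding of size n + p. The symmetric case has size
  n, and its bound is weakened to n + p so that both settings share one statement.\<close>

lemma (in prob_space) mat_bound_tail_entries:
  fixes h :: "nat \<times> nat \<Rightarrow> 'a \<Rightarrow> real" and d b c t :: real
  assumes pat: "entry_pattern n p I \<kappa>"
    and indep: "indep_vars (\<lambda>_. borel) h I"
    and b: "b > 0" and bnd: "\<And>e \<omega>. e \<in> I \<Longrightarrow> \<omega> \<in> space M \<Longrightarrow> \<bar>h e \<omega>\<bar> \<le> b"
    and mean: "\<And>e. e \<in> I \<Longrightarrow> expectation (h e) = 0"
    and var: "\<And>e. e \<in> I \<Longrightarrow> expectation (\<lambda>\<omega>. (h e \<omega>)\<^sup>2) \<le> d"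
    and d: "0 < d" "d \<le> b\<^sup>2" and c: "real (n + p) * d \<le> c" "2 ^ m * b\<^sup>2 \<le> c" and t: "t > 0"
  obtains A where "A \<in> events"
    "prob A \<le> 3 * real (n + p) * b\<^sup>2 / d * (ref_const * exp 3 * c / t\<^sup>2) ^ (2 ^ m)"
    "\<And>\<omega>. \<omega> \<in> space M - A \<Longrightarrow> mat_bound {..<n} {..<p} (\<lambda>i j. h (\<kappa> i j) \<omega>) t"
proof -
  consider (asym) "I = {..<n} \<times> {..<p}" "\<kappa> = Pair"
    | (sym) "p = n" "I = {(i, j). i \<le> j \<and> j < n}" "\<kappa> = edge"
    using pat unfolding entry_pattern_def by blast
  then show ?thesis
  proof cases
    case asym
    define g where "g e = (fst e, snd e - n)" for e :: "nat \<times> nat"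
    define J where "J = {..<n} \<times> {n..<n + p}"
    have gI: "g e \<in> I" if "e \<in> J" for e using that by (auto simp: g_def J_def asym)
    have J: "J \<subseteq> edges_on {..<n + p}" by (auto simp: J_def edges_on_def)
    have "indep_vars (\<lambda>_. borel) (\<lambda>e. h (g e)) J"
      using gI by (intro indep_vars_reindex[OF indep]) (auto simp: inj_on_def g_def J_def)
    from mat_bound_tail[OF J this b bnd[OF gI] mean[OF gI] var[OF gI] d c t]
    obtain A where A: "A \<in> events"
      "prob A \<le> 3 * real (n + p) * b\<^sup>2 / d * (ref_const * exp 3 * c / t\<^sup>2) ^ (2 ^ m)"
      "\<And>\<omega>. \<omega> \<in> space M - A \<Longrightarrow>
        mat_bound {..<n + p} {..<n + p} (\<lambda>i j. if edge i j \<in> J then h (g (edge i j)) \<omega> else 0) t"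
      by blast
    show ?thesis
    proof (rule that[OF A(1,2)])
      fix \<omega> assume "\<omega> \<in> space M - A"
      from A(3)[OF this] show "mat_bound {..<n} {..<p} (\<lambda>i j. h (\<kappa> i j) \<omega>) t"
        by (rule mat_bound_block) (auto simp: edge_def J_def g_def asym)
    qed
  next
    case sym
    have J: "I \<subseteq> edges_on {..<n}" by (auto simp: sym edges_on_def)
    have "real n * d \<le> real (n + p) * d" using d by (intro mult_right_mono) auto
    then have c': "real n * d \<le> c" using c(1) by linarith
    have C: "ref_const * exp 3 * c / t\<^sup>2 \<ge> 0"
    proof -
      have "0 \<le> c" using c'(1) d(1) by (smt (verit) mult_nonneg_nonneg of_nat_0_le_iff)
      then show ?thesis by (simp add: ref_const_def)
    qed
    from mat_bound_tail[OF J indep b bnd mean var d c' c(2) t]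
    obtain A where A: "A \<in> events"
      "prob A \<le> 3 * real n * b\<^sup>2 / d * (ref_const * exp 3 * c / t\<^sup>2) ^ (2 ^ m)"
      "\<And>\<omega>. \<omega> \<in> space M - A \<Longrightarrow>
        mat_bound {..<n} {..<n} (\<lambda>i j. if edge i j \<in> I then h (edge i j) \<omega> else 0) t"
      by blast
    show ?thesis
    proof (rule that[OF A(1)])
      have "3 * real n * b\<^sup>2 / d * (ref_const * exp 3 * c / t\<^sup>2) ^ (2 ^ m) \<le>
        3 * real (n + p) * b\<^sup>2 / d * (ref_const * exp 3 * c / t\<^sup>2) ^ (2 ^ m)"
        using d C by (intro mult_right_mono divide_right_mono) auto
      with A(2) show "prob A \<le> 3 * real (n + p) * b\<^sup>2 / d * (ref_const * exp 3 * c / t\<^sup>2) ^ (2 ^ m)"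
        by linarith
      fix \<omega> assume \<omega>: "\<omega> \<in> space M - A"
      show "mat_bound {..<n} {..<p} (\<lambda>i j. h (\<kappa> i j) \<omega>) t"
      proof (rule mat_boundI)
        fix x
        have "L2_set (\<lambda>i. \<Sum>j<p. h (\<kappa> i j) \<omega> * x j) {..<n} =
          L2_set (\<lambda>i. \<Sum>j<n. (if edge i j \<in> I then h (edge i j) \<omega> else 0) * x j) {..<n}"
          using entry_patternD(3)[OF pat] sym by (intro L2_set_cong sum.cong refl) auto
        also have "\<dots> \<le> t * L2_set x {..<p}"
          using mat_boundD[OF A(3)[OF \<omega>]] sym by simp
        finally show "L2_set (\<lambda>i. \<Sum>j<p. h (\<kappa> i j) \<omega> * x j) {..<n} \<le> t * L2_set x {..<p}" .
      qed
    qed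
  qed
qed

text \<open>The order of the trace has to be a power of two and also comparable to log n.\<close>

lemma dyadic_between:
  fixes L :: real
  assumes "L \<ge> 1"
  obtains m :: nat where "L \<le> 2 ^ m" "2 ^ m \<le> 2 * L"
proof -
  define m where "m = (LEAST m. L \<le> 2 ^ m)"
  obtain k :: nat where "L < 2 ^ k" using real_arch_pow[of 2 L] by auto
  then have 1: "L \<le> 2 ^ m" unfolding m_def by (rule LeastI[of "\<lambda>m. L \<le> 2 ^ m" k, OF less_imp_le])
  have "2 ^ m \<le> 2 * L"
  proof (cases m)
    case 0
    then show ?thesis using assms by simp
  next
    case (Suc l)
    then have "\<not> L \<le> 2 ^ l" using not_less_Least[of l "\<lambda>m. L \<le> 2 ^ m"] by (simp add: m_def)
    then show ?thesis using Suc by simp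
  qed
  with 1 show ?thesis by (rule that)
qed

subsection \<open>Increments of the nonlinearity\<close>

lemma borel_measurable_completion_AE:
  fixes f g :: "'a \<Rightarrow> real"
  assumes g: "g \<in> borel_measurable M" and ae: "AE x in M. f x = g x"
  shows "f \<in> borel_measurable (completion M)"
proof (rule measurableI)
  fix A :: "real set" assume A: "A \<in> sets borel"
  show "f -` A \<inter> space (completion M) \<in> sets (completion M)"
  proof (rule complete_measure.in_sets_AE[OF completion.complete_measure_axioms])
    show "AE x in completion M. (x \<in> g -` A \<inter> space M) = (x \<in> f -` A \<inter> space (completion M))"
      using AE_completion[OF ae] by eventually_elim simp
    show "g -` A \<inter> space M \<in> sets (completion M)"
      using measurable_sets[OF g A] by simp
  qed auto
qed auto

lemma power_one_plus_le: "(1 + u) ^ k \<le> 2 ^ k * (1 + u ^ k)" if "0 \<le> u" for u :: real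
proof -
  have "(1 + u) ^ k \<le> (2 * max 1 u) ^ k"
    using that by (intro power_mono) auto
  also have "\<dots> = 2 ^ k * max 1 u ^ k" by (rule power_mult_distrib)
  also have "max 1 u ^ k \<le> 1 + u ^ k"
    using that by (cases "u \<le> 1") (auto simp: max_def)
  finally show ?thesis by simp
qed

lemma polynomially_bounded_shift:
  assumes "polynomially_bounded f"
  obtains K m where "K > 0" "\<And>x z. \<bar>x\<bar> \<le> 1 \<Longrightarrow> \<bar>f (x + z) - f z\<bar> \<le> K * (1 + \<bar>z\<bar> ^ m)"
    "\<And>x z. \<bar>x\<bar> \<le> 1 \<Longrightarrow> \<bar>f (x + z)\<bar> \<le> K * (1 + \<bar>z\<bar> ^ m)"
proof -
  obtain C m where f: "\<And>x. \<bar>f x\<bar> \<le> C * (1 + \<bar>x\<bar> ^ m)"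
    using assms unfolding polynomially_bounded_def by blast
  define B where "B = \<bar>C\<bar> * (1 + 2 ^ m) + 1"
  have B: "\<bar>f (x + z)\<bar> \<le> B * (1 + \<bar>z\<bar> ^ m)" if "\<bar>x\<bar> \<le> 1" for x z
  proof -
    have "\<bar>x + z\<bar> ^ m \<le> (1 + \<bar>z\<bar>) ^ m"
      using that by (intro power_mono) auto
    also have "\<dots> \<le> 2 ^ m * (1 + \<bar>z\<bar> ^ m)"
      by (rule power_one_plus_le) simp
    finally have "\<bar>x + z\<bar> ^ m \<le> 2 ^ m * (1 + \<bar>z\<bar> ^ m)" .
    then have 1: "1 + \<bar>x + z\<bar> ^ m \<le> (1 + 2 ^ m) * (1 + \<bar>z\<bar> ^ m)"
    proof -
      have "(1 + 2 ^ m) * (1 + \<bar>z\<bar> ^ m) = 1 + \<bar>z\<bar> ^ m + 2 ^ m * (1 + \<bar>z\<bar> ^ m)"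
        by (simp add: algebra_simps)
      moreover have "0 \<le> \<bar>z\<bar> ^ m" by simp
      ultimately show ?thesis using \<open>\<bar>x + z\<bar> ^ m \<le> 2 ^ m * (1 + \<bar>z\<bar> ^ m)\<close> by linarith
    qed
    have "\<bar>f (x + z)\<bar> \<le> \<bar>C\<bar> * (1 + \<bar>x + z\<bar> ^ m)"
      using f[of "x + z"] by (rule order_trans) (intro mult_right_mono, auto)
    also have "\<dots> \<le> \<bar>C\<bar> * ((1 + 2 ^ m) * (1 + \<bar>z\<bar> ^ m))"
      by (intro mult_left_mono 1) auto
    also have "\<dots> \<le> B * (1 + \<bar>z\<bar> ^ m)"
      by (simp add: B_def distrib_right mult.assoc)
    finally show ?thesis .
  qed
  have "B > 0" by (simp add: B_def add_nonneg_pos)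
  show ?thesis
  proof (rule that)
    show "2 * B > 0" using \<open>B > 0\<close> by simp
    show "\<bar>f (x + z) - f z\<bar> \<le> 2 * B * (1 + \<bar>z\<bar> ^ m)" if "\<bar>x\<bar> \<le> 1" for x z
      using B[OF that, of z] B[of 0 z] by simp
    show "\<bar>f (x + z)\<bar> \<le> 2 * B * (1 + \<bar>z\<bar> ^ m)" if "\<bar>x\<bar> \<le> 1" for x z
      using B[OF that, of z] abs_ge_zero[of "f (x + z)"] by linarith
  qed
qed

section \<open>Means of shifted functions\<close>

text \<open>The weight \<open>z ^ j\<close> makes the induction over the coefficients close: one
  more factor \<open>x + z\<close> yields \<open>x\<close> times the same weight plus the weight of
  degree \<open>Suc j\<close>.\<close>

lemma moments_weighted_poly:
  fixes p :: "real poly"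
  assumes borel: "sets \<mu> = sets borel" and mom: "\<forall>k::nat. integrable \<mu> (\<lambda>x::real. x ^ k)"
  shows "integrable \<mu> (\<lambda>z. z ^ j * poly p (x + z))"
proof (induction p arbitrary: j)
  case 0
  then show ?case by simp
next
  case (pCons a p)
  have "integrable \<mu> (\<lambda>z. a * z ^ j + (x * (z ^ j * poly p (x + z)) + z ^ Suc j * poly p (x + z)))"
    using mom by (intro Bochner_Integration.integrable_add integrable_mult_right pCons.IH) auto
  then show ?case by (simp add: algebra_simps)
qed

text \<open>The recursion of \<open>moments_weighted_poly\<close> together with the product rule, so
  that nothing has to be differentiated under the integral.\<close>

lemma has_derivative_integral_poly_shift:
  fixes p :: "real poly"
  assumes borel: "sets \<mu> = sets borel" and mom: "\<forall>k::nat. integrable \<mu> (\<lambda>x::real. x ^ k)"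
  shows "((\<lambda>x. \<integral>z. z ^ j * poly p (x + z) \<partial>\<mu>) has_real_derivative (\<integral>z. z ^ j * poly (pderiv p) z \<partial>\<mu>)) (at 0)"
proof (induction p arbitrary: j)
  case 0
  then show ?case by simp
next
  case (pCons a p)
  note int = moments_weighted_poly[OF assms]
  let ?F = "\<lambda>j x. \<integral>z. z ^ j * poly p (x + z) \<partial>\<mu>"
  have "(\<integral>z. z ^ j * poly (pCons a p) (x + z) \<partial>\<mu>) = a * (\<integral>z. z ^ j \<partial>\<mu>) + (x * ?F j x + ?F (Suc j) x)" for x
  proof -
    have "(\<integral>z. z ^ j * poly (pCons a p) (x + z) \<partial>\<mu>) =
      (\<integral>z. a * z ^ j + (x * (z ^ j * poly p (x + z)) + z ^ Suc j * poly p (x + z)) \<partial>\<mu>)"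
      by (simp add: algebra_simps)
    also have "\<dots> = a * (\<integral>z. z ^ j \<partial>\<mu>) + (x * ?F j x + ?F (Suc j) x)"
    proof -
      have i1: "integrable \<mu> (\<lambda>z. a * z ^ j)" using mom by (intro integrable_mult_right) auto
      have i2: "integrable \<mu> (\<lambda>z. x * (z ^ j * poly p (x + z)))" by (intro integrable_mult_right int)
      note i3 = int[of "Suc j" p x]
      show ?thesis
        unfolding Bochner_Integration.integral_add[OF i1 Bochner_Integration.integrable_add[OF i2 i3]]
          Bochner_Integration.integral_add[OF i2 i3] by simp
    qed
    finally show ?thesis .
  qed
  moreover have "((\<lambda>x. a * (\<integral>z. z ^ j \<partial>\<mu>) + (x * ?F j x + ?F (Suc j) x)) has_real_derivative
    0 + ((1 * ?F j 0 + (\<integral>z. z ^ j * poly (pderiv p) z \<partial>\<mu>) * 0) + (\<integral>z. z ^ Suc j * poly (pderiv p) z \<partial>\<mu>))) (at 0)"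
    by (intro DERIV_add DERIV_const DERIV_mult DERIV_ident pCons.IH)
  moreover have "(\<integral>z. z ^ j * poly (pderiv (pCons a p)) z \<partial>\<mu>) =
    ?F j 0 + (\<integral>z. z ^ Suc j * poly (pderiv p) z \<partial>\<mu>)"
  proof -
    have "(\<integral>z. z ^ j * poly (pderiv (pCons a p)) z \<partial>\<mu>) =
      (\<integral>z. z ^ j * poly p (0 + z) + z ^ Suc j * poly (pderiv p) (0 + z) \<partial>\<mu>)"
      by (simp add: pderiv_pCons algebra_simps)
    also have "\<dots> = ?F j 0 + (\<integral>z. z ^ Suc j * poly (pderiv p) (0 + z) \<partial>\<mu>)"
      using int by (intro Bochner_Integration.integral_add)
    finally show ?thesis by simp
  qed
  ultimately show ?case by simp
qed

lemma integrable_poly: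
  fixes p :: "real poly"
  assumes "sets \<mu> = sets borel" "\<forall>k::nat. integrable \<mu> (\<lambda>x::real. x ^ k)"
  shows "integrable \<mu> (\<lambda>z. poly p (x + z))"
  using moments_weighted_poly[OF assms, of 0 p x] by simp

lemma borel_measurable_poly:
  fixes p :: "real poly"
  assumes "sets \<mu> = sets borel"
  shows "(\<lambda>z. poly p (x + z)) \<in> borel_measurable \<mu>"
proof -
  have "continuous_on UNIV (\<lambda>z. poly p (x + z))" by (intro continuous_intros)
  then have "(\<lambda>z. poly p (x + z)) \<in> borel_measurable borel"
    by (rule borel_measurable_continuous_onI)
  then show ?thesis using assms measurable_cong_sets by blast
qed

lemma integrable_growth_power:
  assumes borel: "sets \<mu> = sets borel" and mom: "\<forall>k::nat. integrable \<mu> (\<lambda>x::real. x ^ k)"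
    and "finite_measure \<mu>" and K: "K \<ge> 0"
  shows "integrable \<mu> (\<lambda>z. (K * (1 + \<bar>z\<bar> ^ m)) ^ k)"
proof -
  interpret finite_measure \<mu> by fact
  have meas: "(\<lambda>z. z) \<in> borel_measurable \<mu>"
    using borel_measurable_poly[OF borel, of "[:0, 1:]" 0] by simp
  have "integrable \<mu> (\<lambda>z. K ^ k * (2 ^ k * (1 + \<bar>z ^ (m * k)\<bar>)))"
    using mom by (intro integrable_mult_right Bochner_Integration.integrable_add integrable_abs) auto
  then show ?thesis
  proof (rule Bochner_Integration.integrable_bound)
    show "(\<lambda>z. (K * (1 + \<bar>z\<bar> ^ m)) ^ k) \<in> borel_measurable \<mu>"
      using meas by measurable
    have "(K * (1 + \<bar>z\<bar> ^ m)) ^ k \<le> K ^ k * (2 ^ k * (1 + \<bar>z ^ (m * k)\<bar>))" for z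
      using power_one_plus_le[of "\<bar>z\<bar> ^ m" k] K
      by (simp add: power_mult_distrib power_mult power_abs mult_left_mono)
    then show "AE z in \<mu>. norm ((K * (1 + \<bar>z\<bar> ^ m)) ^ k) \<le> norm (K ^ k * (2 ^ k * (1 + \<bar>z ^ (m * k)\<bar>)))"
      using K by (intro AE_I2) simp
  qed
qed

text \<open>For every \<open>K\<close>, the quotient tends to \<open>L K\<close> plus the partial
  sum of the products \<open>a\<^sub>k * b\<^sub>k\<close> up to \<open>K\<close>. By uniqueness of
  limits this number does not depend on \<open>K\<close>, and \<open>L K\<close> tends to 0: the
  convergence of the series and its value come out together.\<close>

lemma derivative_of_mean:
  assumes \<mu>: "real_distribution \<mu>" and mom: "\<forall>k::nat. integrable \<mu> (\<lambda>x. x ^ k)"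
    and q: "orthonormal_polys \<mu> q" and iv: "polynomial_approximation \<mu> q f"
    and "norm_mu \<mu> f > 0"
  shows "((\<lambda>x. 1 / x * (\<integral>z. f (x + z) \<partial>completion \<mu>)) \<longlongrightarrow> tau \<mu> q f * norm_mu \<mu> f) (at 0)"
    and "(\<integral>z. f z \<partial>completion \<mu>) = 0"
proof -
  interpret real_distribution \<mu> by fact
  have borel: "sets \<mu> = sets borel" by simp
  note int_poly = integrable_poly[OF borel mom] and meas_poly = borel_measurable_poly[OF borel]
  let ?a = "coeff_a \<mu> q f" and ?b = "coeff_b \<mu> q"
  obtain L where Lk: "\<And>K. ((\<lambda>x. 1 / x * (\<integral>z. f (x + z) - trunc \<mu> q f K (x + z) \<partial>completion \<mu>)) \<longlongrightarrow> L K) (at 0)"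
    and L: "L \<longlonglongrightarrow> 0" and a0: "?a 0 = 0"
    and ev: "\<forall>\<^sub>F x in at 0. integrable (completion \<mu>) (\<lambda>z. f (x + z))"
    using iv unfolding polynomial_approximation_def by blast
  obtain l where q0: "poly (q 0) = (\<lambda>_. l)" and l: "l > 0"
  proof -
    have "degree (q 0) = 0" "lead_coeff (q 0) > 0" using q unfolding orthonormal_polys_def by blast+
    then obtain c where "q 0 = [:c:]" by (auto elim: degree_eq_zeroE)
    with \<open>lead_coeff (q 0) > 0\<close> show ?thesis
      by (intro that[of c]) (auto simp: fun_eq_iff)
  qed
  from a0 l show "(\<integral>z. f z \<partial>completion \<mu>) = 0"
    by (simp add: coeff_a_def inner_mu_def q0)
  define P where "P K = (\<Sum>k=1..K. Polynomial.smult (?a k) (q k))" for K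
  have P: "trunc \<mu> q f K z = poly (P K) z" for K z
    by (simp add: trunc_def P_def poly_sum)
  \<comment> \<open>Orthogonality to \<open>q 0\<close>, which is a nonzero constant.\<close>
  have q_mean: "(\<integral>z. poly (q k) (0 + z) \<partial>\<mu>) = 0" if "k \<ge> 1" for k
  proof -
    have "inner_mu \<mu> (poly (q k)) (poly (q 0)) = 0"
      using q that unfolding orthonormal_polys_def by (metis of_bool_eq(1) not_one_le_zero)
    with l have "(\<integral>z. poly (q k) (0 + z) \<partial>completion \<mu>) = 0"
      by (simp add: inner_mu_def q0)
    then show ?thesis using integral_completion[OF meas_poly[of "q k" 0]] by simp
  qed
  have P_mean: "(\<integral>z. poly (P K) (0 + z) \<partial>\<mu>) = 0" for K
  proof -
    have "(\<integral>z. poly (P K) (0 + z) \<partial>\<mu>) = (\<integral>z. (\<Sum>k=1..K. ?a k * poly (q k) (0 + z)) \<partial>\<mu>)"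
      by (simp only: P_def poly_sum poly_smult)
    also have "\<dots> = (\<Sum>k=1..K. (\<integral>z. ?a k * poly (q k) (0 + z) \<partial>\<mu>))"
      by (intro Bochner_Integration.integral_sum integrable_mult_right int_poly)
    also have "\<dots> = 0"
      using q_mean by (intro sum.neutral) simp
    finally show ?thesis .
  qed
  have P_deriv: "(\<integral>z. poly (pderiv (P K)) z \<partial>\<mu>) = (\<Sum>k=1..K. ?a k * ?b k)" for K
  proof -
    have "(\<integral>z. poly (pderiv (P K)) z \<partial>\<mu>) = (\<integral>z. (\<Sum>k=1..K. ?a k * poly (pderiv (q k)) (0 + z)) \<partial>\<mu>)"
      by (simp add: P_def poly_sum pderiv_sum pderiv_smult)
    also have "\<dots> = (\<Sum>k=1..K. (\<integral>z. ?a k * poly (pderiv (q k)) (0 + z) \<partial>\<mu>))"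
      by (intro Bochner_Integration.integral_sum integrable_mult_right int_poly)
    also have "\<dots> = (\<Sum>k=1..K. ?a k * ?b k)"
      using integral_completion[OF meas_poly[of _ 0]] by (simp add: coeff_b_def inner_mu_def)
    finally show ?thesis .
  qed
  have P_lim: "((\<lambda>x. 1 / x * (\<integral>z. poly (P K) (x + z) \<partial>\<mu>)) \<longlongrightarrow> (\<Sum>k=1..K. ?a k * ?b k)) (at 0)" for K
    using has_derivative_integral_poly_shift[OF borel mom, of 0 "P K"] P_mean[of K]
    by (simp add: DERIV_def P_deriv)
  have lim: "((\<lambda>x. 1 / x * (\<integral>z. f (x + z) \<partial>completion \<mu>)) \<longlongrightarrow> L K + (\<Sum>k=1..K. ?a k * ?b k)) (at 0)" for K
  proof (rule Lim_transform_eventually)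
    show "((\<lambda>x. 1 / x * (\<integral>z. f (x + z) - trunc \<mu> q f K (x + z) \<partial>completion \<mu>) +
      1 / x * (\<integral>z. poly (P K) (x + z) \<partial>\<mu>)) \<longlongrightarrow> L K + (\<Sum>k=1..K. ?a k * ?b k)) (at 0)"
      by (intro tendsto_add Lk P_lim)
    show "\<forall>\<^sub>F x in at 0. 1 / x * (\<integral>z. f (x + z) - trunc \<mu> q f K (x + z) \<partial>completion \<mu>) +
      1 / x * (\<integral>z. poly (P K) (x + z) \<partial>\<mu>) = 1 / x * (\<integral>z. f (x + z) \<partial>completion \<mu>)"
      using ev
    proof eventually_elim
      case (elim x)
      have "integrable (completion \<mu>) (\<lambda>z. poly (P K) (x + z))"
        using int_poly meas_poly by (subst integrable_completion) auto
      with elim have "(\<integral>z. f (x + z) - trunc \<mu> q f K (x + z) \<partial>completion \<mu>) =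
        (\<integral>z. f (x + z) \<partial>completion \<mu>) - (\<integral>z. poly (P K) (x + z) \<partial>completion \<mu>)"
        by (simp add: P)
      then show ?case
        using integral_completion[OF meas_poly[of "P K" x]]
        by (simp add: diff_divide_distrib)
    qed
  qed
  have eq: "L K + (\<Sum>k=1..K. ?a k * ?b k) = L 0" for K
    using tendsto_unique[OF _ lim[of K] lim[of 0]] by simp
  have "(\<lambda>K. L 0 - L K) \<longlonglongrightarrow> L 0 - 0"
    by (intro tendsto_intros L)
  moreover have "L 0 - L K = (\<Sum>k<K. ?a (Suc k) * ?b (Suc k))" for K
  proof -
    have "L 0 - L K = (\<Sum>k=1..K. ?a k * ?b k)" using eq[of K] by linarith
    also have "\<dots> = (\<Sum>k<K. ?a (Suc k) * ?b (Suc k))"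
      using sum.atLeast1_atMost_eq[of "\<lambda>k. ?a k * ?b k" K] by simp
    finally show ?thesis .
  qed
  ultimately have "(\<lambda>k. ?a (Suc k) * ?b (Suc k)) sums L 0"
    by (simp add: sums_def)
  then have "tau \<mu> q f * norm_mu \<mu> f = L 0"
    using \<open>norm_mu \<mu> f > 0\<close> by (simp add: tau_def sums_unique[symmetric])
  with lim[of 0] show "((\<lambda>x. 1 / x * (\<integral>z. f (x + z) \<partial>completion \<mu>)) \<longlongrightarrow> tau \<mu> q f * norm_mu \<mu> f) (at 0)"
    by simp
qed

section \<open>Borel versions of the increments\<close>

text \<open>\<open>f\<close> need not be Borel, so every shift is replaced by an almost everywhere
  equal Borel function. A punctured neighbourhood says nothing about the shift 0; that one is
  recovered as a limit of nonzero shifts at the continuity points of \<open>f\<close>.\<close>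

lemma Borel_versions_of_shifts:
  fixes f :: "real \<Rightarrow> real"
  assumes \<mu>: "real_distribution \<mu>" and cont: "AE x in \<mu>. isCont f x"
    and ev: "\<forall>\<^sub>F x in at 0. integrable (completion \<mu>) (\<lambda>z. f (x + z))"
  obtains \<delta> g where "0 < \<delta>" "\<delta> \<le> 1" "\<And>x. g x \<in> borel_measurable \<mu>"
    "\<And>x. \<bar>x\<bar> < \<delta> \<Longrightarrow> AE z in \<mu>. f (x + z) = g x z"
proof -
  interpret real_distribution \<mu> by fact
  obtain d where d: "d > 0" "\<And>x. x \<noteq> 0 \<Longrightarrow> \<bar>x\<bar> < d \<Longrightarrow> integrable (completion \<mu>) (\<lambda>z. f (x + z))"
    using ev unfolding eventually_at by (auto simp: dist_real_def)
  have ex: "\<exists>g\<in>borel_measurable \<mu>. AE z in \<mu>. f (x + z) = g z" if "x \<noteq> 0" "\<bar>x\<bar> < d" for x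
    using borel_measurable_integrable[OF d(2)[OF that]] by (rule completion_ex_borel_measurable_real)
  have ex0: "\<exists>g\<in>borel_measurable \<mu>. AE z in \<mu>. f (0 + z) = g z"
  proof -
    \<comment> \<open>The offset 2 keeps the whole sequence strictly inside the radius
      \<open>d\<close>.\<close>
    define X where "X n = d / real (n + 2)" for n
    have X: "X n \<noteq> 0" "\<bar>X n\<bar> < d" for n
      using d(1) by (auto simp: X_def divide_less_eq)
    obtain G where G: "\<And>n. G n \<in> borel_measurable \<mu>" "\<And>n. AE z in \<mu>. f (X n + z) = G n z"
      using ex[OF X] by metis
    have "X \<longlonglongrightarrow> 0"
      unfolding X_def by (rule LIMSEQ_ignore_initial_segment[OF lim_const_over_n])
    have "AE z in \<mu>. \<forall>n. f (X n + z) = G n z"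
      using G(2) by (simp add: AE_all_countable)
    then have "AE z in \<mu>. f (0 + z) = lim (\<lambda>n. G n z)"
      using cont
    proof eventually_elim
      case (elim z)
      have "(\<lambda>n. X n + z) \<longlonglongrightarrow> 0 + z"
        by (intro tendsto_intros \<open>X \<longlonglongrightarrow> 0\<close>)
      then have "(\<lambda>n. f (X n + z)) \<longlonglongrightarrow> f (0 + z)"
        using elim(2) by (intro isCont_tendsto_compose[of _ f]) auto
      with elim(1) show ?case by (simp add: limI)
    qed
    moreover have "(\<lambda>z. lim (\<lambda>n. G n z)) \<in> borel_measurable \<mu>"
      using G(1) by (rule borel_measurable_lim_metric)
    ultimately show ?thesis by (intro bexI[of _ "\<lambda>z. lim (\<lambda>n. G n z)"])
  qed
  have "\<exists>g. g \<in> borel_measurable \<mu> \<and> (\<bar>x\<bar> < min d 1 \<longrightarrow> (AE z in \<mu>. f (x + z) = g z))" for x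
  proof (cases "\<bar>x\<bar> < min d 1")
    case True
    then show ?thesis using ex[of x] ex0 by (cases "x = 0") auto
  next
    case False
    then show ?thesis by (intro exI[of _ "\<lambda>_. 0"]) auto
  qed
  then obtain g where "\<And>x. g x \<in> borel_measurable \<mu>"
    "\<And>x. \<bar>x\<bar> < min d 1 \<Longrightarrow> AE z in \<mu>. f (x + z) = g x z" by metis
  with d(1) show ?thesis by (intro that[of "min d 1" g]) auto
qed

text \<open>The second moment vanishes by dominated convergence at continuity points; the linear
  mean is \<open>derivative_of_mean\<close>. The order 16 is made for truncation at n^(1/4): each of
  O(n^2) entries exceeds this level with probability O(n^-4), and the union bound stays
  summable.\<close>

lemma increment_versions:
  assumes \<mu>: "real_distribution \<mu>" and mom: "\<forall>k::nat. integrable \<mu> (\<lambda>x. x ^ k)"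
    and pb: "polynomially_bounded f" and cont: "AE x in \<mu>. isCont f x"
    and q: "orthonormal_polys \<mu> q" and iv: "polynomial_approximation \<mu> q f"
    and norm: "norm_mu \<mu> f > 0"
  obtains \<delta> \<phi> C where "0 < \<delta>" "\<And>x. \<phi> x \<in> borel_measurable borel"
    "\<And>x. \<bar>x\<bar> < \<delta> \<Longrightarrow> AE z in \<mu>. f (x + z) - f z = \<phi> x z"
    "\<And>x k. \<bar>x\<bar> < \<delta> \<Longrightarrow> integrable \<mu> (\<lambda>z. \<phi> x z ^ k)"
    "\<And>x. \<bar>x\<bar> < \<delta> \<Longrightarrow> (\<integral>z. \<phi> x z ^ 16 \<partial>\<mu>) \<le> C"
    "\<And>\<epsilon>. \<epsilon> > 0 \<Longrightarrow> \<forall>\<^sub>F x in nhds 0. (\<integral>z. (\<phi> x z)\<^sup>2 \<partial>\<mu>) \<le> \<epsilon>"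
    "\<And>\<epsilon>. \<epsilon> > 0 \<Longrightarrow> \<forall>\<^sub>F x in nhds 0. \<bar>(\<integral>z. \<phi> x z \<partial>\<mu>) - tau \<mu> q f * norm_mu \<mu> f * x\<bar> \<le> \<epsilon> * \<bar>x\<bar>"
proof -
  interpret real_distribution \<mu> by fact
  have borel: "sets \<mu> = sets borel" by simp
  have fin: "finite_measure \<mu>" by (rule finite_measure_axioms)
  have ev: "\<forall>\<^sub>F x in at 0. integrable (completion \<mu>) (\<lambda>z. f (x + z))"
    using iv unfolding polynomial_approximation_def by blast
  obtain \<delta> g where \<delta>: "0 < \<delta>" "\<delta> \<le> 1" and g: "\<And>x. g x \<in> borel_measurable \<mu>"
    and fg: "\<And>x. \<bar>x\<bar> < \<delta> \<Longrightarrow> AE z in \<mu>. f (x + z) = g x z"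
    using Borel_versions_of_shifts[OF \<mu> cont ev] by blast
  obtain K m where K: "K > 0" and Kd: "\<And>x z. \<bar>x\<bar> \<le> 1 \<Longrightarrow> \<bar>f (x + z) - f z\<bar> \<le> K * (1 + \<bar>z\<bar> ^ m)"
    and Kf: "\<And>x z. \<bar>x\<bar> \<le> 1 \<Longrightarrow> \<bar>f (x + z)\<bar> \<le> K * (1 + \<bar>z\<bar> ^ m)"
    using polynomially_bounded_shift[OF pb] by blast
  let ?w = "\<lambda>z. K * (1 + \<bar>z\<bar> ^ m)"
  define \<phi> where "\<phi> x z = g x z - g 0 z" for x z
  have \<phi>_meas: "\<phi> x \<in> borel_measurable \<mu>" for x
    unfolding \<phi>_def[abs_def] using g by measurable
  have \<phi>_eq: "AE z in \<mu>. f (x + z) - f z = \<phi> x z" if "\<bar>x\<bar> < \<delta>" for x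
    using fg[OF that] fg[of 0] \<delta> by (auto simp: \<phi>_def elim: eventually_elim2)
  have \<phi>_bound: "AE z in \<mu>. \<bar>\<phi> x z\<bar> \<le> ?w z" if "\<bar>x\<bar> < \<delta>" for x
    using \<phi>_eq[OF that]
  proof eventually_elim
    case (elim z)
    then show ?case using Kd[of x z] that \<delta> by simp
  qed
  have w_int: "integrable \<mu> (\<lambda>z. ?w z ^ k)" for k
    using K by (intro integrable_growth_power[OF borel mom fin]) auto
  have \<phi>_int: "integrable \<mu> (\<lambda>z. \<phi> x z ^ k)" if "\<bar>x\<bar> < \<delta>" for x k
  proof (rule Bochner_Integration.integrable_bound[OF w_int[of k]])
    show "(\<lambda>z. \<phi> x z ^ k) \<in> borel_measurable \<mu>" using \<phi>_meas by measurable
    show "AE z in \<mu>. norm (\<phi> x z ^ k) \<le> norm (?w z ^ k)"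
      using \<phi>_bound[OF that]
    proof eventually_elim
      case (elim z)
      then have "\<bar>\<phi> x z\<bar> ^ k \<le> ?w z ^ k" by (intro power_mono) auto
      then show ?case
        using abs_ge_self[of "?w z ^ k"] unfolding real_norm_def power_abs[of "\<phi> x z"] by linarith
    qed
  qed
  have \<phi>_16: "(\<integral>z. \<phi> x z ^ 16 \<partial>\<mu>) \<le> (\<integral>z. ?w z ^ 16 \<partial>\<mu>)" if "\<bar>x\<bar> < \<delta>" for x
  proof (rule integral_mono_AE[OF \<phi>_int[OF that] w_int])
    show "AE z in \<mu>. \<phi> x z ^ 16 \<le> ?w z ^ 16"
      using \<phi>_bound[OF that]
    proof eventually_elim
      case (elim z)
      then have "\<bar>\<phi> x z\<bar> ^ 16 \<le> ?w z ^ 16" by (intro power_mono) auto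
      then show ?case by simp
    qed
  qed
  \<comment> \<open>The increment at 0 is exactly 0, so estimates near 0 extend from punctured to
    full neighbourhoods.\<close>
  have \<phi>0: "\<phi> 0 z = 0" for z by (simp add: \<phi>_def)
  have sq: "((\<lambda>x. \<integral>z. (\<phi> x z)\<^sup>2 \<partial>\<mu>) \<longlongrightarrow> 0) (at 0)"
  proof (unfold tendsto_at_iff_sequentially comp_def, intro allI impI)
    fix X :: "nat \<Rightarrow> real" assume "\<forall>i. X i \<in> UNIV - {0}" and X: "X \<longlonglongrightarrow> 0"
    have Xe: "\<forall>\<^sub>F n in sequentially. \<bar>X n\<bar> < \<delta>"
      using tendstoD[OF X \<delta>(1)] by (simp add: dist_real_def)
    then obtain N where N: "\<And>n. n \<ge> N \<Longrightarrow> \<bar>X n\<bar> < \<delta>" by (auto simp: eventually_sequentially)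
    have "(\<lambda>n. \<integral>z. (\<phi> (X (n + N)) z)\<^sup>2 \<partial>\<mu>) \<longlonglongrightarrow> (\<integral>z. 0 \<partial>\<mu>)"
    proof (rule integral_dominated_convergence)
      show "integrable \<mu> (\<lambda>z. (?w z)\<^sup>2)" by (rule w_int)
      show "(\<lambda>z. (\<phi> (X (n + N)) z)\<^sup>2) \<in> borel_measurable \<mu>" for n using \<phi>_meas by measurable
      show "AE z in \<mu>. norm ((\<phi> (X (n + N)) z)\<^sup>2) \<le> (?w z)\<^sup>2" for n
        using \<phi>_bound[OF N[OF le_add2[of N n]]]
      proof eventually_elim
        case (elim z)
        then have "\<bar>\<phi> (X (n + N)) z\<bar>\<^sup>2 \<le> (?w z)\<^sup>2" by (intro power_mono) auto
        then show ?case by simp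
      qed
      have "AE z in \<mu>. \<forall>n. f (X (n + N) + z) - f z = \<phi> (X (n + N)) z"
        unfolding AE_all_countable using \<phi>_eq N by simp
      then show "AE z in \<mu>. (\<lambda>n. (\<phi> (X (n + N)) z)\<^sup>2) \<longlonglongrightarrow> 0"
        using cont
      proof eventually_elim
        case (elim z)
        have "(\<lambda>n. X (n + N) + z) \<longlonglongrightarrow> 0 + z"
          by (intro tendsto_intros LIMSEQ_ignore_initial_segment[OF X])
        then have "(\<lambda>n. f (X (n + N) + z)) \<longlonglongrightarrow> f z"
          using elim(2) by (intro isCont_tendsto_compose[of _ f]) auto
        then have "(\<lambda>n. (f (X (n + N) + z) - f z)\<^sup>2) \<longlonglongrightarrow> (f z - f z)\<^sup>2"
          by (intro tendsto_intros)
        with elim(1) show ?case by simp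
      qed
    qed auto
    then have "(\<lambda>n. \<integral>z. (\<phi> (X (n + N)) z)\<^sup>2 \<partial>\<mu>) \<longlonglongrightarrow> 0" by simp
    then show "(\<lambda>n. \<integral>z. (\<phi> (X n) z)\<^sup>2 \<partial>\<mu>) \<longlonglongrightarrow> 0" by (rule LIMSEQ_offset)
  qed
  \<comment> \<open>\<open>f\<close> has mean 0 by \<open>derivative_of_mean\<close>, so subtracting
    \<open>f z\<close> does not change the mean.\<close>
  have mean: "(\<integral>z. \<phi> x z \<partial>\<mu>) = (\<integral>z. f (x + z) \<partial>completion \<mu>)" if x: "\<bar>x\<bar> < \<delta>" for x
  proof -
    have f_int: "integrable (completion \<mu>) (\<lambda>z. f (y + z))" if y: "\<bar>y\<bar> < \<delta>" for y
    proof (rule Bochner_Integration.integrable_bound)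
      show "integrable (completion \<mu>) ?w"
        using w_int[of 1] by (subst integrable_completion) (auto simp: borel_measurable_integrable)
      show "(\<lambda>z. f (y + z)) \<in> borel_measurable (completion \<mu>)"
        using g fg[OF y] by (rule borel_measurable_completion_AE)
      show "AE z in completion \<mu>. norm (f (y + z)) \<le> norm (?w z)"
      proof (rule AE_I2)
        fix z
        have "\<bar>f (y + z)\<bar> \<le> ?w z" using Kf[of y z] y \<delta> by simp
        then show "norm (f (y + z)) \<le> norm (?w z)" by simp
      qed
    qed
    have "(\<integral>z. \<phi> x z \<partial>\<mu>) = (\<integral>z. \<phi> x z \<partial>completion \<mu>)"
      by (rule integral_completion[OF \<phi>_meas, symmetric])
    also have "\<dots> = (\<integral>z. f (x + z) - f (0 + z) \<partial>completion \<mu>)"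
    proof (rule integral_cong_AE)
      show "\<phi> x \<in> borel_measurable (completion \<mu>)" using \<phi>_meas by (rule measurable_completion)
      show "(\<lambda>z. f (x + z) - f (0 + z)) \<in> borel_measurable (completion \<mu>)"
        using f_int[OF x] f_int[of 0] \<delta> by (intro borel_measurable_diff borel_measurable_integrable) auto
      show "AE z in completion \<mu>. \<phi> x z = f (x + z) - f (0 + z)"
        using AE_completion[OF \<phi>_eq[OF x]] by eventually_elim simp
    qed
    also have "\<dots> = (\<integral>z. f (x + z) \<partial>completion \<mu>) - (\<integral>z. f (0 + z) \<partial>completion \<mu>)"
      using f_int[OF x] f_int[of 0] \<delta> by (intro Bochner_Integration.integral_diff) auto
    also have "\<dots> = (\<integral>z. f (x + z) \<partial>completion \<mu>)"
      using derivative_of_mean(2)[OF \<mu> mom q iv norm] by simp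
    finally show ?thesis .
  qed
  show ?thesis
  proof (rule that[of \<delta> \<phi> "\<integral>z. ?w z ^ 16 \<partial>\<mu>"])
    show "\<phi> x \<in> borel_measurable borel" for x
      using \<phi>_meas[of x] borel measurable_cong_sets by blast
    show "\<forall>\<^sub>F x in nhds 0. (\<integral>z. (\<phi> x z)\<^sup>2 \<partial>\<mu>) \<le> \<epsilon>" if "\<epsilon> > 0" for \<epsilon>
    proof -
      have "\<forall>\<^sub>F x in at 0. (\<integral>z. (\<phi> x z)\<^sup>2 \<partial>\<mu>) < \<epsilon>"
        using sq that by (rule order_tendstoD)
      then have "\<forall>\<^sub>F x in at 0. (\<integral>z. (\<phi> x z)\<^sup>2 \<partial>\<mu>) \<le> \<epsilon>"
        by eventually_elim simp
      then show ?thesis using that by (simp add: eventually_nhds_conv_at \<phi>0)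
    qed
    let ?t = "tau \<mu> q f * norm_mu \<mu> f"
    show "\<forall>\<^sub>F x in nhds 0. \<bar>(\<integral>z. \<phi> x z \<partial>\<mu>) - ?t * x\<bar> \<le> \<epsilon> * \<bar>x\<bar>" if "\<epsilon> > 0" for \<epsilon>
    proof -
      have "\<forall>\<^sub>F x in at 0. dist (1 / x * (\<integral>z. f (x + z) \<partial>completion \<mu>)) ?t < \<epsilon>"
        using derivative_of_mean(1)[OF \<mu> mom q iv norm] that by (rule tendstoD)
      moreover have "\<forall>\<^sub>F x in at (0::real). \<bar>x\<bar> < \<delta>"
        using \<delta> by (auto simp: eventually_at dist_real_def)
      moreover have "\<forall>\<^sub>F x in at (0::real). x \<noteq> 0"
        by (simp add: eventually_at_filter)
      ultimately have "\<forall>\<^sub>F x in at 0. \<bar>(\<integral>z. \<phi> x z \<partial>\<mu>) - ?t * x\<bar> \<le> \<epsilon> * \<bar>x\<bar>"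
      proof eventually_elim
        case (elim x)
        have "(\<integral>z. \<phi> x z \<partial>\<mu>) - ?t * x = (1 / x * (\<integral>z. f (x + z) \<partial>completion \<mu>) - ?t) * x"
          using elim(3) mean[OF elim(2)] by (simp add: left_diff_distrib)
        also have "\<bar>\<dots>\<bar> \<le> \<epsilon> * \<bar>x\<bar>"
          unfolding abs_mult using elim(1) by (intro mult_right_mono) (auto simp: dist_real_def)
        finally show ?case .
      qed
      moreover have "\<phi> 0 = (\<lambda>_. 0)" by (simp add: fun_eq_iff \<phi>0)
      ultimately show ?thesis by (simp add: eventually_nhds_conv_at)
    qed
  qed (use \<delta> \<phi>_eq \<phi>_int \<phi>_16 in auto)
qed

subsection \<open>Singular value decomposition of the signal\<close>

text \<open>det (t^2 - X^2) = det (t - X) det (t + X), and the sign comes from det (t + X) = (-1)^n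
  det (- t - X).\<close>

lemma poly_char_poly_square:
  fixes X :: "real mat"
  assumes X: "X \<in> carrier_mat n n"
  shows "poly (char_poly (X * X)) (t\<^sup>2) = poly (char_poly X) t * ((- 1) ^ n * poly (char_poly X) (- t))"
proof -
  have XX: "X * X \<in> carrier_mat n n" using X by simp
  have c: "char_matrix X t \<in> carrier_mat n n" "char_matrix X (- t) \<in> carrier_mat n n"
    using X by (auto simp: char_matrix_def)
  have eq: "- char_matrix (X * X) (t\<^sup>2) = (- char_matrix X t) * char_matrix X (- t)"
  proof -
    have "(- char_matrix X t) * char_matrix X (- t) = - (char_matrix X t * char_matrix X (- t))"
      using c by (intro uminus_mult_left_mat) auto
    also have "char_matrix X t * char_matrix X (- t) = (X + (- t) \<cdot>\<^sub>m 1\<^sub>m n) * (X + t \<cdot>\<^sub>m 1\<^sub>m n)"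
      using X by (simp add: char_matrix_def)
    also have "\<dots> = (X + (- t) \<cdot>\<^sub>m 1\<^sub>m n) * X + (X + (- t) \<cdot>\<^sub>m 1\<^sub>m n) * (t \<cdot>\<^sub>m 1\<^sub>m n)"
      using X by (intro mult_add_distrib_mat) auto
    also have "(X + (- t) \<cdot>\<^sub>m 1\<^sub>m n) * X = X * X + ((- t) \<cdot>\<^sub>m 1\<^sub>m n) * X"
      using X by (intro add_mult_distrib_mat) auto
    also have "((- t) \<cdot>\<^sub>m 1\<^sub>m n) * X = (- t) \<cdot>\<^sub>m X"
      using X by (subst mult_smult_assoc_mat[of _ n n]) auto
    also have "(X + (- t) \<cdot>\<^sub>m 1\<^sub>m n) * (t \<cdot>\<^sub>m 1\<^sub>m n) = t \<cdot>\<^sub>m (X + (- t) \<cdot>\<^sub>m 1\<^sub>m n)"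
      using X by (subst mult_smult_distrib[of _ n n]) auto
    also have "X * X + (- t) \<cdot>\<^sub>m X + t \<cdot>\<^sub>m (X + (- t) \<cdot>\<^sub>m 1\<^sub>m n) = X * X + (- t\<^sup>2) \<cdot>\<^sub>m 1\<^sub>m n"
      using X by (intro eq_matI) (auto simp: power2_eq_square algebra_simps)
    also have "\<dots> = char_matrix (X * X) (t\<^sup>2)"
      using X by (simp add: char_matrix_def)
    finally show ?thesis by simp
  qed
  have "poly (char_poly (X * X)) (t\<^sup>2) = Determinant.det (- char_matrix X t) * Determinant.det (char_matrix X (- t))"
    unfolding char_poly_matrix[OF XX] eq by (rule det_mult[of _ n]) (use c in auto)
  also have "Determinant.det (- char_matrix X t) = poly (char_poly X) t"
    by (rule char_poly_matrix[OF X, symmetric])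
  also have "Determinant.det (char_matrix X (- t)) = (- 1) ^ n * poly (char_poly X) (- t)"
  proof -
    have "char_matrix X (- t) = (- 1) \<cdot>\<^sub>m (- char_matrix X (- t))"
      using c by (intro eq_matI) auto
    then have "Determinant.det (char_matrix X (- t)) = Determinant.det ((- 1) \<cdot>\<^sub>m (- char_matrix X (- t)))"
      by (rule arg_cong)
    also have "\<dots> = (- 1) ^ n * Determinant.det (- char_matrix X (- t))"
      unfolding det_smult using c by simp
    finally show ?thesis by (simp only: char_poly_matrix[OF X])
  qed
  finally show ?thesis .
qed

lemma prod_linear_factors_dvd:
  fixes p :: "real poly"
  assumes "finite A" "inj_on l A" "\<And>k. k \<in> A \<Longrightarrow> poly p (l k) = 0"
  shows "(\<Prod>k\<in>A. [:- l k, 1:]) dvd p"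
  using assms
proof (induction A rule: finite_induct)
  case empty
  then show ?case by simp
next
  case (insert a A)
  then have "(\<Prod>k\<in>A. [:- l k, 1:]) dvd p" by (intro insert.IH) (auto simp: inj_on_def)
  then obtain s where s: "p = (\<Prod>k\<in>A. [:- l k, 1:]) * s" by (auto elim: dvdE)
  have "poly (\<Prod>k\<in>A. [:- l k, 1:]) (l a) \<noteq> 0"
    using insert by (auto simp: poly_prod inj_on_def)
  moreover have "poly p (l a) = 0" using insert by simp
  ultimately have "poly s (l a) = 0" by (simp add: s)
  then have "[:- l a, 1:] dvd s" by (simp add: poly_eq_0_iff_dvd)
  then have "[:- l a, 1:] * (\<Prod>k\<in>A. [:- l k, 1:]) dvd s * (\<Prod>k\<in>A. [:- l k, 1:])"
    by (rule mult_dvd_mono) simp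
  with insert s show ?case by (simp add: mult.commute)
qed

text \<open>With \<open>T = t\<^sup>2\<close> and \<open>D = \<Prod>(T - l k\<^sup>2)\<close>, the remainder of the characteristic polynomial modulo \<open>D\<close>
  vanishes after substituting \<open>t\<^sup>2\<close> for \<open>T\<close>, because \<open>\<Prod>(t - l k)(t + l k)\<close> divides both other terms.\<close>
lemma prod_squares_dvd_char_poly_square:
  fixes X :: "real mat"
  assumes X: "X \<in> carrier_mat n n" and A: "finite A" "inj_on l A"
    and root: "\<And>k. k \<in> A \<Longrightarrow> poly (char_poly X) (l k) = 0"
  shows "(\<Prod>k\<in>A. [:- (l k)\<^sup>2, 1:]) dvd char_poly (X * X)"
proof -
  let ?P = "char_poly X" and ?Q = "char_poly (X * X)" and ?T = "[:0, 0, 1:] :: real poly"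
  define D where "D = (\<Prod>k\<in>A. [:- (l k)\<^sup>2, 1:])"
  \<comment> \<open>The polynomial in t whose value is det (t + X).\<close>
  define P' where "P' = Polynomial.smult ((- 1) ^ n) (?P \<circ>\<^sub>p [:0, - 1:])"
  have Q: "?Q \<circ>\<^sub>p ?T = ?P * P'"
  proof -
    have "poly (?Q \<circ>\<^sub>p ?T) t = poly (?P * P') t" for t
      using poly_char_poly_square[OF X, of t]
      by (simp add: poly_pcompose P'_def power2_eq_square)
    then show ?thesis by (simp add: poly_eq_poly_eq_iff[symmetric] fun_eq_iff)
  qed
  have deg: "degree D = card A"
    using A(1) unfolding D_def by (subst degree_prod_eq_sum_degree) auto
  have DT: "D \<circ>\<^sub>p ?T = (\<Prod>k\<in>A. [:- l k, 1:]) * (\<Prod>k\<in>A. [:- (- l k), 1:])"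
    unfolding D_def pcompose_prod prod.distrib[symmetric]
    by (intro prod.cong refl) (simp add: pcompose_pCons power2_eq_square)
  have "(\<Prod>k\<in>A. [:- l k, 1:]) dvd ?P"
    using A root by (rule prod_linear_factors_dvd)
  moreover have "(\<Prod>k\<in>A. [:- (- l k), 1:]) dvd P'"
  proof (rule prod_linear_factors_dvd[OF A(1)])
    show "inj_on (\<lambda>k. - l k) A" using A(2) by (auto simp: inj_on_def)
    show "poly P' (- l k) = 0" if "k \<in> A" for k
      using root[OF that] by (simp add: P'_def poly_pcompose)
  qed
  ultimately have dvd: "D \<circ>\<^sub>p ?T dvd ?Q \<circ>\<^sub>p ?T"
    unfolding DT Q by (rule mult_dvd_mono)
  define R where "R = ?Q mod D"
  have "?Q = (?Q div D) * D + R" by (simp add: R_def)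
  then have "?Q \<circ>\<^sub>p ?T = ((?Q div D) \<circ>\<^sub>p ?T) * (D \<circ>\<^sub>p ?T) + R \<circ>\<^sub>p ?T"
    by (metis pcompose_add pcompose_mult)
  with dvd have "D \<circ>\<^sub>p ?T dvd R \<circ>\<^sub>p ?T"
    by (metis dvd_add_right_iff dvd_triv_right)
  moreover have "D \<noteq> 0" unfolding D_def using A(1) by auto
  moreover have "R \<circ>\<^sub>p ?T = 0 \<longleftrightarrow> R = 0"
    by (rule pcompose_eq_0_iff) simp
  \<comment> \<open>Substituting \<open>?T\<close> doubles degrees: otherwise a nonzero polynomial
    of degree below 2 card A would be divisible by one of degree 2 card A.\<close>
  ultimately have "R = 0"
    using dvd_imp_degree_le[of "D \<circ>\<^sub>p ?T" "R \<circ>\<^sub>p ?T"] degree_mod_less'[of D ?Q]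
    by (fastforce simp: degree_pcompose R_def)
  then show ?thesis by (simp add: R_def D_def mod_eq_0_iff_dvd)
qed

text \<open>The list is decreasing. If the entry at \<open>i - 1\<close> were not positive, all
  positive entries would precede it, and there would be fewer than \<open>i \<le> r\<close> of
  them.\<close>

lemma rev_sorted_list_nth_pos:
  fixes M :: "real multiset"
  assumes "r \<le> size (filter_mset (\<lambda>x. x > 0) M)" "i \<in> {1..r}"
  shows "rev (sorted_list_of_multiset M) ! (i - 1) > 0"
proof (rule ccontr)
  let ?L = "rev (sorted_list_of_multiset M)"
  assume neg: "\<not> ?L ! (i - 1) > 0"
  have sd: "sorted_wrt (\<lambda>x y. y \<le> x) ?L"
    by (simp add: sorted_wrt_rev)
  have M: "mset ?L = M" by simp
  have "{j. j < length ?L \<and> ?L ! j > 0} \<subseteq> {..<i - 1}"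
  proof (rule subsetI, rule ccontr)
    fix j assume j: "j \<in> {j. j < length ?L \<and> ?L ! j > 0}" "j \<notin> {..<i - 1}"
    then have "?L ! j \<le> ?L ! (i - 1)"
      using sd by (cases "j = i - 1") (auto simp: sorted_wrt_iff_nth_less)
    with j neg show False by simp
  qed
  then have "card {j. j < length ?L \<and> ?L ! j > 0} \<le> i - 1"
    using card_mono[of "{..<i - 1}"] by fastforce
  moreover have "size (filter_mset (\<lambda>x. x > 0) M) = length (filter (\<lambda>x. x > 0) ?L)"
    by (subst M[symmetric], subst mset_filter[symmetric], subst size_mset) simp
  ultimately show False
    using assms by (auto simp: length_filter_conv_card)
qed

text \<open>The symmetric setting prescribes eigenvalues, whereas \<open>singular_value\<close>
  refers to the spectrum of the square. Divisibility of polynomials keeps track of multiplicities: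
  opposite eigenvalues have the same square but account for two singular values.\<close>

lemma singular_value_pos_symmetric:
  fixes X :: "real mat"
  assumes X: "X \<in> carrier_mat n n" "transpose_mat X = X"
    and l: "\<And>k. k \<in> {1..r} \<Longrightarrow> l k \<noteq> 0" "inj_on l {1..r}"
    and ev: "filter_mset (\<lambda>x. x \<noteq> 0) (eigenvalue_mset X) = image_mset l (mset_set {1..r})"
    and i: "i \<in> {1..r}"
  shows "singular_value i X > 0"
proof -
  have P0: "char_poly X \<noteq> 0" using degree_monic_char_poly[OF X(1)] by auto
  have XX: "X * X \<in> carrier_mat n n" using X by simp
  have Q0: "char_poly (X * X) \<noteq> 0" using degree_monic_char_poly[OF XX] by auto
  have root: "poly (char_poly X) (l k) = 0" if "k \<in> {1..r}" for k
  proof -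
    have "l k \<in># image_mset l (mset_set {1..r})" using that by simp
    then have "l k \<in># eigenvalue_mset X" unfolding ev[symmetric] by simp
    then show ?thesis using P0 by (simp add: eigenvalue_mset_def)
  qed
  let ?D = "\<Prod>k\<in>{1..r}. [:- (l k)\<^sup>2, 1:]"
  have "?D dvd char_poly (X * X)"
    by (rule prod_squares_dvd_char_poly_square[OF X(1) _ l(2) root]) auto
  then obtain s where s: "char_poly (X * X) = ?D * s" by (auto elim: dvdE)
  have "proots ?D = (\<Sum>k\<in>{1..r}. {# (l k)\<^sup>2 #})"
    by (subst proots_prod) (auto simp: proots_linear_factor simp del: One_nat_def)
  then have D: "proots ?D = image_mset (\<lambda>k. (l k)\<^sup>2) (mset_set {1..r})"
    by (simp add: sum_unfold_sum_mset)
  let ?M = "image_mset sqrt (eigenvalue_mset (transpose_mat X * X))"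
  have "?M = image_mset sqrt (proots ?D) + image_mset sqrt (proots s)"
    using Q0 unfolding X(2) eigenvalue_mset_def s by (subst proots_mult) auto
  then have "size (filter_mset (\<lambda>x. x > 0) ?M) \<ge> size (filter_mset (\<lambda>x. x > 0) (image_mset sqrt (proots ?D)))"
    by simp
  also have "image_mset sqrt (proots ?D) = image_mset (\<lambda>k. \<bar>l k\<bar>) (mset_set {1..r})"
    unfolding D by (simp add: image_mset.compositionality comp_def)
  also have "filter_mset (\<lambda>x. x > 0) (image_mset (\<lambda>k. \<bar>l k\<bar>) (mset_set {1..r})) = image_mset (\<lambda>k. \<bar>l k\<bar>) (mset_set {1..r})"
    using l(1) by (intro multiset_eqI) (auto simp: not_in_iff[symmetric])
  finally have "r \<le> size (filter_mset (\<lambda>x. x > 0) ?M)" by simp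
  from rev_sorted_list_nth_pos[OF this i] show ?thesis
    by (simp add: singular_value_def)
qed

text \<open>From X v = s u and X u = s v, each of u + v and u - v is zero or an eigenvector, for s
  and - s respectively, and they do not both vanish. So s is the absolute value of some
  \<open>l k\<close>; the sum is a bound that needs no matching of indices.\<close>

lemma singular_value_abs_le_symmetric:
  fixes X :: "real mat"
  assumes X: "X \<in> carrier_mat n n" "transpose_mat X = X"
    and ev: "filter_mset (\<lambda>x. x \<noteq> 0) (eigenvalue_mset X) = image_mset l (mset_set {1..r})"
    and sv: "singular_vectors X r u v" and i: "i \<in> {1..r}" and pos: "singular_value i X > 0"
  shows "singular_value i X \<le> (\<Sum>k\<in>{1..r}. \<bar>l k\<bar>)"
proof -
  let ?s = "singular_value i X"
  have P0: "char_poly X \<noteq> 0" using degree_monic_char_poly[OF X(1)] by auto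
  have uv: "u i \<in> carrier_vec n" "v i \<in> carrier_vec n" "X *\<^sub>v v i = ?s \<cdot>\<^sub>v u i" "X *\<^sub>v u i = ?s \<cdot>\<^sub>v v i"
    and u1: "u i \<bullet> u i = 1"
    using sv i X unfolding singular_vectors_def by auto
  have "u i \<noteq> 0\<^sub>v n" using u1 uv(1) by auto
  have "X *\<^sub>v (u i + v i) = ?s \<cdot>\<^sub>v (u i + v i)"
    using uv X by (simp add: mult_add_distrib_mat_vec smult_add_distrib_vec comm_add_vec)
  moreover have "X *\<^sub>v (u i - v i) = (- ?s) \<cdot>\<^sub>v (u i - v i)"
    using uv X by (subst mult_minus_distrib_mat_vec) (auto intro!: eq_vecI simp: algebra_simps)
  moreover have "u i + v i \<noteq> 0\<^sub>v n \<or> u i - v i \<noteq> 0\<^sub>v n"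
  proof (rule ccontr)
    assume "\<not> ?thesis"
    then have e: "u i + v i = 0\<^sub>v n" "u i - v i = 0\<^sub>v n" by auto
    have "u i = 0\<^sub>v n"
    proof (rule eq_vecI)
      fix j assume j: "j < dim_vec (0\<^sub>v n :: real Matrix.vec)"
      with e have "(u i + v i) $ j = 0" "(u i - v i) $ j = 0" by auto
      with j uv show "u i $ j = 0\<^sub>v n $ j" by simp
    qed (use uv in auto)
    with \<open>u i \<noteq> 0\<^sub>v n\<close> show False by simp
  qed
  moreover have "u i + v i \<in> carrier_vec n" "u i - v i \<in> carrier_vec n" using uv by auto
  ultimately have "eigenvector X (u i + v i) ?s \<or> eigenvector X (u i - v i) (- ?s)"
    using X(1) unfolding eigenvector_def by auto
  then have "eigenvalue X ?s \<or> eigenvalue X (- ?s)"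
    unfolding eigenvalue_def by blast
  then obtain y where y: "eigenvalue X y" "\<bar>y\<bar> = ?s" using pos by auto
  then have "y \<in># eigenvalue_mset X" "y \<noteq> 0"
    using pos P0 by (auto simp: eigenvalue_root_char_poly[OF X(1)] eigenvalue_mset_def)
  then have "y \<in># filter_mset (\<lambda>x. x \<noteq> 0) (eigenvalue_mset X)" by simp
  then obtain k where k: "k \<in> {1..r}" "y = l k" unfolding ev by auto
  have "\<bar>l k\<bar> \<le> (\<Sum>k\<in>{1..r}. \<bar>l k\<bar>)"
    using k by (intro member_le_sum) auto
  with k y show ?thesis by simp
qed

section \<open>Expansion of a matrix in its singular vectors\<close>

text \<open>The columns of \<open>C\<close> form a maximal independent set of columns of
  \<open>A\<close>, and \<open>D\<close> holds the coordinates of all columns with respect to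
  it.\<close>

lemma rank_factorization:
  fixes A :: "real mat"
  assumes A: "A \<in> carrier_mat n nc" and r: "vec_space.rank n A = r"
  obtains C D where "\<And>a b. a < n \<Longrightarrow> b < nc \<Longrightarrow> A $$ (a, b) = (\<Sum>k<r. C a k * D k b)"
proof -
  interpret vec_space "TYPE(real)" n .
  have cols: "set (cols A) \<subseteq> carrier_vec n" using cols_dim A by blast
  have "\<exists>S. finite S \<and> maximal S (\<lambda>T. T \<subseteq> set (cols A) \<and> lin_indpt T) \<and> {} \<subseteq> S"
    by (rule maximal_exists_superset[of "set (cols A)"]) (auto simp: lin_dep_def)
  then obtain S where S: "finite S" "maximal S (\<lambda>T. T \<subseteq> set (cols A) \<and> lin_indpt T)" by blast
  then have SA: "S \<subseteq> set (cols A)" and li: "lin_indpt S" by (auto simp: maximal_def)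
  have SC: "S \<subseteq> carrier_vec n" using SA cols by auto
  have card: "card S = r" using rank_card_indpt[OF A S(2)] r by simp
  have span: "c \<in> span S" if c: "c \<in> set (cols A)" for c
  proof (cases "c \<in> S")
    case True
    then show ?thesis using SC by (intro span_mem) auto
  next
    case False
    have "lin_dep (insert c S)"
    proof (rule ccontr)
      assume "\<not> lin_dep (insert c S)"
      with S(2) c SA have "S = insert c S"
        unfolding maximal_def by (metis insert_subset subset_insertI)
      with False show False by auto
    qed
    then show ?thesis using lin_dep_iff_in_span[OF _ li _ False] SC c cols by auto
  qed
  have "\<exists>d. \<forall>a<n. A $$ (a, b) = (\<Sum>s\<in>S. d s * s $ a)" if b: "b < nc" for b
  proof -
    have "col A b \<in> span S" using span[of "col A b"] b A by (simp add: cols_def)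
    then obtain d where d: "col A b = lincomb d S"
      using finite_span[OF S(1)] SC by auto
    have "A $$ (a, b) = (\<Sum>s\<in>S. d s * s $ a)" if "a < n" for a
      using lincomb_index[OF that SC, of d] that b A by (simp add: d[symmetric])
    then show ?thesis by blast
  qed
  then obtain d where d: "\<And>a b. b < nc \<Longrightarrow> a < n \<Longrightarrow> A $$ (a, b) = (\<Sum>s\<in>S. d b s * s $ a)"
    by metis
  obtain f where f: "bij_betw f {..<r} S"
    using ex_bij_betw_nat_finite[OF S(1)] card by (auto simp: atLeast0LessThan)
  show ?thesis
  proof (rule that)
    fix a b assume "a < n" "b < nc"
    then show "A $$ (a, b) = (\<Sum>k<r. f k $ a * d b (f k))"
      using d sum.reindex_bij_betw[OF f, of "\<lambda>s. d b s * s $ a"] by (simp add: mult.commute)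
  qed
qed

lemma left_inverse_imp_right_inverse:
  fixes G E :: "nat \<Rightarrow> nat \<Rightarrow> real"
  assumes "\<And>i j. i < r \<Longrightarrow> j < r \<Longrightarrow> (\<Sum>k<r. G i k * E k j) = of_bool (i = j)"
    and "k < r" "l < r"
  shows "(\<Sum>i<r. E k i * G i l) = of_bool (k = l)"
proof -
  let ?G = "mat r r (\<lambda>(i, k). G i k)" and ?E = "mat r r (\<lambda>(k, j). E k j)"
  have "?G * ?E = 1\<^sub>m r"
    using assms(1) by (intro eq_matI) (auto simp: scalar_prod_def atLeast0LessThan)
  then have "?E * ?G = 1\<^sub>m r"
    by (rule mat_mult_left_right_inverse[rotated 2]) auto
  then have "(?E * ?G) $$ (k, l) = 1\<^sub>m r $$ (k, l)" by simp
  then show ?thesis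
    using assms(2,3) by (simp add: scalar_prod_def atLeast0LessThan)
qed

text \<open>With \<open>X = C * D\<close> of inner dimension \<open>r\<close>, the matrix \<open>D * V\<close> is invertible, and
  \<open>C - U * U\<^sup>T * C\<close> annihilates it from the left.\<close>
lemma singular_value_decomposition:
  fixes X :: "real mat"
  assumes X: "X \<in> carrier_mat n p" and r: "vec_space.rank n X = r"
    and sv: "singular_vectors X r u v" and pos: "\<And>i. i \<in> {1..r} \<Longrightarrow> singular_value i X > 0"
    and ab: "a < n" "b < p"
  shows "X $$ (a, b) = (\<Sum>i=1..r. singular_value i X * u i $ a * v i $ b)"
proof -
  obtain C D where CD: "\<And>a b. a < n \<Longrightarrow> b < p \<Longrightarrow> X $$ (a, b) = (\<Sum>k<r. C a k * D k b)"
    using rank_factorization[OF X r] by blast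
  define s where "s i = singular_value (Suc i) X" for i
  define U where "U i a = u (Suc i) $ a" for i a
  define V where "V i b = v (Suc i) $ b" for i b
  have s: "s i > 0" if "i < r" for i using pos[of "Suc i"] that by (simp add: s_def)
  have car: "u (Suc i) \<in> carrier_vec n" "v (Suc i) \<in> carrier_vec p" if "i < r" for i
    using sv X that unfolding singular_vectors_def by auto
  have XV: "(\<Sum>b<p. X $$ (a, b) * V i b) = s i * U i a" if "i < r" "a < n" for i a
  proof -
    have "X *\<^sub>v v (Suc i) = singular_value (Suc i) X \<cdot>\<^sub>v u (Suc i)"
      using sv that unfolding singular_vectors_def by auto
    then have "(X *\<^sub>v v (Suc i)) $ a = (singular_value (Suc i) X \<cdot>\<^sub>v u (Suc i)) $ a" by simp
    then show ?thesis
      using X that car[OF that(1)]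
      by (simp add: scalar_prod_def atLeast0LessThan s_def U_def V_def row_def)
  qed
  have XU: "(\<Sum>a<n. X $$ (a, b) * U i a) = s i * V i b" if "i < r" "b < p" for i b
  proof -
    have "transpose_mat X *\<^sub>v u (Suc i) = singular_value (Suc i) X \<cdot>\<^sub>v v (Suc i)"
      using sv that unfolding singular_vectors_def by auto
    then have "(transpose_mat X *\<^sub>v u (Suc i)) $ b = (singular_value (Suc i) X \<cdot>\<^sub>v v (Suc i)) $ b" by simp
    then show ?thesis
      using X that car[OF that(1)]
      by (simp add: scalar_prod_def atLeast0LessThan s_def U_def V_def col_def)
  qed
  have UU: "(\<Sum>a<n. U i a * U j a) = of_bool (i = j)" if "i < r" "j < r" for i j
  proof -
    have "u (Suc i) \<bullet> u (Suc j) = of_bool (Suc i = Suc j)"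
      using sv that unfolding singular_vectors_def by (metis atLeastAtMost_iff Suc_leI Suc_le_mono zero_le One_nat_def)
    then show ?thesis
      using car[OF that(2)] by (simp add: scalar_prod_def atLeast0LessThan U_def)
  qed
  define G where "G i k = (\<Sum>a<n. U i a * C a k)" for i k
  define E where "E k i = (\<Sum>b<p. D k b * V i b)" for k i
  \<comment> \<open>In matrix notation C E = X V; the next facts are G D = U^T X and that G E = U^T
    X V is diagonal.\<close>
  have CE: "(\<Sum>k<r. C a k * E k j) = s j * U j a" if "a < n" "j < r" for a j
  proof -
    have "(\<Sum>k<r. C a k * E k j) = (\<Sum>k<r. \<Sum>b<p. C a k * D k b * V j b)"
      by (simp add: E_def sum_distrib_left mult.assoc)
    also have "\<dots> = (\<Sum>b<p. \<Sum>k<r. C a k * D k b * V j b)" by (rule sum.swap)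
    also have "\<dots> = (\<Sum>b<p. X $$ (a, b) * V j b)"
      using that by (simp add: CD sum_distrib_right)
    finally show ?thesis using XV that by simp
  qed
  have GD: "(\<Sum>k<r. G i k * D k b) = s i * V i b" if "i < r" "b < p" for i b
  proof -
    have "(\<Sum>k<r. G i k * D k b) = (\<Sum>k<r. \<Sum>a<n. U i a * C a k * D k b)"
      by (simp add: G_def sum_distrib_right)
    also have "\<dots> = (\<Sum>a<n. \<Sum>k<r. U i a * C a k * D k b)" by (rule sum.swap)
    also have "\<dots> = (\<Sum>a<n. X $$ (a, b) * U i a)"
      using that by (intro sum.cong refl) (simp add: CD sum_distrib_left mult_ac)
    finally show ?thesis using XU that by simp
  qed
  have GE: "(\<Sum>k<r. G i k * E k j) = s j * of_bool (i = j)" if "i < r" "j < r" for i j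
  proof -
    have "(\<Sum>k<r. G i k * E k j) = (\<Sum>k<r. \<Sum>a<n. U i a * (C a k * E k j))"
      by (simp add: G_def sum_distrib_right mult.assoc)
    also have "\<dots> = (\<Sum>a<n. \<Sum>k<r. U i a * (C a k * E k j))" by (rule sum.swap)
    also have "\<dots> = (\<Sum>a<n. U i a * (s j * U j a))"
      using CE that by (simp add: sum_distrib_left[symmetric])
    also have "\<dots> = s j * (\<Sum>a<n. U i a * U j a)"
      by (simp add: sum_distrib_left mult_ac)
    finally show ?thesis using UU that by simp
  qed
  have "(\<Sum>k<r. (G i k / s i) * E k j) = of_bool (i = j)" if "i < r" "j < r" for i j
    using GE[OF that] s[OF that(1)] by (auto simp: sum_divide_distrib[symmetric])
  \<comment> \<open>\<open>E\<close> is square of size \<open>r\<close>, so its left inverse,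
    \<open>G\<close> with rows divided by the singular values, is also a right inverse.\<close>
  from left_inverse_imp_right_inverse[OF this]
  have EG: "(\<Sum>i<r. E k i * (G i l / s i)) = of_bool (k = l)" if "k < r" "l < r" for k l
    using that by blast
  \<comment> \<open>Row \<open>a\<close> of C - U U^T C. Being annihilated by the invertible
    \<open>E\<close>, it vanishes.\<close>
  define w where "w k = C a k - (\<Sum>i<r. U i a * G i k)" for k
  have wE: "(\<Sum>k<r. w k * E k j) = 0" if j: "j < r" for j
  proof -
    have "(\<Sum>k<r. w k * E k j) = s j * U j a - (\<Sum>k<r. \<Sum>i<r. U i a * (G i k * E k j))"
      using CE[OF ab(1) j] by (simp add: w_def left_diff_distrib sum_subtractf sum_distrib_right mult.assoc)
    also have "(\<Sum>k<r. \<Sum>i<r. U i a * (G i k * E k j)) = (\<Sum>i<r. \<Sum>k<r. U i a * (G i k * E k j))"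
      by (rule sum.swap)
    also have "\<dots> = (\<Sum>i<r. U i a * (s j * of_bool (i = j)))"
      using GE j by (simp add: sum_distrib_left[symmetric])
    also have "\<dots> = (\<Sum>i<r. if i = j then U i a * s j else 0)"
      by (intro sum.cong) auto
    also have "\<dots> = s j * U j a" using j by simp
    finally show ?thesis by simp
  qed
  have w0: "w l = 0" if l: "l < r" for l
  proof -
    have "w l = (\<Sum>k<r. if k = l then w k else 0)" using l by simp
    also have "\<dots> = (\<Sum>k<r. w k * (\<Sum>i<r. E k i * (G i l / s i)))"
      using l EG by (intro sum.cong) auto
    also have "\<dots> = (\<Sum>k<r. \<Sum>i<r. w k * E k i * (G i l / s i))"
      by (simp add: sum_distrib_left mult.assoc)
    also have "\<dots> = (\<Sum>i<r. \<Sum>k<r. w k * E k i * (G i l / s i))" by (rule sum.swap)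
    also have "\<dots> = (\<Sum>i<r. (\<Sum>k<r. w k * E k i) * (G i l / s i))"
      by (simp only: sum_distrib_right)
    also have "\<dots> = 0" using wE by simp
    finally show ?thesis .
  qed
  have "X $$ (a, b) = (\<Sum>k<r. (w k + (\<Sum>i<r. U i a * G i k)) * D k b)"
    using CD[OF ab] by (simp add: w_def)
  also have "\<dots> = (\<Sum>k<r. \<Sum>i<r. U i a * (G i k * D k b))"
    using w0 by (simp add: sum_distrib_right mult.assoc)
  also have "\<dots> = (\<Sum>i<r. \<Sum>k<r. U i a * (G i k * D k b))" by (rule sum.swap)
  also have "\<dots> = (\<Sum>i<r. U i a * (s i * V i b))"
    using GD ab by (simp add: sum_distrib_left[symmetric])
  also have "\<dots> = (\<Sum>i<r. singular_value (Suc i) X * u (Suc i) $ a * v (Suc i) $ b)"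
    by (simp add: s_def U_def V_def mult_ac)
  also have "\<dots> = (\<Sum>i=1..r. singular_value i X * u i $ a * v i $ b)"
    using sum.atLeast1_atMost_eq[of "\<lambda>i. singular_value i X * u i $ a * v i $ b" r] by simp
  finally show ?thesis .
qed

subsection \<open>Fluctuations and residual\<close>

definition trunc_at :: "real \<Rightarrow> real \<Rightarrow> real" where
  "trunc_at b y = (if \<bar>y\<bar> \<le> b then y else 0)"

lemma abs_trunc_at_le: "b \<ge> 0 \<Longrightarrow> \<bar>trunc_at b y\<bar> \<le> b"
  by (simp add: trunc_at_def)

lemma abs_trunc_at_le_abs: "\<bar>trunc_at b y\<bar> \<le> \<bar>y\<bar>"
  by (simp add: trunc_at_def)

lemma borel_measurable_trunc_at [measurable]: "trunc_at b \<in> borel_measurable borel"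
  unfolding trunc_at_def[abs_def] by measurable

text \<open>Where the truncation acts, |y| exceeds b, so |y| <= |y| (|y| / b)^15. After integration
  the bias is at most the 16th moment over b^15.\<close>

lemma trunc_at_error_le:
  assumes "b > 0"
  shows "\<bar>y - trunc_at b y\<bar> \<le> y ^ 16 / b ^ 15"
proof (cases "\<bar>y\<bar> \<le> b")
  case False
  then have "\<bar>y\<bar> * b ^ 15 \<le> \<bar>y\<bar> * \<bar>y\<bar> ^ 15"
    using assms by (intro mult_left_mono power_mono) auto
  also have "\<dots> = y ^ 16" by (simp flip: power_Suc)
  finally show ?thesis
    using False assms by (simp add: trunc_at_def pos_le_divide_eq)
qed (simp add: trunc_at_def)

text \<open>What the probabilistic part uses about signal, noise and nonlinearity. \<open>x\<close>
  is the signal multiplied by sqrt n, hence the factor \<open>real n\<close> in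
  \<open>x_Frobenius\<close>, and \<open>c0\<close> is the slope at 0 of the mean increment.\<close>

locale perturbed_noise = prob_space M for M :: "'w measure" +
  fixes \<mu> :: "real measure" and x :: "nat \<Rightarrow> nat \<times> nat \<Rightarrow> real"
    and Z :: "nat \<Rightarrow> nat \<times> nat \<Rightarrow> 'w \<Rightarrow> real" and p :: "nat \<Rightarrow> nat" and \<gamma> :: real
    and I :: "nat \<Rightarrow> (nat \<times> nat) set" and \<kappa> :: "nat \<Rightarrow> nat \<Rightarrow> nat \<Rightarrow> nat \<times> nat"
    and \<phi> :: "real \<Rightarrow> real \<Rightarrow> real" and \<delta> C c0 F :: real
  assumes \<mu>: "real_distribution \<mu>"
    and pattern: "n \<ge> 1 \<Longrightarrow> entry_pattern n (p n) (I n) (\<kappa> n)"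
    and p_lim: "(\<lambda>n. real (p n) / real n) \<longlonglongrightarrow> \<gamma>"
    and indep: "n \<ge> 1 \<Longrightarrow> indep_vars (\<lambda>_. borel) (Z n) (I n)"
    and distr: "n \<ge> 1 \<Longrightarrow> e \<in> I n \<Longrightarrow> distr M borel (Z n e) = \<mu>"
    and x_small: "\<eta> > 0 \<Longrightarrow> \<forall>\<^sub>F n in sequentially. \<forall>e\<in>I n. \<bar>x n e\<bar> < \<eta>"
    and x_Frobenius: "\<forall>\<^sub>F n in sequentially. (\<Sum>i<n. \<Sum>j<p n. (x n (\<kappa> n i j))\<^sup>2) \<le> F * real n"
    and \<phi>_meas [measurable]: "\<phi> y \<in> borel_measurable borel"
    and \<delta>: "\<delta> > 0"
    and \<phi>_int: "\<bar>y\<bar> < \<delta> \<Longrightarrow> integrable \<mu> (\<lambda>z. \<phi> y z ^ k)"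
    and \<phi>_16: "\<bar>y\<bar> < \<delta> \<Longrightarrow> (\<integral>z. \<phi> y z ^ 16 \<partial>\<mu>) \<le> C"
    and \<phi>_sq: "\<eta> > 0 \<Longrightarrow> \<forall>\<^sub>F y in nhds 0. (\<integral>z. (\<phi> y z)\<^sup>2 \<partial>\<mu>) \<le> \<eta>"
    and \<phi>_mean: "\<eta> > 0 \<Longrightarrow> \<forall>\<^sub>F y in nhds 0. \<bar>(\<integral>z. \<phi> y z \<partial>\<mu>) - c0 * y\<bar> \<le> \<eta> * \<bar>y\<bar>"
begin

sublocale noise: real_distribution \<mu>
  by (rule \<mu>)

lemma prob_UNIV: "measure \<mu> UNIV = 1"
  using noise.prob_space by simp

text \<open>The exponent 1/4 is constrained from both sides: the square of the cutoff times log n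
  has to be o(n), and its 16th power has to exceed the number of entries by a summable
  factor.\<close>

definition cutoff :: "nat \<Rightarrow> real" where
  "cutoff n = sqrt (sqrt (real n))"

text \<open>The mean of the truncated increment instead of the increment itself:
  \<open>fluct\<close> is then exactly centred, and the truncation bias goes into the deterministic
  residual.\<close>

definition centre :: "nat \<Rightarrow> nat \<times> nat \<Rightarrow> real" where
  "centre n e = (\<integral>z. trunc_at (cutoff n) (\<phi> (x n e) z) \<partial>\<mu>)"

definition fluct :: "nat \<Rightarrow> nat \<times> nat \<Rightarrow> 'w \<Rightarrow> real" where
  "fluct n e \<omega> = trunc_at (cutoff n) (\<phi> (x n e) (Z n e \<omega>)) - centre n e"

lemma cutoff_sq: "(cutoff n)\<^sup>2 = sqrt n"
  by (simp add: cutoff_def)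

lemma cutoff_4: "(cutoff n) ^ 4 = n"
proof -
  have "(cutoff n) ^ 4 = ((cutoff n)\<^sup>2)\<^sup>2" by (simp flip: power_mult)
  then show ?thesis by (simp add: cutoff_sq)
qed

lemma cutoff_pos: "n \<ge> 1 \<Longrightarrow> cutoff n > 0"
  by (simp add: cutoff_def)

lemma Z_measurable: "n \<ge> 1 \<Longrightarrow> e \<in> I n \<Longrightarrow> Z n e \<in> borel_measurable M"
  using indep unfolding indep_vars_def2 by auto

lemma integral_Z:
  fixes g :: "real \<Rightarrow> real"
  assumes "n \<ge> 1" "e \<in> I n" "g \<in> borel_measurable borel"
  shows "expectation (\<lambda>\<omega>. g (Z n e \<omega>)) = (\<integral>z. g z \<partial>\<mu>)"
proof -
  have "(\<integral>z. g z \<partial>distr M borel (Z n e)) = expectation (\<lambda>\<omega>. g (Z n e \<omega>))"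
    using Z_measurable[OF assms(1,2)] assms(3) by (rule integral_distr)
  then show ?thesis unfolding distr[OF assms(1,2)] by simp
qed

lemma eventually_positions:
  assumes "\<forall>\<^sub>F y in nhds 0. P y"
  shows "\<forall>\<^sub>F n in sequentially. \<forall>e\<in>I n. P (x n e)"
proof -
  obtain \<eta> where \<eta>: "\<eta> > 0" "\<And>y. \<bar>y\<bar> < \<eta> \<Longrightarrow> P y"
    using assms unfolding eventually_nhds_metric by (auto simp: dist_real_def)
  show ?thesis
    using x_small[OF \<eta>(1)] by eventually_elim (use \<eta>(2) in auto)
qed

lemma x_lt_\<delta>: "\<forall>\<^sub>F n in sequentially. \<forall>e\<in>I n. \<bar>x n e\<bar> < \<delta>"
  by (rule x_small[OF \<delta>])

lemma integrable_trunc: "integrable \<mu> (\<lambda>z. trunc_at (cutoff n) (\<phi> y z))"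
  by (rule noise.integrable_const_bound[where B = "cutoff n"])
    (auto simp: cutoff_def intro!: AE_I2 abs_trunc_at_le)

lemma abs_centre_le: "\<bar>centre n e\<bar> \<le> cutoff n"
proof -
  have "\<bar>centre n e\<bar> \<le> (\<integral>z. \<bar>trunc_at (cutoff n) (\<phi> (x n e) z)\<bar> \<partial>\<mu>)"
    unfolding centre_def by (rule integral_abs_bound)
  also have "\<dots> \<le> (\<integral>z. cutoff n \<partial>\<mu>)"
    by (intro integral_mono integrable_abs integrable_trunc abs_trunc_at_le) (auto simp: cutoff_def)
  finally show ?thesis by (simp add: prob_UNIV)
qed

text \<open>Two errors add up: the truncation bias, at most the 16th moment over the 15th power of
  the cutoff, and the o(x) in the mean increment.\<close>

lemma centre_close:
  assumes "\<eta> > 0"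
  shows "\<forall>\<^sub>F n in sequentially. \<forall>e\<in>I n. \<bar>centre n e - c0 * x n e\<bar> \<le> C / cutoff n ^ 15 + \<eta> * \<bar>x n e\<bar>"
  using eventually_positions[OF \<phi>_mean[OF assms]] x_lt_\<delta> eventually_ge_at_top[of 1]
proof eventually_elim
  case (elim n)
  show ?case
  proof
    fix e assume e: "e \<in> I n"
    then have x: "\<bar>x n e\<bar> < \<delta>" using elim by simp
    have int: "integrable \<mu> (\<phi> (x n e))" using \<phi>_int[OF x, of 1] by simp
    have "\<bar>(\<integral>z. \<phi> (x n e) z \<partial>\<mu>) - centre n e\<bar> = \<bar>\<integral>z. \<phi> (x n e) z - trunc_at (cutoff n) (\<phi> (x n e) z) \<partial>\<mu>\<bar>"
      unfolding centre_def using int integrable_trunc by simp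
    also have "\<dots> \<le> (\<integral>z. \<bar>\<phi> (x n e) z - trunc_at (cutoff n) (\<phi> (x n e) z)\<bar> \<partial>\<mu>)"
      by (rule integral_abs_bound)
    also have "\<dots> \<le> (\<integral>z. \<phi> (x n e) z ^ 16 / cutoff n ^ 15 \<partial>\<mu>)"
      using int integrable_trunc \<phi>_int[OF x] trunc_at_error_le[OF cutoff_pos] elim
      by (intro integral_mono) auto
    also have "\<dots> \<le> C / cutoff n ^ 15"
      using \<phi>_16[OF x] cutoff_pos[of n] elim by (simp add: divide_right_mono)
    finally have "\<bar>(\<integral>z. \<phi> (x n e) z \<partial>\<mu>) - centre n e\<bar> \<le> C / cutoff n ^ 15" .
    moreover have "\<bar>(\<integral>z. \<phi> (x n e) z \<partial>\<mu>) - c0 * x n e\<bar> \<le> \<eta> * \<bar>x n e\<bar>"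
      using elim e by simp
    ultimately show "\<bar>centre n e - c0 * x n e\<bar> \<le> C / cutoff n ^ 15 + \<eta> * \<bar>x n e\<bar>"
      by linarith
  qed
qed

lemma C_nonneg: "C \<ge> 0"
proof -
  have "0 \<le> (\<integral>z. \<phi> 0 z ^ 16 \<partial>\<mu>)" by (rule integral_nonneg_AE) simp
  also have "\<dots> \<le> C" using \<delta> by (intro \<phi>_16) simp
  finally show ?thesis .
qed

lemma p_le: "\<forall>\<^sub>F n in sequentially. real (p n) \<le> (\<gamma> + 1) * real n"
proof -
  have "\<forall>\<^sub>F n in sequentially. real (p n) / real n < \<gamma> + 1"
    by (rule order_tendstoD(2)[OF p_lim]) simp
  with eventually_gt_at_top[of 0] show ?thesis
    by eventually_elim (simp add: divide_less_eq)
qed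

lemma \<gamma>_nonneg: "\<gamma> \<ge> 0"
  using p_lim by (rule LIMSEQ_le_const) auto

section \<open>Truncation is eventually inactive\<close>

text \<open>Markov's inequality for the 16th moment gives C / n^4 for each entry and O(1 / n^2) for
  all of them. The first Borel-Cantelli lemma then applies, whatever the joint law of the matrices
  for different \<open>n\<close>.\<close>

lemma AE_eventually_truncated:
  "AE \<omega> in M. \<forall>\<^sub>F n in sequentially. \<forall>e\<in>I n. \<bar>\<phi> (x n e) (Z n e \<omega>)\<bar> \<le> cutoff n"
proof -
  obtain N where N: "\<And>n. n \<ge> N \<Longrightarrow> (\<forall>e\<in>I n. \<bar>x n e\<bar> < \<delta>) \<and> real (p n) \<le> (\<gamma> + 1) * real n \<and> n \<ge> 1"
    using eventually_conj[OF x_lt_\<delta> eventually_conj[OF p_le eventually_ge_at_top[of 1]]]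
    by (auto simp: eventually_sequentially)
  define A where "A n e = {\<omega> \<in> space M. \<phi> (x n e) (Z n e \<omega>) ^ 16 \<ge> cutoff n ^ 16}" for n e
  define B where "B n = (if n \<ge> N then \<Union>e\<in>I n. A n e else {})" for n
  have A_meas: "A n e \<in> events" if "n \<ge> N" "e \<in> I n" for n e
  proof -
    have "n \<ge> 1" using N that by blast
    from Z_measurable[OF this that(2)] have [measurable]: "Z n e \<in> borel_measurable M" .
    show ?thesis unfolding A_def by measurable
  qed
  have A_prob: "prob (A n e) \<le> C / real n ^ 4" if "n \<ge> N" "e \<in> I n" for n e
  proof -
    have n: "n \<ge> 1" and x: "\<bar>x n e\<bar> < \<delta>" using N that by blast+
    from Z_measurable[OF n that(2)] have [measurable]: "Z n e \<in> borel_measurable M" .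
    have "integrable (distr M borel (Z n e)) (\<lambda>z. \<phi> (x n e) z ^ 16)"
      unfolding distr[OF n that(2)] by (rule \<phi>_int[OF x])
    then have int: "integrable M (\<lambda>\<omega>. \<phi> (x n e) (Z n e \<omega>) ^ 16)"
      by (subst (asm) integrable_distr_eq) auto
    have "prob (A n e) \<le> expectation (\<lambda>\<omega>. \<phi> (x n e) (Z n e \<omega>) ^ 16) / cutoff n ^ 16"
      unfolding A_def using int cutoff_pos[OF n]
      by (intro integral_Markov_inequality_measure[where A = "{}"]) auto
    also have "expectation (\<lambda>\<omega>. \<phi> (x n e) (Z n e \<omega>) ^ 16) = (\<integral>z. \<phi> (x n e) z ^ 16 \<partial>\<mu>)"
      using n that by (intro integral_Z) auto
    also have "\<dots> / cutoff n ^ 16 \<le> C / cutoff n ^ 16"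
      using \<phi>_16[OF x] cutoff_pos[OF n] by (intro divide_right_mono) auto
    also have "cutoff n ^ 16 = real n ^ 4"
      using power_mult[of "cutoff n" 4 4] by (simp add: cutoff_4)
    finally show ?thesis .
  qed
  have fin: "finite (I n)" if "n \<ge> N" for n
    using entry_patternD(1)[OF pattern] N that by blast
  have B_meas: "B n \<in> events" for n
    unfolding B_def using A_meas fin by auto
  have B_prob: "prob (B n) \<le> (\<gamma> + 1) * C * (1 / real n ^ 2)" for n
  proof (cases "n \<ge> N")
    case True
    have n: "n \<ge> 1" and pn: "real (p n) \<le> (\<gamma> + 1) * real n" using N True by blast+
    have "prob (B n) \<le> (\<Sum>e\<in>I n. prob (A n e))"
      unfolding B_def using True fin A_meas by (auto intro!: finite_measure_subadditive_finite)
    also have "\<dots> \<le> (\<Sum>e\<in>I n. C / real n ^ 4)"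
      by (intro sum_mono A_prob True)
    also have "\<dots> = card (I n) * (C / real n ^ 4)" by simp
    also have "\<dots> \<le> ((\<gamma> + 1) * real n * real n) * (C / real n ^ 4)"
    proof (intro mult_right_mono)
      have "card (I n) \<le> card ({..<n} \<times> {..<p n})"
        by (intro card_mono entry_patternD(2)[OF pattern[OF n]]) auto
      then have "real (card (I n)) \<le> real (p n) * real n"
        by (simp add: mult.commute flip: of_nat_mult)
      also have "\<dots> \<le> (\<gamma> + 1) * real n * real n"
        using pn by (intro mult_right_mono) auto
      finally show "real (card (I n)) \<le> (\<gamma> + 1) * real n * real n" .
    qed (use C_nonneg in auto)
    also have "\<dots> = (\<gamma> + 1) * C * (1 / real n ^ 2)"
      using n by (simp add: field_simps eval_nat_numeral)
    finally show ?thesis .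
  next
    case False
    then show ?thesis using C_nonneg \<gamma>_nonneg by (simp add: B_def)
  qed
  have "summable (\<lambda>n. (\<gamma> + 1) * C * (1 / real n ^ 2))"
    using inverse_power_summable[of 2, where 'a = real] by (intro summable_mult) (simp add: inverse_eq_divide)
  then have "summable (\<lambda>n. prob (B n))"
    by (rule summable_comparison_test'[where N = 0]) (use B_prob in auto)
  then have "AE \<omega> in M. \<forall>\<^sub>F n in sequentially. \<omega> \<in> space M - B n"
    using B_meas by (intro borel_cantelli_AE1) (auto simp: less_top[symmetric])
  then show ?thesis
  proof eventually_elim
    case (elim \<omega>)
    from elim eventually_ge_at_top[of N] show ?case
    proof eventually_elim
      case (elim n)
      show ?case
      proof
        fix e assume e: "e \<in> I n"
        with elim have "\<phi> (x n e) (Z n e \<omega>) ^ 16 < cutoff n ^ 16"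
          by (auto simp: B_def A_def)
        then have "\<bar>\<phi> (x n e) (Z n e \<omega>)\<bar> ^ 16 < cutoff n ^ 16" by simp
        then show "\<bar>\<phi> (x n e) (Z n e \<omega>)\<bar> \<le> cutoff n"
          using power_less_imp_less_base[of "\<bar>\<phi> (x n e) (Z n e \<omega>)\<bar>" 16 "cutoff n"]
          by (simp add: cutoff_def)
      qed
    qed
  qed
qed

section \<open>Operator norm of the centred increments\<close>

text \<open>One cutoff for the truncated value and one for its mean give the factor 2; both centring
  and truncating only lower the second moment.\<close>

lemma
  assumes n: "n \<ge> 1" and x: "\<forall>e\<in>I n. \<bar>x n e\<bar> < \<delta>" and e: "e \<in> I n"
  shows fluct_abs_le: "\<bar>fluct n e \<omega>\<bar> \<le> 2 * cutoff n"
    and fluct_mean: "expectation (fluct n e) = 0"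
    and fluct_var: "expectation (\<lambda>\<omega>. (fluct n e \<omega>)\<^sup>2) \<le> (\<integral>z. (\<phi> (x n e) z)\<^sup>2 \<partial>\<mu>)"
proof -
  have c: "cutoff n \<ge> 0" by (simp add: cutoff_def)
  show "\<bar>fluct n e \<omega>\<bar> \<le> 2 * cutoff n"
    unfolding fluct_def using abs_centre_le[of n e] abs_trunc_at_le[OF c, of "\<phi> (x n e) (Z n e \<omega>)"] by linarith
  let ?T = "\<lambda>z. trunc_at (cutoff n) (\<phi> (x n e) z)"
  have sq_int: "integrable \<mu> (\<lambda>z. (?T z)\<^sup>2)"
  proof (rule noise.integrable_const_bound[where B = "(cutoff n)\<^sup>2"])
    show "AE z in \<mu>. norm ((?T z)\<^sup>2) \<le> (cutoff n)\<^sup>2"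
      using abs_trunc_at_le[OF c] c by (intro AE_I2) (simp add: abs_le_square_iff[symmetric])
  qed simp
  have "expectation (fluct n e) = (\<integral>z. ?T z - centre n e \<partial>\<mu>)"
    unfolding fluct_def[abs_def] by (rule integral_Z[OF n e]) measurable
  also have "\<dots> = 0"
    using integrable_trunc by (simp add: centre_def prob_UNIV)
  finally show "expectation (fluct n e) = 0" .
  have "expectation (\<lambda>\<omega>. (fluct n e \<omega>)\<^sup>2) = (\<integral>z. (?T z - centre n e)\<^sup>2 \<partial>\<mu>)"
    unfolding fluct_def[abs_def] by (rule integral_Z[OF n e]) measurable
  also have "\<dots> = (\<integral>z. (?T z)\<^sup>2 \<partial>\<mu>) - (centre n e)\<^sup>2"
    using noise.variance_eq[OF integrable_trunc sq_int] by (simp add: centre_def)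
  also have "\<dots> \<le> (\<integral>z. (?T z)\<^sup>2 \<partial>\<mu>)" by simp
  also have "\<dots> \<le> (\<integral>z. (\<phi> (x n e) z)\<^sup>2 \<partial>\<mu>)"
    using x e \<phi>_int[of "x n e" 2] abs_trunc_at_le_abs
    by (intro integral_mono sq_int) (auto simp: abs_le_square_iff)
  finally show "expectation (\<lambda>\<omega>. (fluct n e \<omega>)\<^sup>2) \<le> (\<integral>z. (\<phi> (x n e) z)\<^sup>2 \<partial>\<mu>)" .
qed

lemma fluct_indep:
  assumes n: "n \<ge> 1"
  shows "indep_vars (\<lambda>_. borel) (fluct n) (I n)"
  unfolding fluct_def[abs_def]
  by (rule indep_vars_compose2[OF indep[OF n], where Y = "\<lambda>e z. trunc_at (cutoff n) (\<phi> (x n e) z) - centre n e"]) measurable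

text \<open>The base of the power in the tail bound is proportional to the variance bound \<eta>.
  Once it is at most 1/32 = 2^-5, an order of at least log_2 n yields n^-5, which beats a prefactor
  of order at most n^2 and leaves a summable bound.\<close>

lemma fluct_tail:
  assumes \<epsilon>: "\<epsilon> > 0"
  obtains K :: real where "\<forall>\<^sub>F n in sequentially. \<exists>A\<in>events. prob A \<le> K * (1 / real n ^ 2) \<and>
    (\<forall>\<omega>\<in>space M - A. mat_bound {..<n} {..<p n} (\<lambda>i j. fluct n (\<kappa> n i j) \<omega>) (\<epsilon> * sqrt n))"
proof -
  define K0 where "K0 = ref_const * exp 3"
  have K0: "K0 > 0" by (simp add: K0_def ref_const_def)
  \<comment> \<open>Chosen to make the base of the power equal at most 1/32; \<gamma> + 2 eventually
    bounds (n + p) / n.\<close>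
  define \<eta> where "\<eta> = \<epsilon>\<^sup>2 / (32 * K0 * (\<gamma> + 2))"
  have \<eta>: "\<eta> > 0" using \<epsilon> K0 \<gamma>_nonneg by (simp add: \<eta>_def)
  have ev1: "\<forall>\<^sub>F n in sequentially. \<eta> \<le> 4 * sqrt (real n)"
    by real_asymp
  \<comment> \<open>Provides the hypothesis \<open>2 ^ m * b\<^sup>2 \<le> c\<close> of the tail
    bound; it holds because sqrt n log n is o(n).\<close>
  have ev2: "\<forall>\<^sub>F n in sequentially. 2 * log 2 (real n) * (4 * sqrt (real n)) \<le> real n * \<eta>"
    using \<eta> by real_asymp
  show ?thesis
  proof (rule that)
    show "\<forall>\<^sub>F n in sequentially. \<exists>A\<in>events. prob A \<le> 12 * (\<gamma> + 2) / \<eta> * (1 / real n ^ 2) \<and>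
      (\<forall>\<omega>\<in>space M - A. mat_bound {..<n} {..<p n} (\<lambda>i j. fluct n (\<kappa> n i j) \<omega>) (\<epsilon> * sqrt n))"
      using eventually_positions[OF \<phi>_sq[OF \<eta>]] x_lt_\<delta> p_le eventually_ge_at_top[of 2] ev1 ev2
    proof eventually_elim
      case (elim n)
      then have n: "n \<ge> 1" by simp
      have "log 2 (real n) \<ge> 1" using elim by (simp add: le_log_iff)
      then obtain m :: nat where m: "log 2 (real n) \<le> 2 ^ m" "2 ^ m \<le> 2 * log 2 (real n)"
        by (rule dyadic_between)
      define c where "c = real (n + p n) * \<eta>"
      have sq: "(2 * cutoff n)\<^sup>2 = 4 * sqrt (real n)"
        by (simp add: power_mult_distrib cutoff_sq)
      have b: "2 * cutoff n > 0" using cutoff_pos[OF n] by simp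
      have d: "\<eta> \<le> (2 * cutoff n)\<^sup>2" unfolding sq using elim by simp
      have "2 ^ m * (2 * cutoff n)\<^sup>2 \<le> 2 * log 2 (real n) * (4 * sqrt (real n))"
        unfolding sq using m by (intro mult_right_mono) auto
      also have "\<dots> \<le> real n * \<eta>" using elim by simp
      also have "\<dots> \<le> c" unfolding c_def using \<eta> by (intro mult_right_mono) auto
      finally have c2: "2 ^ m * (2 * cutoff n)\<^sup>2 \<le> c" .
      have t: "\<epsilon> * sqrt (real n) > 0" using \<epsilon> n by simp
      have c1: "real (n + p n) * \<eta> \<le> c" by (simp add: c_def)
      have var: "expectation (\<lambda>\<omega>. (fluct n e \<omega>)\<^sup>2) \<le> \<eta>" if "e \<in> I n" for e
        using fluct_var[OF n elim(2) that] elim(1) that by fastforce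
      obtain A where A: "A \<in> events"
        "prob A \<le> 3 * real (n + p n) * (2 * cutoff n)\<^sup>2 / \<eta> * (ref_const * exp 3 * c / (\<epsilon> * sqrt (real n))\<^sup>2) ^ (2 ^ m)"
        "\<And>\<omega>. \<omega> \<in> space M - A \<Longrightarrow> mat_bound {..<n} {..<p n} (\<lambda>i j. fluct n (\<kappa> n i j) \<omega>) (\<epsilon> * sqrt (real n))"
        using mat_bound_tail_entries[OF pattern[OF n] fluct_indep[OF n] b fluct_abs_le[OF n elim(2)]
            fluct_mean[OF n elim(2)] var \<eta> d c1 c2 t] by blast
      have np: "real (n + p n) \<le> (\<gamma> + 2) * real n" using elim(3) by (simp add: algebra_simps)
      have "ref_const * exp 3 * c / (\<epsilon> * sqrt (real n))\<^sup>2 = K0 * \<eta> * real (n + p n) / (\<epsilon>\<^sup>2 * real n)"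
        by (simp add: K0_def c_def power_mult_distrib)
      also have "\<dots> \<le> K0 * \<eta> * ((\<gamma> + 2) * real n) / (\<epsilon>\<^sup>2 * real n)"
        using np K0 \<eta> by (intro divide_right_mono mult_left_mono) auto
      also have "\<dots> = 1 / 32"
        using K0 \<epsilon> \<gamma>_nonneg n by (simp add: \<eta>_def)
      finally have q: "ref_const * exp 3 * c / (\<epsilon> * sqrt (real n))\<^sup>2 \<le> 1 / 32" .
      have q0: "0 \<le> ref_const * exp 3 * c / (\<epsilon> * sqrt (real n))\<^sup>2"
        using K0 \<eta> by (simp add: K0_def[symmetric] c_def)
      have "(ref_const * exp 3 * c / (\<epsilon> * sqrt (real n))\<^sup>2) ^ (2 ^ m) \<le> (1 / 32) ^ (2 ^ m)"
        using q q0 by (rule power_mono)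
      also have "\<dots> \<le> 1 / real n ^ 5"
      proof -
        have "real n = 2 powr (log 2 (real n))" using n by simp
        also have "\<dots> \<le> 2 powr (2 ^ m)" using m by (intro powr_mono) auto
        also have "\<dots> = 2 ^ (2 ^ m)" using powr_realpow[of 2 "2 ^ m"] by simp
        finally have "real n ^ 5 \<le> (2 ^ (2 ^ m)) ^ 5" by (intro power_mono) auto
        also have "\<dots> = 32 ^ (2 ^ m)" by (simp add: power_mult[symmetric] mult.commute[of _ 5] power_mult[of 2 5])
        finally show ?thesis using n by (simp add: power_one_over divide_simps)
      qed
      finally have q5: "(ref_const * exp 3 * c / (\<epsilon> * sqrt (real n))\<^sup>2) ^ (2 ^ m) \<le> 1 / real n ^ 5" .
      have "prob A \<le> 3 * real (n + p n) * (4 * sqrt (real n)) / \<eta> * (1 / real n ^ 5)"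
        by (rule order_trans[OF A(2)[unfolded sq] mult_left_mono[OF q5]]) (use \<eta> in auto)
      also have "\<dots> \<le> 3 * ((\<gamma> + 2) * real n) * (4 * real n) / \<eta> * (1 / real n ^ 5)"
      proof (intro mult_right_mono divide_right_mono mult_mono mult_left_mono)
        show "sqrt (real n) \<le> real n"
          using n by (intro real_le_lsqrt) (auto simp: power2_eq_square)
      qed (use np \<eta> \<gamma>_nonneg in auto)
      also have "\<dots> = 12 * (\<gamma> + 2) / \<eta> * (1 / real n ^ 3)"
        using n \<eta> by (simp add: field_simps eval_nat_numeral)
      also have "\<dots> \<le> 12 * (\<gamma> + 2) / \<eta> * (1 / real n ^ 2)"
        using n \<eta> \<gamma>_nonneg by (intro mult_left_mono divide_left_mono power_increasing) auto
      finally show ?case using A by (intro bexI[of _ A]) auto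
    qed
  qed
qed

lemma AE_fluct_bound:
  assumes \<epsilon>: "\<epsilon> > 0"
  shows "AE \<omega> in M. \<forall>\<^sub>F n in sequentially.
    mat_bound {..<n} {..<p n} (\<lambda>i j. fluct n (\<kappa> n i j) \<omega>) (\<epsilon> * sqrt n)"
proof -
  let ?good = "\<lambda>n \<omega>. mat_bound {..<n} {..<p n} (\<lambda>i j. fluct n (\<kappa> n i j) \<omega>) (\<epsilon> * sqrt n)"
  obtain K where K: "\<forall>\<^sub>F n in sequentially. \<exists>A\<in>events. prob A \<le> K * (1 / real n ^ 2) \<and> (\<forall>\<omega>\<in>space M - A. ?good n \<omega>)"
    using fluct_tail[OF \<epsilon>] by blast
  then obtain N where N: "\<And>n. n \<ge> N \<Longrightarrow> \<exists>A\<in>events. prob A \<le> K * (1 / real n ^ 2) \<and> (\<forall>\<omega>\<in>space M - A. ?good n \<omega>)"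
    by (auto simp: eventually_sequentially)
  have "\<exists>A. A \<in> events \<and> (n \<ge> N \<longrightarrow> prob A \<le> K * (1 / real n ^ 2) \<and> (\<forall>\<omega>\<in>space M - A. ?good n \<omega>))" for n
    using N[of n] by (cases "n \<ge> N") auto
  then obtain A where A: "\<And>n. A n \<in> events" "\<And>n. n \<ge> N \<Longrightarrow> prob (A n) \<le> K * (1 / real n ^ 2)"
    "\<And>n \<omega>. n \<ge> N \<Longrightarrow> \<omega> \<in> space M - A n \<Longrightarrow> ?good n \<omega>" by metis
  have "summable (\<lambda>n. K * (1 / real n ^ 2))"
    using inverse_power_summable[of 2, where 'a = real] by (intro summable_mult) (simp add: inverse_eq_divide)
  then have "summable (\<lambda>n. prob (A n))"
    by (rule summable_comparison_test'[where N = N]) (use A(2) in auto)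
  then have "AE \<omega> in M. \<forall>\<^sub>F n in sequentially. \<omega> \<in> space M - A n"
    using A(1) by (intro borel_cantelli_AE1) (auto simp: less_top[symmetric])
  then show ?thesis
  proof eventually_elim
    case (elim \<omega>)
    from elim eventually_ge_at_top[of N] show ?case
      by eventually_elim (rule A(3))
  qed
qed

section \<open>Deterministic residual and total perturbation\<close>

text \<open>The scaled signal has Frobenius norm O(sqrt n), so an entrywise error of \<eta> times
  the signal is affordable; the truncation bias is negligible even when summed over all O(n^2)
  entries.\<close>

lemma residual_Frobenius:
  assumes \<epsilon>: "\<epsilon> > 0"
  shows "\<forall>\<^sub>F n in sequentially. (\<Sum>i<n. \<Sum>j<p n. (centre n (\<kappa> n i j) - c0 * x n (\<kappa> n i j))\<^sup>2) \<le> \<epsilon>\<^sup>2 * real n"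
proof -
  \<comment> \<open>Made positive because the definition of \<eta> divides by its square root; the
    sign of \<open>F\<close> is unknown.\<close>
  define F' where "F' = max F 0 + 1"
  have F': "F' > 0" "F \<le> F'" by (auto simp: F'_def)
  \<comment> \<open>Makes \<open>2 * \<eta>\<^sup>2 * F'\<close> equal to
    \<open>\<epsilon>\<^sup>2 / 2\<close>; the other half is left for the truncation bias.\<close>
  define \<eta> where "\<eta> = \<epsilon> / (2 * sqrt F')"
  have \<eta>: "\<eta> > 0" using \<epsilon> F' by (simp add: \<eta>_def)
  have \<eta>2: "\<eta>\<^sup>2 * F' = \<epsilon>\<^sup>2 / 4" using F' by (simp add: \<eta>_def power_divide power_mult_distrib)
  have lim: "\<forall>\<^sub>F n in sequentially. 2 * (\<gamma> + 1) * C\<^sup>2 * (1 / real n) \<le> \<epsilon>\<^sup>2 / 2"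
  proof -
    have "(\<lambda>n. 2 * (\<gamma> + 1) * C\<^sup>2 * (1 / real n)) \<longlonglongrightarrow> 2 * (\<gamma> + 1) * C\<^sup>2 * 0"
      by (intro tendsto_intros lim_1_over_n)
    then have "\<forall>\<^sub>F n in sequentially. 2 * (\<gamma> + 1) * C\<^sup>2 * (1 / real n) < \<epsilon>\<^sup>2 / 2"
      using \<epsilon> by (intro order_tendstoD) auto
    then show ?thesis by eventually_elim simp
  qed
  show ?thesis
    using centre_close[OF \<eta>] x_Frobenius p_le eventually_ge_at_top[of 1] lim
  proof eventually_elim
    case (elim n)
    then have n: "n \<ge> 1" by simp
    note pat = entry_patternD[OF pattern[OF n]]
    let ?c = "C / cutoff n ^ 15"
    have c0: "?c \<ge> 0" using C_nonneg cutoff_pos[OF n] by simp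
    have c_le: "?c\<^sup>2 \<le> C\<^sup>2 / real n ^ 2"
    proof -
      have n1: "1 \<le> cutoff n" using n by (simp add: cutoff_def)
      have "real n ^ 2 = cutoff n ^ 8" using power_mult[of "cutoff n" 4 2] by (simp add: cutoff_4)
      also have "\<dots> \<le> cutoff n ^ 30" using n1 by (intro power_increasing) auto
      finally have "C\<^sup>2 / cutoff n ^ 30 \<le> C\<^sup>2 / real n ^ 2"
        using n by (intro divide_left_mono mult_pos_pos zero_less_power cutoff_pos) auto
      then show ?thesis by (simp add: power_divide flip: power_mult)
    qed
    have "(\<Sum>i<n. \<Sum>j<p n. (centre n (\<kappa> n i j) - c0 * x n (\<kappa> n i j))\<^sup>2)
      \<le> (\<Sum>i<n. \<Sum>j<p n. 2 * ?c\<^sup>2 + 2 * \<eta>\<^sup>2 * (x n (\<kappa> n i j))\<^sup>2)"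
    proof (intro sum_mono)
      fix i j assume "i \<in> {..<n}" "j \<in> {..<p n}"
      then have e: "\<kappa> n i j \<in> I n" by (intro pat(3)) auto
      let ?x = "x n (\<kappa> n i j)"
      have "\<bar>centre n (\<kappa> n i j) - c0 * ?x\<bar> \<le> ?c + \<eta> * \<bar>?x\<bar>"
        using elim(1) e by blast
      then have "\<bar>centre n (\<kappa> n i j) - c0 * ?x\<bar>\<^sup>2 \<le> (?c + \<eta> * \<bar>?x\<bar>)\<^sup>2"
        by (intro power_mono) auto
      also have "\<dots> \<le> 2 * ?c\<^sup>2 + 2 * (\<eta> * \<bar>?x\<bar>)\<^sup>2"
        using sum_squares_bound[of ?c "\<eta> * \<bar>?x\<bar>"] by (simp add: power2_sum)
      finally show "(centre n (\<kappa> n i j) - c0 * ?x)\<^sup>2 \<le> 2 * ?c\<^sup>2 + 2 * \<eta>\<^sup>2 * ?x\<^sup>2"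
        by (simp add: power_mult_distrib)
    qed
    also have "\<dots> = real n * (real (p n) * (2 * ?c\<^sup>2)) + 2 * \<eta>\<^sup>2 * (\<Sum>i<n. \<Sum>j<p n. (x n (\<kappa> n i j))\<^sup>2)"
      by (simp add: sum.distrib sum_distrib_left)
    also have "\<dots> \<le> real n * (\<epsilon>\<^sup>2 / 2) + 2 * \<eta>\<^sup>2 * (F' * real n)"
    proof (intro add_mono mult_left_mono)
      have "real (p n) * (2 * ?c\<^sup>2) \<le> ((\<gamma> + 1) * real n) * (2 * (C\<^sup>2 / real n ^ 2))"
        using elim(3) c_le \<gamma>_nonneg by (intro mult_mono) auto
      also have "\<dots> = 2 * (\<gamma> + 1) * C\<^sup>2 * (1 / real n)"
        using n by (simp add: power2_eq_square)
      also have "\<dots> \<le> \<epsilon>\<^sup>2 / 2" by (rule elim(5))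
      finally show "real (p n) * (2 * ?c\<^sup>2) \<le> \<epsilon>\<^sup>2 / 2" .
      have "F * real n \<le> F' * real n" using F' by (intro mult_right_mono) auto
      with elim(2) show "(\<Sum>i<n. \<Sum>j<p n. (x n (\<kappa> n i j))\<^sup>2) \<le> F' * real n" by linarith
    qed auto
    also have "2 * \<eta>\<^sup>2 * (F' * real n) = 2 * (\<eta>\<^sup>2 * F') * real n" by simp
    also have "real n * (\<epsilon>\<^sup>2 / 2) + \<dots> = \<epsilon>\<^sup>2 * real n"
      unfolding \<eta>2 by simp
    finally show ?case .
  qed
qed

text \<open>Once no entry is truncated, the matrix is exactly \<open>fluct\<close> plus the
  deterministic residual, and each part costs \<open>\<epsilon> * sqrt n\<close>.\<close>

lemma AE_perturbation_bound:
  assumes \<epsilon>: "\<epsilon> > 0"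
  shows "AE \<omega> in M. \<forall>\<^sub>F n in sequentially. mat_bound {..<n} {..<p n}
    (\<lambda>i j. \<phi> (x n (\<kappa> n i j)) (Z n (\<kappa> n i j) \<omega>) - c0 * x n (\<kappa> n i j)) (2 * \<epsilon> * sqrt n)"
  using AE_fluct_bound[OF \<epsilon>] AE_eventually_truncated
proof eventually_elim
  case (elim \<omega>)
  from elim residual_Frobenius[OF \<epsilon>] eventually_ge_at_top[of 1] show ?case
  proof eventually_elim
    case (elim n)
    then have n: "n \<ge> 1" by simp
    note pat = entry_patternD[OF pattern[OF n]]
    let ?R = "\<lambda>i j. centre n (\<kappa> n i j) - c0 * x n (\<kappa> n i j)"
    let ?H = "\<lambda>i j. fluct n (\<kappa> n i j) \<omega>"
    show ?case
    proof (rule mat_boundI)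
      fix y
      have "L2_set (\<lambda>i. \<Sum>j<p n. (\<phi> (x n (\<kappa> n i j)) (Z n (\<kappa> n i j) \<omega>) - c0 * x n (\<kappa> n i j)) * y j) {..<n} =
        L2_set (\<lambda>i. (\<Sum>j<p n. ?H i j * y j) + (\<Sum>j<p n. ?R i j * y j)) {..<n}"
      proof (intro L2_set_cong refl)
        fix i assume i: "i \<in> {..<n}"
        have eq: "\<phi> (x n (\<kappa> n i j)) (Z n (\<kappa> n i j) \<omega>) - c0 * x n (\<kappa> n i j) = ?H i j + ?R i j" if "j \<in> {..<p n}" for j
          using elim(2) pat(3)[of i j] i that by (simp add: fluct_def trunc_at_def)
        have "(\<Sum>j<p n. (\<phi> (x n (\<kappa> n i j)) (Z n (\<kappa> n i j) \<omega>) - c0 * x n (\<kappa> n i j)) * y j) =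
          (\<Sum>j<p n. (?H i j + ?R i j) * y j)"
          by (intro sum.cong refl) (simp only: eq)
        then show "(\<Sum>j<p n. (\<phi> (x n (\<kappa> n i j)) (Z n (\<kappa> n i j) \<omega>) - c0 * x n (\<kappa> n i j)) * y j) =
          (\<Sum>j<p n. ?H i j * y j) + (\<Sum>j<p n. ?R i j * y j)"
          by (simp only: sum.distrib distrib_right)
      qed
      also have "\<dots> \<le> L2_set (\<lambda>i. \<Sum>j<p n. ?H i j * y j) {..<n} + L2_set (\<lambda>i. \<Sum>j<p n. ?R i j * y j) {..<n}"
        by (rule L2_set_triangle_ineq)
      also have "L2_set (\<lambda>i. \<Sum>j<p n. ?H i j * y j) {..<n} \<le> \<epsilon> * sqrt n * L2_set y {..<p n}"
        by (rule mat_boundD[OF elim(1)])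
      also have "L2_set (\<lambda>i. \<Sum>j<p n. ?R i j * y j) {..<n} \<le> sqrt (\<Sum>i<n. \<Sum>j<p n. (?R i j)\<^sup>2) * L2_set y {..<p n}"
        by (rule mat_boundD[OF mat_bound_Frobenius])
      also have "\<dots> \<le> \<epsilon> * sqrt n * L2_set y {..<p n}"
      proof (intro mult_right_mono)
        have "sqrt (\<Sum>i<n. \<Sum>j<p n. (?R i j)\<^sup>2) \<le> sqrt (\<epsilon>\<^sup>2 * real n)"
          using elim(3) by (rule real_sqrt_le_mono)
        then show "sqrt (\<Sum>i<n. \<Sum>j<p n. (?R i j)\<^sup>2) \<le> \<epsilon> * sqrt n"
          using \<epsilon> by (simp add: real_sqrt_mult)
      qed simp
      finally show "L2_set (\<lambda>i. \<Sum>j<p n. (\<phi> (x n (\<kappa> n i j)) (Z n (\<kappa> n i j) \<omega>) - c0 * x n (\<kappa> n i j)) * y j) {..<n}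
        \<le> 2 * \<epsilon> * sqrt n * L2_set y {..<p n}"
        by (simp add: algebra_simps)
    qed
  qed
qed

end

subsection \<open>Convergence\<close>

lemma l2_norm_eq_L2_set: "l2_norm w = L2_set (vec_index w) {..<dim_vec w}"
  by (simp add: l2_norm_def L2_set_def scalar_prod_def power2_eq_square atLeast0LessThan)

text \<open>A real supremum is informative only for a nonempty set that is bounded above. The zero
  vector supplies nonemptiness and the lower bound 0, and \<open>mat_bound\<close> supplies the
  upper bound.\<close>

lemma op_norm_le_of_mat_bound:
  assumes A: "A \<in> carrier_mat n p" and b: "mat_bound {..<n} {..<p} (\<lambda>i j. A $$ (i, j)) c" and c: "c \<ge> 0"
  shows "0 \<le> op_norm A" "op_norm A \<le> c"
proof -
  let ?S = "{l2_norm (A *\<^sub>v v) | v. v \<in> carrier_vec (dim_col A) \<and> l2_norm v \<le> 1}"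
  have le: "l2_norm (A *\<^sub>v v) \<le> c" if v: "v \<in> carrier_vec (dim_col A)" "l2_norm v \<le> 1" for v
  proof -
    have "l2_norm (A *\<^sub>v v) = L2_set (\<lambda>i. \<Sum>j<p. A $$ (i, j) * v $ j) {..<n}"
      unfolding l2_norm_eq_L2_set using A v
      by (intro L2_set_cong) (auto simp: scalar_prod_def atLeast0LessThan row_def)
    also have "\<dots> \<le> c * L2_set (vec_index v) {..<p}"
      by (rule mat_boundD[OF b])
    also have "\<dots> \<le> c * 1"
      using v A c by (intro mult_left_mono) (auto simp: l2_norm_eq_L2_set)
    finally show ?thesis by simp
  qed
  have zero: "0 \<in> ?S"
  proof -
    have "A *\<^sub>v 0\<^sub>v (dim_col A) = 0\<^sub>v (dim_row A)" by (intro eq_vecI) auto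
    then have "l2_norm (A *\<^sub>v 0\<^sub>v (dim_col A)) = 0" by (simp add: l2_norm_def)
    moreover have "l2_norm (0\<^sub>v (dim_col A)) \<le> 1" by (simp add: l2_norm_def)
    ultimately show ?thesis by (smt (verit) mem_Collect_eq zero_carrier_vec)
  qed
  have bdd: "bdd_above ?S" using le by (auto intro!: bdd_aboveI[of _ c])
  show "0 \<le> op_norm A" unfolding op_norm_def by (rule cSup_upper[OF zero bdd])
  show "op_norm A \<le> c" unfolding op_norm_def using zero le by (intro cSup_least) auto
qed

lemma linf_norm_ge:
  assumes "i < dim_vec v"
  shows "\<bar>v $ i\<bar> \<le> linf_norm v"
proof -
  have "{\<bar>v $ i\<bar> |i. i < dim_vec v} = (\<lambda>i. \<bar>v $ i\<bar>) ` {..<dim_vec v}" by auto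
  then show ?thesis unfolding linf_norm_def using assms by (intro Max_ge) auto
qed

lemma linf_norm_nonneg: "0 \<le> linf_norm v"
proof -
  have "{\<bar>v $ i\<bar> |i. i < dim_vec v} = (\<lambda>i. \<bar>v $ i\<bar>) ` {..<dim_vec v}" by auto
  then show ?thesis unfolding linf_norm_def by (intro Max_ge) auto
qed

text \<open>The two facts about the signal that enter the probabilistic part, both read off from the
  singular value decomposition. In the second, one factor \<open>r\<close> is Cauchy-Schwarz over
  the \<open>r\<close> terms and the other counts them, the singular vectors being of unit
  length.\<close>

lemma low_rank_bounds:
  fixes X :: "real mat"
  assumes X: "X \<in> carrier_mat n p" and rank: "vec_space.rank n X = r"
    and sv: "singular_vectors X r u v"
    and s: "\<And>i. i \<in> {1..r} \<Longrightarrow> 0 < singular_value i X \<and> singular_value i X \<le> S"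
  shows "a < n \<Longrightarrow> b < p \<Longrightarrow> \<bar>X $$ (a, b)\<bar> \<le> S * (\<Sum>i=1..r. linf_norm (u i) * linf_norm (v i))"
    and "(\<Sum>a<n. \<Sum>b<p. (X $$ (a, b))\<^sup>2) \<le> real r * (real r * S\<^sup>2)"
proof -
  let ?s = "\<lambda>i. singular_value i X"
  have svd: "X $$ (a, b) = (\<Sum>i=1..r. ?s i * u i $ a * v i $ b)" if "a < n" "b < p" for a b
    using s by (intro singular_value_decomposition[OF X rank sv _ that]) blast
  have car: "u i \<in> carrier_vec n" "v i \<in> carrier_vec p" if "i \<in> {1..r}" for i
    using sv X that unfolding singular_vectors_def by auto
  show "\<bar>X $$ (a, b)\<bar> \<le> S * (\<Sum>i=1..r. linf_norm (u i) * linf_norm (v i))" if "a < n" "b < p"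
  proof -
    have "\<bar>X $$ (a, b)\<bar> \<le> (\<Sum>i=1..r. \<bar>?s i * u i $ a * v i $ b\<bar>)"
      unfolding svd[OF that] by (rule sum_abs)
    also have "\<dots> \<le> (\<Sum>i=1..r. S * (linf_norm (u i) * linf_norm (v i)))"
    proof (rule sum_mono)
      fix i assume i: "i \<in> {1..r}"
      have "\<bar>u i $ a\<bar> \<le> linf_norm (u i)" "\<bar>v i $ b\<bar> \<le> linf_norm (v i)"
        using car[OF i] that by (auto intro!: linf_norm_ge)
      then have "\<bar>?s i\<bar> * (\<bar>u i $ a\<bar> * \<bar>v i $ b\<bar>) \<le> S * (linf_norm (u i) * linf_norm (v i))"
        using s[OF i] by (intro mult_mono mult_nonneg_nonneg linf_norm_nonneg) auto
      then show "\<bar>?s i * u i $ a * v i $ b\<bar> \<le> S * (linf_norm (u i) * linf_norm (v i))"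
        by (simp add: abs_mult mult.assoc)
    qed
    finally show ?thesis by (simp only: sum_distrib_left)
  qed
  have norm: "(\<Sum>a<n. (u i $ a)\<^sup>2) = 1" "(\<Sum>b<p. (v i $ b)\<^sup>2) = 1" if i: "i \<in> {1..r}" for i
  proof -
    have "u i \<bullet> u i = 1" "v i \<bullet> v i = 1"
      using sv i unfolding singular_vectors_def by auto
    then show "(\<Sum>a<n. (u i $ a)\<^sup>2) = 1" "(\<Sum>b<p. (v i $ b)\<^sup>2) = 1"
      using car[OF i] by (simp_all add: scalar_prod_def power2_eq_square atLeast0LessThan)
  qed
  have "(\<Sum>a<n. \<Sum>b<p. (X $$ (a, b))\<^sup>2) \<le> (\<Sum>a<n. \<Sum>b<p. (\<Sum>i=1..r. (?s i * u i $ a * v i $ b)\<^sup>2) * real r)"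
  proof (intro sum_mono)
    fix a b assume "a \<in> {..<n}" "b \<in> {..<p}"
    then have ab: "a < n" "b < p" by auto
    show "(X $$ (a, b))\<^sup>2 \<le> (\<Sum>i=1..r. (?s i * u i $ a * v i $ b)\<^sup>2) * real r"
      unfolding svd[OF ab] using sum_squared_le_sum_of_squares[of "\<lambda>i. ?s i * u i $ a * v i $ b" "{1..r}"] by simp
  qed
  also have "\<dots> = real r * (\<Sum>a<n. \<Sum>b<p. \<Sum>i=1..r. (?s i * u i $ a * v i $ b)\<^sup>2)"
    by (simp add: sum_distrib_left mult.commute)
  also have "(\<Sum>a<n. \<Sum>b<p. \<Sum>i=1..r. (?s i * u i $ a * v i $ b)\<^sup>2) =
    (\<Sum>i=1..r. \<Sum>a<n. \<Sum>b<p. (?s i)\<^sup>2 * ((u i $ a)\<^sup>2 * (v i $ b)\<^sup>2))"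
  proof -
    have "(\<Sum>a<n. \<Sum>b<p. \<Sum>i=1..r. (?s i * u i $ a * v i $ b)\<^sup>2) =
      (\<Sum>a<n. \<Sum>i=1..r. \<Sum>b<p. (?s i * u i $ a * v i $ b)\<^sup>2)"
      by (rule sum.cong[OF refl], rule sum.swap)
    also have "\<dots> = (\<Sum>i=1..r. \<Sum>a<n. \<Sum>b<p. (?s i * u i $ a * v i $ b)\<^sup>2)"
      by (rule sum.swap)
    finally show ?thesis by (simp only: power_mult_distrib mult.assoc)
  qed
  also have "\<dots> = (\<Sum>i=1..r. (?s i)\<^sup>2 * ((\<Sum>a<n. (u i $ a)\<^sup>2) * (\<Sum>b<p. (v i $ b)\<^sup>2)))"
    unfolding sum_product unfolding sum_distrib_left by (rule refl)
  also have "\<dots> = (\<Sum>i=1..r. (?s i)\<^sup>2)"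
    using norm by (intro sum.cong refl) simp
  also have "\<dots> \<le> (\<Sum>i=1..r. S\<^sup>2)"
    using s by (intro sum_mono power_mono) (auto intro: less_imp_le)
  finally show "(\<Sum>a<n. \<Sum>b<p. (X $$ (a, b))\<^sup>2) \<le> real r * (real r * S\<^sup>2)"
    by (simp add: mult_left_mono)
qed

text \<open>From here on the two settings differ only in their entry pattern. As a bound
  \<open>S\<close> that does not depend on \<open>n\<close>, the sum of the prescribed singular
  values, or of the absolute eigenvalues, is enough.\<close>

lemma settings_unified:
  assumes setting: "asymmetric_setting M \<mu> r X Z \<or> symmetric_setting M \<mu> r X Z"
    and sing_vecs: "\<forall>\<^sub>F n in sequentially. singular_vectors (X n) r (u n) (v n)"
  obtains p :: "nat \<Rightarrow> nat" and \<gamma> :: real and I :: "nat \<Rightarrow> (nat \<times> nat) set"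
      and \<kappa> :: "nat \<Rightarrow> nat \<Rightarrow> nat \<Rightarrow> nat \<times> nat" and S :: real where
    "(\<lambda>n. real (p n) / real n) \<longlonglongrightarrow> \<gamma>"
    "\<And>n. n \<ge> 1 \<Longrightarrow> entry_pattern n (p n) (I n) (\<kappa> n)"
    "\<And>n. n \<ge> 1 \<Longrightarrow> X n \<in> carrier_mat n (p n)"
    "\<And>n \<omega>. n \<ge> 1 \<Longrightarrow> \<omega> \<in> space M \<Longrightarrow> Z n \<omega> \<in> carrier_mat n (p n)"
    "\<And>n i j. n \<ge> 1 \<Longrightarrow> i < n \<Longrightarrow> j < p n \<Longrightarrow> X n $$ (i, j) = X n $$ \<kappa> n i j"
    "\<And>n i j \<omega>. n \<ge> 1 \<Longrightarrow> \<omega> \<in> space M \<Longrightarrow> i < n \<Longrightarrow> j < p n \<Longrightarrow> Z n \<omega> $$ (i, j) = Z n \<omega> $$ \<kappa> n i j"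
    "\<And>n. n \<ge> 1 \<Longrightarrow> iid_entries M \<mu> (I n) (Z n)"
    "\<forall>\<^sub>F n in sequentially. vec_space.rank n (X n) = r \<and>
      (\<forall>i\<in>{1..r}. 0 < singular_value i (X n) \<and> singular_value i (X n) \<le> S)"
  using setting
proof
  assume "asymmetric_setting M \<mu> r X Z"
  then obtain p :: "nat \<Rightarrow> nat" and \<gamma> :: real and s :: "nat \<Rightarrow> real" where
    p: "(\<lambda>n. real (p n) / real n) \<longlonglongrightarrow> \<gamma>"
    and car: "\<forall>n\<ge>1. X n \<in> carrier_mat n (p n)" "\<forall>n\<ge>1. \<forall>\<omega>\<in>space M. Z n \<omega> \<in> carrier_mat n (p n)"
    and s: "\<forall>i\<in>{1..r}. s i > 0"
    and ev: "\<forall>\<^sub>F n in sequentially. vec_space.rank n (X n) = r \<and> (\<forall>i\<in>{1..r}. singular_value i (X n) = s i)"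
    and iid: "\<forall>n\<ge>1. iid_entries M \<mu> ({..<n} \<times> {..<p n}) (Z n)"
    unfolding asymmetric_setting_def by blast
  show thesis
  proof (rule that[of p \<gamma> "\<lambda>n. {..<n} \<times> {..<p n}" "\<lambda>_. Pair" "\<Sum>i=1..r. s i"])
    show "\<forall>\<^sub>F n in sequentially. vec_space.rank n (X n) = r \<and>
      (\<forall>i\<in>{1..r}. 0 < singular_value i (X n) \<and> singular_value i (X n) \<le> (\<Sum>i=1..r. s i))"
      using ev
    proof eventually_elim
      case (elim n)
      have "s i \<le> (\<Sum>i=1..r. s i)" if "i \<in> {1..r}" for i
        using s that by (intro member_le_sum) (auto intro: less_imp_le)
      with elim s show ?case by auto
    qed
  qed (use p car iid in \<open>auto simp: entry_pattern_def\<close>)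
next
  assume "symmetric_setting M \<mu> r X Z"
  then obtain l :: "nat \<Rightarrow> real" where
    X: "\<forall>n\<ge>1. X n \<in> carrier_mat n n \<and> transpose_mat (X n) = X n"
    and Z: "\<forall>n\<ge>1. \<forall>\<omega>\<in>space M. Z n \<omega> \<in> carrier_mat n n \<and> transpose_mat (Z n \<omega>) = Z n \<omega>"
    and l: "\<forall>i\<in>{1..r}. l i \<noteq> 0" "inj_on l {1..r}"
    and ev: "\<forall>\<^sub>F n in sequentially. vec_space.rank n (X n) = r \<and>
      filter_mset (\<lambda>x. x \<noteq> 0) (eigenvalue_mset (X n)) = image_mset l (mset_set {1..r})"
    and iid: "\<forall>n\<ge>1. iid_entries M \<mu> {(i, j). i \<le> j \<and> j < n} (Z n)"
    unfolding symmetric_setting_def by blast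
  have sym: "W $$ (i, j) = W $$ edge i j" if "W \<in> carrier_mat n n" "transpose_mat W = W" "i < n" "j < n"
    for W :: "real mat" and n i j
  proof -
    have "transpose_mat W $$ (i, j) = W $$ (j, i)" using that(1,3,4) by simp
    then have "W $$ (i, j) = W $$ (j, i)" by (simp only: that(2))
    then show ?thesis by (auto simp: edge_def min_def max_def)
  qed
  show thesis
  proof (rule that[of "\<lambda>n. n" 1 "\<lambda>n. {(i, j). i \<le> j \<and> j < n}" "\<lambda>_. edge" "\<Sum>k\<in>{1..r}. \<bar>l k\<bar>"])
    have "\<forall>\<^sub>F n in sequentially. 1 = real n / real n"
      using eventually_gt_at_top[of 0] by eventually_elim simp
    then show "(\<lambda>n. real n / real n) \<longlonglongrightarrow> 1"
      by (rule Lim_transform_eventually[OF tendsto_const])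
    show "\<forall>\<^sub>F n in sequentially. vec_space.rank n (X n) = r \<and>
      (\<forall>i\<in>{1..r}. 0 < singular_value i (X n) \<and> singular_value i (X n) \<le> (\<Sum>k\<in>{1..r}. \<bar>l k\<bar>))"
      using ev sing_vecs eventually_ge_at_top[of 1]
    proof eventually_elim
      case (elim n)
      then have Xn: "X n \<in> carrier_mat n n" "transpose_mat (X n) = X n" using X by auto
      have "0 < singular_value i (X n)" if "i \<in> {1..r}" for i
        using l elim that by (intro singular_value_pos_symmetric[OF Xn, of r l]) auto
      moreover have "singular_value i (X n) \<le> (\<Sum>k\<in>{1..r}. \<bar>l k\<bar>)" if "i \<in> {1..r}" for i
        using elim that calculation[OF that]
        by (intro singular_value_abs_le_symmetric[OF Xn, of l r "u n" "v n"]) auto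
      ultimately show ?case using elim by blast
    qed
    show "X n $$ (i, j) = X n $$ edge i j" if "n \<ge> 1" "i < n" "j < n" for n i j
      using X that by (intro sym[of _ n]) auto
    show "Z n \<omega> $$ (i, j) = Z n \<omega> $$ edge i j" if "n \<ge> 1" "\<omega> \<in> space M" "i < n" "j < n" for n i j \<omega>
      using Z that by (intro sym[of _ n]) auto
  qed (use X Z iid in \<open>auto simp: entry_pattern_def\<close>)
qed

theorem theorem2p1:
  fixes M :: "'w measure" and \<mu> :: "real measure"
    and X :: "nat \<Rightarrow> real mat" and Z :: "nat \<Rightarrow> 'w \<Rightarrow> real mat"
    and r :: nat and u v :: "nat \<Rightarrow> nat \<Rightarrow> real Matrix.vec"
    and f :: "real \<Rightarrow> real" and q :: "nat \<Rightarrow> real poly"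
  assumes "prob_space M" and "real_distribution \<mu>"
    and setting: "asymmetric_setting M \<mu> r X Z \<or> symmetric_setting M \<mu> r X Z"
    and sing_vecs: "\<forall>\<^sub>F n in sequentially. singular_vectors (X n) r (u n) (v n)"
    and i: "\<forall>i\<in>{1..r}. (\<lambda>n. sqrt (real n) * linf_norm (u n i) * linf_norm (v n i)) \<longlonglongrightarrow> 0"
    and ii: "infinite (measure_support \<mu>)" "\<forall>k::nat. integrable \<mu> (\<lambda>x. x ^ k)"
    and iii: "polynomially_bounded f" "AE x in \<mu>. isCont f x"
    and q: "orthonormal_polys \<mu> q"
    and iv: "polynomial_approximation \<mu> q f"
    and "norm_mu \<mu> f > 0"
  shows "AE \<omega> in M. (\<lambda>n. op_norm (Y_mat f X Z n \<omega> - A_mat \<mu> q f X Z n \<omega>)) \<longlonglongrightarrow> 0"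
proof (rule settings_unified[OF setting sing_vecs], rule increment_versions[OF assms(2) ii(2) iii q iv \<open>norm_mu \<mu> f > 0\<close>])
  interpret prob_space M by fact
  fix p :: "nat \<Rightarrow> nat" and \<gamma> :: real and I :: "nat \<Rightarrow> (nat \<times> nat) set"
    and \<kappa> :: "nat \<Rightarrow> nat \<Rightarrow> nat \<Rightarrow> nat \<times> nat" and S :: real
  assume
    p: "(\<lambda>n. real (p n) / real n) \<longlonglongrightarrow> \<gamma>"
    and pat: "\<And>n. n \<ge> 1 \<Longrightarrow> entry_pattern n (p n) (I n) (\<kappa> n)"
    and Xc: "\<And>n. n \<ge> 1 \<Longrightarrow> X n \<in> carrier_mat n (p n)"
    and Zc: "\<And>n \<omega>. n \<ge> 1 \<Longrightarrow> \<omega> \<in> space M \<Longrightarrow> Z n \<omega> \<in> carrier_mat n (p n)"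
    and X\<kappa>: "\<And>n i j. n \<ge> 1 \<Longrightarrow> i < n \<Longrightarrow> j < p n \<Longrightarrow> X n $$ (i, j) = X n $$ \<kappa> n i j"
    and Z\<kappa>: "\<And>n i j \<omega>. n \<ge> 1 \<Longrightarrow> \<omega> \<in> space M \<Longrightarrow> i < n \<Longrightarrow> j < p n \<Longrightarrow> Z n \<omega> $$ (i, j) = Z n \<omega> $$ \<kappa> n i j"
    and iid: "\<And>n. n \<ge> 1 \<Longrightarrow> iid_entries M \<mu> (I n) (Z n)"
    and spec: "\<forall>\<^sub>F n in sequentially. vec_space.rank n (X n) = r \<and>
      (\<forall>i\<in>{1..r}. 0 < singular_value i (X n) \<and> singular_value i (X n) \<le> S)"
  fix \<delta> C :: real and \<phi> :: "real \<Rightarrow> real \<Rightarrow> real"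
  assume \<delta>: "0 < \<delta>" and \<phi>_meas: "\<And>x. \<phi> x \<in> borel_measurable borel"
    and \<phi>_eq: "\<And>x. \<bar>x\<bar> < \<delta> \<Longrightarrow> AE z in \<mu>. f (x + z) - f z = \<phi> x z"
    and \<phi>_int: "\<And>x k. \<bar>x\<bar> < \<delta> \<Longrightarrow> integrable \<mu> (\<lambda>z. \<phi> x z ^ k)"
    and \<phi>_16: "\<And>x. \<bar>x\<bar> < \<delta> \<Longrightarrow> (\<integral>z. \<phi> x z ^ 16 \<partial>\<mu>) \<le> C"
    and \<phi>_sq: "\<And>\<epsilon>. \<epsilon> > 0 \<Longrightarrow> \<forall>\<^sub>F x in nhds 0. (\<integral>z. (\<phi> x z)\<^sup>2 \<partial>\<mu>) \<le> \<epsilon>"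
    and \<phi>_mean: "\<And>\<epsilon>. \<epsilon> > 0 \<Longrightarrow> \<forall>\<^sub>F x in nhds 0. \<bar>(\<integral>z. \<phi> x z \<partial>\<mu>) - tau \<mu> q f * norm_mu \<mu> f * x\<bar> \<le> \<epsilon> * \<bar>x\<bar>"
  define c0 where "c0 = tau \<mu> q f * norm_mu \<mu> f"
  define x where "x n e = sqrt (real n) * X n $$ e" for n and e :: "nat \<times> nat"
  define Z' where "Z' n e \<omega> = Z n \<omega> $$ e" for n and e :: "nat \<times> nat" and \<omega>
  have x_small: "\<forall>\<^sub>F n in sequentially. \<forall>e\<in>I n. \<bar>x n e\<bar> < \<eta>" if "\<eta> > 0" for \<eta>
  proof -
    have "(\<lambda>n. \<Sum>i=1..r. sqrt (real n) * linf_norm (u n i) * linf_norm (v n i)) \<longlonglongrightarrow> (\<Sum>i=1..r. 0)"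
      using i by (intro tendsto_sum) auto
    then have "(\<lambda>n. S * (\<Sum>i=1..r. sqrt (real n) * linf_norm (u n i) * linf_norm (v n i))) \<longlonglongrightarrow> S * (\<Sum>i=1..r. 0)"
      by (rule tendsto_mult_left)
    then have "\<forall>\<^sub>F n in sequentially. S * (\<Sum>i=1..r. sqrt (real n) * linf_norm (u n i) * linf_norm (v n i)) < \<eta>"
      using that by (intro order_tendstoD) auto
    then show ?thesis
      using spec sing_vecs eventually_ge_at_top[of 1]
    proof eventually_elim
      case (elim n)
      show ?case
      proof
        fix e assume e: "e \<in> I n"
        obtain a b where ab: "e = (a, b)" "a < n" "b < p n"
          using entry_patternD(2)[OF pat[OF elim(4)]] e by (cases e) auto
        have "\<bar>X n $$ e\<bar> \<le> S * (\<Sum>i=1..r. linf_norm (u n i) * linf_norm (v n i))"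
          unfolding ab(1) using elim(2) by (intro low_rank_bounds(1)[OF Xc[OF elim(4)] _ elim(3) _ ab(2,3)]) auto
        then have "\<bar>x n e\<bar> \<le> sqrt (real n) * (S * (\<Sum>i=1..r. linf_norm (u n i) * linf_norm (v n i)))"
          by (simp add: x_def abs_mult mult_left_mono)
        also have "\<dots> = S * (\<Sum>i=1..r. sqrt (real n) * linf_norm (u n i) * linf_norm (v n i))"
          by (simp add: sum_distrib_left mult_ac)
        finally show "\<bar>x n e\<bar> < \<eta>" using elim(1) by linarith
      qed
    qed
  qed
  have x_Frobenius: "\<forall>\<^sub>F n in sequentially. (\<Sum>i<n. \<Sum>j<p n. (x n (\<kappa> n i j))\<^sup>2) \<le> real r * (real r * S\<^sup>2) * real n"
    using spec sing_vecs eventually_ge_at_top[of 1]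
  proof eventually_elim
    case (elim n)
    have "(\<Sum>i<n. \<Sum>j<p n. (x n (\<kappa> n i j))\<^sup>2) = (\<Sum>i<n. \<Sum>j<p n. real n * (X n $$ (i, j))\<^sup>2)"
      using X\<kappa>[OF elim(3)] by (intro sum.cong refl) (simp add: x_def power_mult_distrib)
    also have "\<dots> = (\<Sum>i<n. \<Sum>j<p n. (X n $$ (i, j))\<^sup>2) * real n"
      by (simp add: sum_distrib_left mult.commute)
    also have "\<dots> \<le> real r * (real r * S\<^sup>2) * real n"
      using elim(1) by (intro mult_right_mono low_rank_bounds(2)[OF Xc[OF elim(3)] _ elim(2)]) auto
    finally show ?case .
  qed
  interpret perturbed_noise M \<mu> x Z' p \<gamma> I \<kappa> \<phi> \<delta> C c0 "real r * (real r * S\<^sup>2)"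
  proof (rule perturbed_noise.intro[OF \<open>prob_space M\<close>], rule perturbed_noise_axioms.intro)
    show "indep_vars (\<lambda>_. borel) (Z' n) (I n)" if "n \<ge> 1" for n
      using iid[OF that] by (simp add: iid_entries_def Z'_def[abs_def])
    show "distr M borel (Z' n e) = \<mu>" if "n \<ge> 1" "e \<in> I n" for n e
      using iid[OF that(1)] that(2) by (simp add: iid_entries_def Z'_def[abs_def])
  qed (fact assms(2) p \<delta> x_Frobenius | erule pat x_small \<phi>_int \<phi>_16 \<phi>_sq
      \<phi>_mean[folded c0_def] | rule \<phi>_meas)+
  \<comment> \<open>The identity between \<open>\<phi>\<close> and the increment of \<open>f\<close>
    fails on a null set that depends on the position and on \<open>n\<close>. There are countably
    many such pairs, so one null set serves for all.\<close>
  have "AE \<omega> in M. n \<ge> 1 \<longrightarrow> e \<in> I n \<longrightarrow> \<bar>x n e\<bar> < \<delta> \<longrightarrow> f (x n e + Z n \<omega> $$ e) - f (Z n \<omega> $$ e) = \<phi> (x n e) (Z n \<omega> $$ e)" for n e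
  proof (cases "n \<ge> 1 \<and> e \<in> I n \<and> \<bar>x n e\<bar> < \<delta>")
    case True
    then have n: "n \<ge> 1" "e \<in> I n" "\<bar>x n e\<bar> < \<delta>" by auto
    have "AE z in distr M borel (Z' n e). f (x n e + z) - f z = \<phi> (x n e) z"
      unfolding distr[OF n(1,2)] by (rule \<phi>_eq[OF n(3)])
    from AE_distrD[OF Z_measurable[OF n(1,2)] this]
    show ?thesis by eventually_elim (simp add: Z'_def)
  qed auto
  then have eq: "AE \<omega> in M. \<forall>n e. n \<ge> 1 \<longrightarrow> e \<in> I n \<longrightarrow> \<bar>x n e\<bar> < \<delta> \<longrightarrow>
      f (x n e + Z n \<omega> $$ e) - f (Z n \<omega> $$ e) = \<phi> (x n e) (Z n \<omega> $$ e)"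
    by (simp add: AE_all_countable)
  \<comment> \<open>The bounds run over 1 / (k + 1), again to have only countably many exceptional
    null sets.\<close>
  have bound: "AE \<omega> in M. \<forall>k::nat. \<forall>\<^sub>F n in sequentially. mat_bound {..<n} {..<p n}
    (\<lambda>i j. \<phi> (x n (\<kappa> n i j)) (Z' n (\<kappa> n i j) \<omega>) - c0 * x n (\<kappa> n i j)) (2 * (1 / real (Suc k)) * sqrt n)"
    unfolding AE_all_countable by (intro allI AE_perturbation_bound) simp
  show ?thesis
    using eq bound AE_space
  proof eventually_elim
    case (elim \<omega>)
    note \<phi>_at = elim(1)
    have ev: "\<forall>\<^sub>F n in sequentially. 0 \<le> op_norm (Y_mat f X Z n \<omega> - A_mat \<mu> q f X Z n \<omega>) \<and>
      op_norm (Y_mat f X Z n \<omega> - A_mat \<mu> q f X Z n \<omega>) \<le> 2 * (1 / real (Suc k))" for k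
      using elim(2)[rule_format, of k] x_lt_\<delta> eventually_ge_at_top[of 1]
    proof eventually_elim
      case (elim n)
      note n = elim(3)
      note Xn = Xc[OF n] and Zn = Zc[OF n \<open>\<omega> \<in> space M\<close>]
      let ?D = "Y_mat f X Z n \<omega> - A_mat \<mu> q f X Z n \<omega>"
      let ?E = "\<lambda>i j. \<phi> (x n (\<kappa> n i j)) (Z' n (\<kappa> n i j) \<omega>) - c0 * x n (\<kappa> n i j)"
      have D: "?D \<in> carrier_mat n (p n)"
        unfolding Y_mat_def A_mat_def using Xn Zn by (intro carrier_matI) auto
      \<comment> \<open>The factor sqrt n inside \<open>x\<close> cancels against the normalization,
        which leaves \<open>c0\<close> times the unscaled signal.\<close>
      have entry: "1 / sqrt (real n) * ?E i j = ?D $$ (i, j)" if ij: "i \<in> {..<n}" "j \<in> {..<p n}" for i j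
      proof -
        have ij': "i < n" "j < p n" using ij by auto
        let ?e = "\<kappa> n i j"
        have e: "?e \<in> I n" by (rule entry_patternD(3)[OF pat[OF n] ij'])
        have "f (x n ?e + Z n \<omega> $$ ?e) - f (Z n \<omega> $$ ?e) = \<phi> (x n ?e) (Z n \<omega> $$ ?e)"
          using \<phi>_at n e elim(2) by blast
        then have "1 / sqrt (real n) * ?E i j =
          1 / sqrt (real n) * (f (x n ?e + Z n \<omega> $$ ?e) - f (Z n \<omega> $$ ?e) - c0 * x n ?e)"
          by (simp add: Z'_def)
        also have "\<dots> = 1 / sqrt (real n) * f (x n ?e + Z n \<omega> $$ ?e)
          - (c0 * X n $$ ?e + 1 / sqrt (real n) * f (Z n \<omega> $$ ?e))"
          using n by (simp add: x_def right_diff_distrib diff_divide_distrib)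
        also have "\<dots> = ?D $$ (i, j)"
          using Xn Zn ij' X\<kappa>[OF n ij'] Z\<kappa>[OF n \<open>\<omega> \<in> space M\<close> ij']
          by (simp add: Y_mat_def A_mat_def x_def c0_def)
        finally show ?thesis .
      qed
      have "mat_bound {..<n} {..<p n} (\<lambda>i j. 1 / sqrt (real n) * ?E i j)
        (1 / sqrt (real n) * (2 * (1 / real (Suc k)) * sqrt n))"
        by (rule mat_bound_scale[OF elim(1)]) simp
      then have "mat_bound {..<n} {..<p n} (\<lambda>i j. ?D $$ (i, j))
        (1 / sqrt (real n) * (2 * (1 / real (Suc k)) * sqrt n))"
        by (rule mat_bound_cong) (rule entry)
      moreover have "1 / sqrt (real n) * (2 * (1 / real (Suc k)) * sqrt n) = 2 * (1 / real (Suc k))"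
        using n by simp
      ultimately have "mat_bound {..<n} {..<p n} (\<lambda>i j. ?D $$ (i, j)) (2 * (1 / real (Suc k)))"
        by simp
      from op_norm_le_of_mat_bound[OF D this] show ?case by simp
    qed
    show ?case
    proof (rule tendstoI)
      fix \<epsilon> :: real assume "\<epsilon> > 0"
      then obtain k where k: "inverse (real (Suc k)) < \<epsilon> / 2"
        using reals_Archimedean[of "\<epsilon> / 2"] by auto
      from ev[of k] show "\<forall>\<^sub>F n in sequentially. dist (op_norm (Y_mat f X Z n \<omega> - A_mat \<mu> q f X Z n \<omega>)) 0 < \<epsilon>"
      proof eventually_elim
        case (elim n)
        moreover have "2 * (1 / real (Suc k)) < \<epsilon>" using k by (simp add: inverse_eq_divide)
        ultimately show ?case by (simp only: dist_real_def) linarith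
      qed
    qed
  qed
qed

end
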